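(* Let $n\ge1$, let $\psi:[0,\infty)\to[0,\infty)$ be an increasing function such that $\psi(x)\to\infty$ as $x\to\infty$, and let $$S=\sum_{k=0}^\infty\frac{\psi(k)}{1+k^2}.$$ (a) If $S=\infty$ and $f\in L^1(\mathbb{T}^n)$ satisfies $$\sum_{k\in\mathbb{Z}^n}|\widehat{f}(k)|\,e^{\psi(|k|)}<\infty$$ and $f$ vanishes on a set $\Lambda=\Lambda_1\times\cdots\times\Lambda_n$, where each $\Lambda_j$ is a set of positive Lebesgue measure in $\mathbb{T}$, then $f$ is zero almost everywhere. (b) If $S<\infty$, then there is a non-zero $f\in C^\infty(\mathbb{T}^n)$ which vanishes on a set of the form $\Lambda_1\times\cdots\times\Lambda_n$, where each $\Lambda_j\subset\mathbb{T}$ is a set of positive Lebesgue measure, and which satisfies $\sum_{k\in\mathbb{Z}^n}|\widehat{f}(k)|\,e^{\psi(|k|)}<\infty$.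
   Context: $\mathbb{T}^n=\{(e^{ix_1},\dots,e^{ix_n}):x_j\in[-\pi,\pi)\}$ is the $n$-dimensional torus, identified with $[-\pi,\pi)^n$ and carrying Lebesgue measure; sets of positive measure are Lebesgue measurable. $|k|$ is the Euclidean norm. "Increasing" means $x\le y\Rightarrow\psi(x)\le\psi(y)$. For $f\in L^1(\mathbb{T}^n)$, the Fourier coefficients are $\widehat{f}(k)=\frac{1}{(2\pi)^n}\int_{\mathbb{T}^n}f(x)e^{-ix\cdot k}\,dx$ for $k\in\mathbb{Z}^n$. *)

theory Defs
  imports "HOL-Analysis.Analysis"
begin

text \<open>The torus of dimension \<open>CARD('n)\<close> is identified with the half-open cube with sides
  \<open>[-\<pi>, \<pi>)\<close>, carrying the (unnormalised) Lebesgue measure.\<close>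

definition torus :: "(real ^ 'n) measure" where
  "torus = lebesgue_on {x. \<forall>j. x $ j \<in> {-pi..<pi}}"

definition of_int_vec :: "int ^ 'n \<Rightarrow> real ^ 'n" where
  "of_int_vec k = (\<chi> j. real_of_int (k $ j))"

definition fourier_coeff :: "(real ^ 'n \<Rightarrow> complex) \<Rightarrow> int ^ 'n \<Rightarrow> complex" where
  "fourier_coeff f k =
     (1 / (2 * of_real pi) ^ CARD('n)) *
     (LINT x|torus. f x * exp (- \<i> * of_real (x \<bullet> of_int_vec k)))"

definition product_set :: "('n \<Rightarrow> real set) \<Rightarrow> (real ^ 'n) set" where
  "product_set L = {x. \<forall>j. x $ j \<in> L j}"

definition positive_measure_subset :: "real set \<Rightarrow> bool" where
  "positive_measure_subset A \<longleftrightarrow>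
     A \<in> sets (lebesgue_on {-pi..<pi}) \<and> emeasure (lebesgue_on {-pi..<pi}) A > 0"

text \<open>Continuous differentiability of order \<open>m\<close>: all iterated directional derivatives up to
  order \<open>m\<close> exist and are continuous.\<close>

primrec C_k :: "nat \<Rightarrow> (real ^ 'n \<Rightarrow> complex) \<Rightarrow> bool" where
  "C_k 0 f \<longleftrightarrow> continuous_on UNIV f"
| "C_k (Suc m) f \<longleftrightarrow>
     (\<forall>x. f differentiable (at x)) \<and> (\<forall>v. C_k m (\<lambda>x. frechet_derivative f (at x) v))"

text \<open>A smooth function on the torus is a smooth function on the whole space that is
  \<open>2\<pi>\<close>-periodic in each coordinate; smoothness on the cube alone would not see the
  identification of opposite faces.\<close>

definition smooth_on_torus :: "(real ^ 'n \<Rightarrow> complex) \<Rightarrow> bool" where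
  "smooth_on_torus f \<longleftrightarrow>
     (\<forall>m. C_k m f) \<and> (\<forall>x j. f (x + axis j (2 * pi)) = f x)"

end

theory Submission
  imports Defs
begin

text \<open>
  (a) The series of \<open>f\<close>, restricted to a line parallel to a coordinate axis, is an exponential series
  \<open>u(x) = \<Sum> a\<^sub>l e\<^bsup>i t\<^sub>l x\<^esup>\<close> with \<open>\<Sum> |a\<^sub>l| e\<^bsup>\<psi>(|t\<^sub>l|)\<^esup> < \<infinity>\<close>, so everything rests on uniqueness for such \<open>u\<close>.
  If \<open>\<psi> \<ge> s\<close> beyond the frequency \<open>Y\<close> and \<open>|u| \<le> e\<^bsup>-s\<^esup>\<close> on a part of fixed relative density of an interval of
  length \<open>h = \<kappa> s / Y\<close>, then interpolating \<open>u\<close> at about \<open>\<eta> s\<close> separated points of that part gives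
  \<open>|u| \<le> e\<^bsup>-\<eta> s\<^esup>\<close> on the interval of twice the length. Start at a one-sided density point of the zero
  set and descend through the levels \<open>s\<^sub>i = \<eta>\<^bsup>-i\<^esup>\<close>: smallness at level \<open>s\<^sub>i\<close> on an interval becomes smallness at
  level \<open>s\<^sub>i\<^sub>-\<^sub>1\<close> on an interval longer by \<open>\<kappa> s\<^sub>i / Y\<^sub>i\<close>. Divergence of \<open>\<Sum> \<psi>(k) / (1 + k\<^sup>2)\<close> makes the sum
  of these increments infinite, so \<open>u\<close> vanishes on a half line, and by reflection everywhere.

  (b) Averaging \<open>max 0 cos\<close> successively over intervals of half-lengths \<open>a\<^sub>0, a\<^sub>1, \<dots>\<close> with small sum gives a smooth
  periodic function of one variable, vanishing on an interval, whose \<open>k\<close>-th Fourier coefficient is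
  \<open>O(\<Prod> min 1 (1 / (a\<^sub>i |k|)))\<close>. Using the half-length \<open>e / 2\<^sup>j\<close> about \<open>\<psi>(2\<^bsup>j+1\<^esup>) + 2 ln 2\<^bsup>j+1\<^esup>\<close> times makes this
  \<open>O(e\<^bsup>-\<psi>(|k|)\<^esup> / k\<^sup>2)\<close>, and the sum of the half-lengths converges because \<open>\<Sum> \<psi>(2\<^sup>j) / 2\<^sup>j\<close> does.
\<close>

subsection \<open>Propagation of smallness by interpolation\<close>

text \<open>The balance behind the one-step estimate: interpolating at m + 1 nodes spread over a set
  of relative density d amplifies errors only exponentially in m, while the Taylor remainder of
  order m decays like any prescribed exponential once \<open>h * Y\<close> is a small enough
  multiple of m. A degree proportional to s therefore leaves a fixed fraction of the exponent s.

  The obstacle in several variables is that the function is only known almost everywhere, while the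
  one-variable result must be applied on individual lines. So f is replaced by the sum of its
  absolutely convergent series, which is continuous, and every factor of the product set by a
  compact set near each point of which the factor has positive measure; the series then vanishes at
  every point of the smaller product.

  For (b) a function of a single coordinate is enough, because the other factors of the product set
  can be taken full. The averages are arranged so that splitting off one of them leaves a function
  of the same kind; smoothness and coefficient decay both follow from this self-similarity.\<close>

lemma power_div_fact_le_exp:
  fixes x :: real
  assumes "x \<ge> 0"
  shows "x ^ n / fact n \<le> exp x"
proof -
  have "(\<Sum>k\<in>{n}. x ^ k / fact k) \<le> (\<Sum>k. x ^ k / fact k)"
    using assms summable_exp_generic[of x]
    by (intro sum_le_suminf) (auto simp: divide_inverse mult.commute)
  then show ?thesis
    by (simp add: exp_def divide_inverse mult.commute)
qed

section \<open>Lagrange interpolation at separated nodes and its error on exponentials\<close>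

lemma lagrange_interpolation_exact:
  fixes z :: "'i \<Rightarrow> 'a :: field" and p :: "'a poly"
  assumes fin: "finite I" and inj: "inj_on z I" and deg: "degree p < card I"
  shows "poly p y = (\<Sum>i\<in>I. poly p (z i) * (\<Prod>l\<in>I-{i}. (y - z l) / (z i - z l)))"
proof -
  define q where "q = (\<Sum>i\<in>I. smult (poly p (z i)) (\<Prod>l\<in>I-{i}. smult (inverse (z i - z l)) [:- z l, 1:]))"
  have q: "poly q x = (\<Sum>i\<in>I. poly p (z i) * (\<Prod>l\<in>I-{i}. (x - z l) / (z i - z l)))" for x
    by (simp add: q_def poly_sum poly_prod divide_inverse left_diff_distrib mult.commute)
  have "degree q \<le> card I - 1"
    unfolding q_def
  proof (intro degree_sum_le fin)
    fix i assume i: "i \<in> I"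
    have "degree (smult (poly p (z i)) (\<Prod>l\<in>I-{i}. smult (inverse (z i - z l)) [:- z l, 1:]))
        \<le> degree (\<Prod>l\<in>I-{i}. smult (inverse (z i - z l)) [:- z l, 1:])"
      by (rule degree_smult_le)
    also have "\<dots> \<le> (\<Sum>l\<in>I-{i}. degree (smult (inverse (z i - z l)) [:- z l, 1:]))"
      using degree_prod_sum_le[of "I-{i}" "\<lambda>l. smult (inverse (z i - z l)) [:- z l, 1:]"] fin by (simp add: o_def)
    also have "\<dots> \<le> (\<Sum>l\<in>I-{i}. 1)"
      by (intro sum_mono) auto
    finally show "degree (smult (poly p (z i)) (\<Prod>l\<in>I-{i}. smult (inverse (z i - z l)) [:- z l, 1:])) \<le> card I - 1"
      using fin i by (simp add: card_Diff_singleton)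
  qed
  moreover have "poly q (z j) = poly p (z j)" if j: "j \<in> I" for j
  proof -
    have "(\<Prod>l\<in>I-{i}. (z j - z l) / (z i - z l)) = (if i = j then 1 else 0)" if "i \<in> I" for i
    proof (cases "i = j")
      case True
      have "z j \<noteq> z l" if "l \<in> I - {j}" for l
        using inj j that by (auto dest: inj_onD)
      with True show ?thesis by (auto intro!: prod.neutral)
    next
      case False
      then have "j \<in> I - {i}" using j by simp
      then show ?thesis using False fin by (auto intro!: prod_zero)
    qed
    then have "poly q (z j) = (\<Sum>i\<in>I. if i = j then poly p (z i) else 0)"
      unfolding q by (intro sum.cong) auto
    also have "\<dots> = poly p (z j)" using j fin by simp
    finally show ?thesis .
  qed
  ultimately have "p = q"
    using deg inj by (intro poly_eqI_degree[of "z ` I"]) (auto simp: card_image)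
  then show ?thesis using q by metis
qed

lemma prod_abs_diff_eq_fact:
  assumes "i \<le> m"
  shows "(\<Prod>l\<in>{..m}-{i}. \<bar>real i - real l\<bar>) = fact i * fact (m - i)"
proof -
  have split: "{..m} - {i} = {..<i} \<union> {i<..m}" using assms by auto
  have "(\<Prod>l\<in>{..<i}. \<bar>real i - real l\<bar>) = (\<Prod>l\<in>{..<i}. real (i - l))"
    by (intro prod.cong) auto
  also have "\<dots> = (\<Prod>k\<in>{1..i}. real k)"
    by (rule prod.reindex_bij_witness[of _ "\<lambda>k. i - k" "\<lambda>l. i - l"]) auto
  finally have 1: "(\<Prod>l\<in>{..<i}. \<bar>real i - real l\<bar>) = fact i"
    by (simp add: fact_prod)
  have "(\<Prod>l\<in>{i<..m}. \<bar>real i - real l\<bar>) = (\<Prod>k\<in>{1..m-i}. real k)"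
    by (rule prod.reindex_bij_witness[of _ "\<lambda>k. k + i" "\<lambda>l. l - i"]) (use assms in auto)
  then have 2: "(\<Prod>l\<in>{i<..m}. \<bar>real i - real l\<bar>) = fact (m - i)"
    by (simp add: fact_prod)
  have "(\<Prod>l\<in>{..<i} \<union> {i<..m}. \<bar>real i - real l\<bar>)
      = (\<Prod>l\<in>{..<i}. \<bar>real i - real l\<bar>) * (\<Prod>l\<in>{i<..m}. \<bar>real i - real l\<bar>)"
    by (intro prod.union_disjoint) auto
  then show ?thesis unfolding split 1 2 .
qed

text \<open>Comparison with equally spaced nodes: their denominators are
  \<open>fact i * fact (m - i)\<close>, and summing over i turns the reciprocals into binomial
  coefficients. What remains, \<open>(m + 1) ^ m / fact m\<close>, is at most
  \<open>exp (m + 1)\<close>, so the growth is only exponential in m.\<close>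

lemma lebesgue_constant_bound:
  fixes z :: "nat \<Rightarrow> real"
  assumes d: "0 < d" "d \<le> 1" and h: "h > 0"
    and sep: "\<And>i l. i \<le> m \<Longrightarrow> l \<le> m \<Longrightarrow> d * h / real (m + 1) * \<bar>real i - real l\<bar> \<le> \<bar>z i - z l\<bar>"
    and y: "\<And>l. l \<le> m \<Longrightarrow> \<bar>y - z l\<bar> \<le> 2 * h"
  shows "(\<Sum>i\<le>m. \<Prod>l\<in>{..m}-{i}. \<bar>(y - z l) / (z i - z l)\<bar>) \<le> (4 * exp 1 / d) ^ (m + 1)"
proof -
  define \<delta> where "\<delta> = d * h / real (m + 1)"
  have \<delta>: "\<delta> > 0" using d h by (simp add: \<delta>_def)
  have "(\<Prod>l\<in>{..m}-{i}. \<bar>(y - z l) / (z i - z l)\<bar>) \<le> (2 * h / \<delta>) ^ m / fact m * real (m choose i)"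
    if i: "i \<le> m" for i
  proof -
    have "(\<Prod>l\<in>{..m}-{i}. \<bar>(y - z l) / (z i - z l)\<bar>)
        \<le> (\<Prod>l\<in>{..m}-{i}. (2 * h / \<delta>) / \<bar>real i - real l\<bar>)"
    proof (intro prod_mono conjI)
      fix l assume l: "l \<in> {..m}-{i}"
      have pos: "\<delta> * \<bar>real i - real l\<bar> > 0" using l \<delta> by simp
      have "\<bar>y - z l\<bar> / \<bar>z i - z l\<bar> \<le> 2 * h / (\<delta> * \<bar>real i - real l\<bar>)"
        using l i y[of l] sep[of i l] pos h by (intro frac_le) (auto simp: \<delta>_def add.commute)
      then show "\<bar>(y - z l) / (z i - z l)\<bar> \<le> (2 * h / \<delta>) / \<bar>real i - real l\<bar>"
        by (simp add: abs_divide)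
    qed auto
    also have "\<dots> = (2 * h / \<delta>) ^ m / (fact i * fact (m - i))"
      unfolding prod_dividef prod_abs_diff_eq_fact[OF i] using i by (simp add: card_Diff_singleton power_divide power_mult_distrib)
    also have "\<dots> = (2 * h / \<delta>) ^ m / fact m * real (m choose i)"
      using i by (simp add: binomial_fact)
    finally show ?thesis .
  qed
  then have "(\<Sum>i\<le>m. \<Prod>l\<in>{..m}-{i}. \<bar>(y - z l) / (z i - z l)\<bar>)
      \<le> (\<Sum>i\<le>m. (2 * h / \<delta>) ^ m / fact m * real (m choose i))"
    by (intro sum_mono) auto
  also have "\<dots> = (2 * h / \<delta>) ^ m / fact m * 2 ^ m"
  proof -
    have "(\<Sum>i\<le>m. real (m choose i)) = 2 ^ m"
      by (metis choose_row_sum of_nat_numeral of_nat_power of_nat_sum)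
    then show ?thesis unfolding sum_distrib_left[symmetric] by simp
  qed
  also have "\<dots> = (4 / d) ^ m * ((real (m + 1)) ^ m / fact m)"
  proof -
    have "2 * h / \<delta> = 2 * real (m + 1) / d" using h d by (simp add: \<delta>_def field_simps)
    then show ?thesis by (simp add: power_divide power_mult_distrib flip: power_mult_distrib)
  qed
  also have "\<dots> \<le> (4 / d) ^ (m + 1) * exp (real (m + 1))"
    using d by (intro mult_mono power_increasing power_div_fact_le_exp) auto
  also have "exp (real (m + 1)) = exp 1 ^ (m + 1)"
    by (metis exp_of_nat_mult mult.right_neutral)
  also have "(4 / d) ^ (m + 1) * exp 1 ^ (m + 1) = (4 * exp 1 / d) ^ (m + 1)"
    by (simp only: times_divide_eq_left flip: power_mult_distrib)
  finally show ?thesis .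
qed

lemma has_sum_finite_sum:
  fixes f :: "'i \<Rightarrow> 'a \<Rightarrow> 'b :: topological_comm_monoid_add"
  assumes "finite I" "\<And>i. i \<in> I \<Longrightarrow> (f i has_sum s i) A"
  shows "((\<lambda>x. \<Sum>i\<in>I. f i x) has_sum (\<Sum>i\<in>I. s i)) A"
  using assms by (induction I rule: finite_induct) (auto intro!: has_sum_add)

lemma cis_Taylor_poly:
  "cmod (cis \<theta> - (\<Sum>k\<le>m. (\<i> * of_real \<theta>) ^ k / fact k)) \<le> \<bar>\<theta>\<bar> ^ (m + 1) / fact m"
  using Taylor_exp[of "\<i> * of_real \<theta>" m] by (simp add: cis_conv_exp norm_mult)

text \<open>The interpolation error functional annihilates polynomials of degree at most \<open>m\<close>, so on an
  exponential of frequency at most \<open>Y\<close> it only sees the remainder of the Taylor expansion.\<close>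

lemma interpolation_error_cis:
  fixes z :: "nat \<Rightarrow> real" and t Y h p y :: real and m :: nat
  defines "w \<equiv> \<lambda>i. \<Prod>l\<in>{..m}-{i}. (y - z l) / (z i - z l)"
  assumes inj: "inj_on z {..m}" and z: "\<And>i. i \<le> m \<Longrightarrow> \<bar>z i - p\<bar> \<le> 2 * h"
    and y: "\<bar>y - p\<bar> \<le> 2 * h" and h: "h \<ge> 0" and t: "\<bar>t\<bar> \<le> Y"
  shows "cmod (cis (t * y) - (\<Sum>i\<le>m. of_real (w i) * cis (t * z i)))
     \<le> (1 + (\<Sum>i\<le>m. \<bar>w i\<bar>)) * ((2 * h * Y) ^ (m + 1) / fact m)"
proof -
  define q :: "complex poly" where "q = (\<Sum>k\<le>m. monom ((\<i> * of_real t) ^ k / fact k) k)"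
  define R where "R x = cis (t * (x - p)) - poly q (of_real (x - p))" for x
  have deg: "degree q \<le> m"
    unfolding q_def by (intro degree_sum_le) (auto intro: order.trans[OF degree_monom_le])
  have R: "cmod (R x) \<le> (2 * h * Y) ^ (m + 1) / fact m" if "\<bar>x - p\<bar> \<le> 2 * h" for x
  proof -
    have "poly q (of_real (x - p)) = (\<Sum>k\<le>m. (\<i> * of_real (t * (x - p))) ^ k / fact k)"
      by (simp add: q_def poly_sum poly_monom power_mult_distrib mult_ac)
    then have "cmod (R x) \<le> \<bar>t * (x - p)\<bar> ^ (m + 1) / fact m"
      unfolding R_def using cis_Taylor_poly[of "t * (x - p)" m] by simp
    also have "\<dots> \<le> (2 * h * Y) ^ (m + 1) / fact m"
    proof (intro divide_right_mono power_mono)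
      show "\<bar>t * (x - p)\<bar> \<le> 2 * h * Y"
        using mult_mono[OF t that] t h by (simp add: abs_mult mult_ac)
    qed auto
    finally show ?thesis .
  qed
  have exact: "poly q (of_real (y - p)) = (\<Sum>i\<le>m. of_real (w i) * poly q (of_real (z i - p)))"
  proof -
    have "inj_on (\<lambda>i. complex_of_real (z i - p)) {..m}"
      using inj by (auto simp: inj_on_def)
    from lagrange_interpolation_exact[OF _ this, of q "of_real (y - p)"]
    have "poly q (of_real (y - p)) = (\<Sum>i\<le>m. poly q (of_real (z i - p)) *
       (\<Prod>l\<in>{..m}-{i}. (of_real (y - p) - of_real (z l - p)) / (of_real (z i - p) - of_real (z l - p))))"
      using deg by (simp del: of_real_diff)
    also have "\<dots> = (\<Sum>i\<le>m. of_real (w i) * poly q (of_real (z i - p)))"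
      unfolding w_def of_real_prod by (intro sum.cong refl) (simp add: mult.commute)
    finally show ?thesis .
  qed
  \<comment> \<open>The expansion is about \<open>p\<close>: splitting off the unimodular factor
    \<open>cis (t * p)\<close> lets the Taylor polynomials cancel by \<open>exact\<close>, which
    leaves the remainders \<open>R\<close>.\<close>
  have "cis (t * y) - (\<Sum>i\<le>m. of_real (w i) * cis (t * z i))
      = cis (t * p) * (cis (t * (y - p)) - (\<Sum>i\<le>m. of_real (w i) * cis (t * (z i - p))))"
    by (simp add: cis_mult right_diff_distrib sum_distrib_left mult.left_commute[of "cis _"] algebra_simps)
  also have "cis (t * (y - p)) - (\<Sum>i\<le>m. of_real (w i) * cis (t * (z i - p)))
      = R y - (\<Sum>i\<le>m. of_real (w i) * R (z i))"
    unfolding R_def exact right_diff_distrib sum_subtractf by simp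
  finally have "cmod (cis (t * y) - (\<Sum>i\<le>m. of_real (w i) * cis (t * z i)))
      \<le> cmod (R y) + (\<Sum>i\<le>m. \<bar>w i\<bar> * cmod (R (z i)))"
    by (simp add: norm_mult)
       (rule order.trans[OF norm_triangle_ineq4], intro add_left_mono order.trans[OF norm_sum],
         simp add: norm_mult)
  also have "\<dots> \<le> (2 * h * Y) ^ (m + 1) / fact m + (\<Sum>i\<le>m. \<bar>w i\<bar> * ((2 * h * Y) ^ (m + 1) / fact m))"
    using R y z by (intro add_mono sum_mono mult_left_mono) auto
  finally show ?thesis by (simp only: sum_distrib_right distrib_right mult_1)
qed

text \<open>Greedy choice: take the least point of \<open>Z\<close> and discard the following
  stretch of length \<delta>, which costs at most \<delta> of measure. The strict inequality leaves
  a nonempty set for the last point.\<close>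

lemma separated_points:
  fixes Z :: "real set"
  assumes "compact Z" "measure lebesgue Z > real m * \<delta>" "\<delta> \<ge> 0"
  shows "\<exists>z. (\<forall>i\<le>m. z i \<in> Z) \<and> (\<forall>i<m. z i + \<delta> \<le> z (Suc i))"
  using assms
proof (induction m arbitrary: Z)
  case 0
  then have "Z \<noteq> {}" by auto
  then obtain x where "x \<in> Z" by blast
  then show ?case by (intro exI[of _ "\<lambda>_. x"]) auto
next
  case (Suc m)
  then have ne: "Z \<noteq> {}"
    by (metis less_eq_real_def linorder_not_less measure_empty mult_nonneg_nonneg of_nat_0_le_iff)
  obtain x where x: "x \<in> Z" "\<And>y. y \<in> Z \<Longrightarrow> x \<le> y"
    using compact_attains_inf[OF \<open>compact Z\<close> ne] by blast
  define Z' where "Z' = Z \<inter> {x + \<delta>..}"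
  have cZ': "compact Z'" unfolding Z'_def using Suc.prems by (intro compact_Int_closed) auto
  have "Z \<subseteq> {x..x+\<delta>} \<union> Z'" using x by (auto simp: Z'_def)
  then have "measure lebesgue Z \<le> measure lebesgue ({x..x+\<delta>} \<union> Z')"
    using Suc.prems cZ' by (intro measure_mono_fmeasurable) (auto intro: lmeasurable_compact fmeasurable.Un fmeasurableD)
  also have "\<dots> \<le> measure lebesgue {x..x+\<delta>} + measure lebesgue Z'"
    using cZ' by (intro measure_Un_le) (auto intro: lmeasurable_compact fmeasurableD)
  finally have "measure lebesgue Z' > real m * \<delta>"
    using Suc.prems by (simp add: algebra_simps)
  from Suc.IH[OF cZ' this \<open>\<delta> \<ge> 0\<close>] obtain z where
    z: "\<forall>i\<le>m. z i \<in> Z'" "\<forall>i<m. z i + \<delta> \<le> z (Suc i)" by blast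
  show ?case
    using z x by (intro exI[of _ "\<lambda>i. case i of 0 \<Rightarrow> x | Suc j \<Rightarrow> z j"]) (auto simp: Z'_def split: nat.splits)
qed

lemma separated_imp_abs_diff_ge:
  fixes z :: "nat \<Rightarrow> real"
  assumes "\<And>i. i < m \<Longrightarrow> z i + \<delta> \<le> z (Suc i)" "i \<le> m" "l \<le> m" "\<delta> \<ge> 0"
  shows "\<delta> * \<bar>real i - real l\<bar> \<le> \<bar>z i - z l\<bar>"
proof -
  have *: "z i + \<delta> * real k \<le> z (i + k)" if "i + k \<le> m" for i k
    using that
  proof (induction k)
    case (Suc k)
    then have "z i + \<delta> * real k \<le> z (i + k)" "z (i + k) + \<delta> \<le> z (Suc (i + k))" using assms(1) by auto
    then show ?case by (simp add: algebra_simps)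
  qed auto
  show ?thesis
    using *[of i "l - i"] *[of l "i - l"] assms(2-4)
    by (cases "i \<le> l") (auto simp: of_nat_diff algebra_simps abs_if)
qed

text \<open>The interpolation error \<open>c l\<close> of a single exponential is small by Taylor
  expansion up to frequency \<open>Y\<close>; beyond it the coefficient already carries the factor
  \<tau> and a crude bound suffices. Of the factor 3, two come from the error functional, whose norm
  is at most \<open>1 + B\<close>, and one from the interpolated values.\<close>

lemma interpolation_smallness:
  fixes a :: "'i \<Rightarrow> complex" and t b :: "'i \<Rightarrow> real" and f :: "real \<Rightarrow> complex"
  assumes f: "\<And>x. ((\<lambda>l. a l * cis (t l * x)) has_sum f x) UNIV"
    and b: "(b has_sum A) UNIV" and ab: "\<And>l. cmod (a l) \<le> b l"
    and ab': "\<And>l. \<bar>t l\<bar> > Y \<Longrightarrow> cmod (a l) \<le> b l * \<tau>" and \<tau>: "\<tau> \<ge> 0"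
    and Z: "compact Z" "Z \<subseteq> {p..p+h}" "measure lebesgue Z \<ge> d * h"
    and small: "\<And>x. x \<in> Z \<Longrightarrow> cmod (f x) \<le> A * \<tau>"
    and d: "0 < d" "d \<le> 1" and h: "h > 0" and Y: "Y \<ge> 0" and y: "y \<in> {p..p+2*h}"
  shows "cmod (f y) \<le> A * (3 * (4 * exp 1 / d) ^ (m + 1) * (\<tau> + (2 * h * Y) ^ (m + 1) / fact m))"
proof -
  define \<delta> where "\<delta> = d * h / real (m + 1)"
  define B where "B = (4 * exp 1 / d) ^ (m + 1)"
  have \<delta>: "\<delta> > 0" using d h by (simp add: \<delta>_def)
  have A: "A \<ge> 0" using b ab by (meson has_sum_nonneg norm_ge_zero order_trans)
  have b0: "b l \<ge> 0" for l using ab norm_ge_zero order_trans by blast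
  have "real m * \<delta> < d * h" using d h by (simp add: \<delta>_def field_simps)
  then obtain z where z: "\<And>i. i \<le> m \<Longrightarrow> z i \<in> Z" "\<And>i. i < m \<Longrightarrow> z i + \<delta> \<le> z (Suc i)"
    using separated_points[OF Z(1), of m \<delta>] Z(3) \<delta> by (meson less_eq_real_def order.strict_trans2)
  have sep: "\<delta> * \<bar>real i - real l\<bar> \<le> \<bar>z i - z l\<bar>" if "i \<le> m" "l \<le> m" for i l
    using separated_imp_abs_diff_ge[of m z \<delta> i l, OF z(2) that] \<delta> by simp
  have inj: "inj_on z {..m}"
  proof (rule inj_onI)
    fix i l assume *: "i \<in> {..m}" "l \<in> {..m}" "z i = z l"
    then have "\<delta> * \<bar>real i - real l\<bar> \<le> 0" using sep[of i l] by simp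
    then show "i = l" using \<delta> by (simp add: mult_le_0_iff)
  qed
  have zI: "z i \<in> {p..p+h}" if "i \<le> m" for i using z(1)[OF that] Z(2) by auto
  define w where "w i = (\<Prod>l\<in>{..m}-{i}. (y - z l) / (z i - z l))" for i
  have "(\<Sum>i\<le>m. \<Prod>l\<in>{..m}-{i}. \<bar>(y - z l) / (z i - z l)\<bar>) \<le> B"
  proof -
    have "\<bar>y - z l\<bar> \<le> 2 * h" if "l \<le> m" for l using zI[OF that] y h by (auto simp: abs_le_iff)
    from lebesgue_constant_bound[OF d h sep[unfolded \<delta>_def] this] show ?thesis
      unfolding B_def by blast
  qed
  then have W: "(\<Sum>i\<le>m. \<bar>w i\<bar>) \<le> B" by (simp add: w_def abs_prod)
  have B1: "B \<ge> 1" unfolding B_def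
  proof (rule one_le_power)
    have "exp 1 \<ge> (1::real)" by simp
    then have "d \<le> 4 * exp 1" using d by linarith
    then show "1 \<le> 4 * exp 1 / d" using d by simp
  qed
  define \<epsilon> where "\<epsilon> = \<tau> + (2 * h * Y) ^ (m + 1) / fact m"
  have \<epsilon>: "\<epsilon> \<ge> \<tau>" "\<epsilon> \<ge> (2 * h * Y) ^ (m + 1) / fact m" using \<tau> h Y by (auto simp: \<epsilon>_def)
  define c where "c l = cis (t l * y) - (\<Sum>i\<le>m. of_real (w i) * cis (t l * z i))" for l
  have "((\<lambda>l. \<Sum>i\<le>m. of_real (w i) * (a l * cis (t l * z i))) has_sum (\<Sum>i\<le>m. of_real (w i) * f (z i))) UNIV"
    by (rule has_sum_finite_sum) (auto intro: has_sum_cmult_right f)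
  then have "((\<lambda>l. a l * cis (t l * y) - (\<Sum>i\<le>m. of_real (w i) * (a l * cis (t l * z i)))) has_sum
      (f y - (\<Sum>i\<le>m. of_real (w i) * f (z i)))) UNIV"
    unfolding diff_conv_add_uminus
    using has_sum_uminus[THEN iffD2] f by (intro has_sum_add) (auto simp: has_sum_uminus)
  then have hs: "((\<lambda>l. a l * c l) has_sum (f y - (\<Sum>i\<le>m. of_real (w i) * f (z i)))) UNIV"
    by (simp add: c_def right_diff_distrib sum_distrib_left mult.left_commute)
  have cb: "cmod (a l * c l) \<le> b l * (2 * B * \<epsilon>)" for l
  proof (cases "\<bar>t l\<bar> \<le> Y")
    case True
    have "cmod (c l) \<le> (1 + (\<Sum>i\<le>m. \<bar>w i\<bar>)) * ((2 * h * Y) ^ (m + 1) / fact m)"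
      unfolding c_def w_def
    proof (rule interpolation_error_cis[OF inj _ _ _ True])
      show "\<bar>z i - p\<bar> \<le> 2 * h" if "i \<le> m" for i using zI[OF that] h by auto
    qed (use y h in auto)
    also have "\<dots> \<le> (2 * B) * \<epsilon>"
      using W B1 \<epsilon> h Y by (intro mult_mono) auto
    finally show ?thesis using ab[of l] b0[of l] by (auto simp: norm_mult intro!: mult_mono)
  next
    case False
    have "cmod (c l) \<le> 1 + (\<Sum>i\<le>m. \<bar>w i\<bar>)" unfolding c_def
      by (rule order.trans[OF norm_triangle_ineq4], intro add_mono order.trans[OF norm_sum])
         (auto simp: norm_mult)
    also have "\<dots> \<le> 2 * B" using W B1 by simp
    finally have "cmod (a l * c l) \<le> (b l * \<tau>) * (2 * B)"
      unfolding norm_mult using ab'[of l] False b0[of l] \<tau> by (intro mult_mono) auto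
    also have "\<dots> \<le> b l * (2 * B * \<epsilon>)"
    proof -
      have "\<tau> * (b l * (2 * B)) \<le> \<epsilon> * (b l * (2 * B))"
        using \<epsilon>(1) b0[of l] B1 by (intro mult_right_mono) auto
      then show ?thesis by (simp only: mult_ac)
    qed
    finally show ?thesis .
  qed
  have "cmod (f y - (\<Sum>i\<le>m. of_real (w i) * f (z i))) \<le> A * (2 * B * \<epsilon>)"
    by (rule norm_infsum_le[OF hs has_sum_cmult_left[OF b]]) (use cb in auto)
  moreover have "cmod (\<Sum>i\<le>m. of_real (w i) * f (z i)) \<le> (A * \<epsilon>) * B"
  proof -
    have "cmod (\<Sum>i\<le>m. of_real (w i) * f (z i)) \<le> (\<Sum>i\<le>m. \<bar>w i\<bar> * (A * \<epsilon>))"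
    proof (rule order.trans[OF norm_sum], rule sum_mono)
      fix i assume "i \<in> {..m}"
      then have "cmod (f (z i)) \<le> A * \<tau>" using z small by simp
      also have "\<dots> \<le> A * \<epsilon>" using A \<epsilon> by (simp add: mult_left_mono)
      finally show "cmod (of_real (w i) * f (z i)) \<le> \<bar>w i\<bar> * (A * \<epsilon>)"
        by (simp add: norm_mult mult_left_mono)
    qed
    also have "\<dots> = (A * \<epsilon>) * (\<Sum>i\<le>m. \<bar>w i\<bar>)" by (simp add: sum_distrib_left mult_ac)
    also have "\<dots> \<le> (A * \<epsilon>) * B" using W A \<epsilon> \<tau> by (intro mult_left_mono) auto
    finally show ?thesis .
  qed
  ultimately have "cmod (f y) \<le> A * (2 * B * \<epsilon>) + (A * \<epsilon>) * B"
    using norm_triangle_ineq[of "f y - (\<Sum>i\<le>m. of_real (w i) * f (z i))" "\<Sum>i\<le>m. of_real (w i) * f (z i)"]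
    unfolding diff_add_cancel by linarith
  also have "A * (2 * B * \<epsilon>) + (A * \<epsilon>) * B = A * (3 * B * \<epsilon>)" by (simp add: algebra_simps)
  finally show ?thesis unfolding B_def \<epsilon>_def .
qed

text \<open>The constants depend on the density \<open>d\<close> alone, so the same ones serve at
  every level and on every interval.\<close>

lemma propagation_of_smallness:
  fixes d :: real
  assumes d: "0 < d" "d \<le> 1"
  obtains \<eta> \<kappa> s0 :: real where "0 < \<eta>" "\<eta> < 1" "\<kappa> > 0" "s0 > 0"
    "\<And>(a :: 'i \<Rightarrow> complex) t b f A s Y Z p h y. \<lbrakk>
       \<And>x. ((\<lambda>l. a l * cis (t l * x)) has_sum f x) UNIV; (b has_sum A) UNIV;
       \<And>l. cmod (a l) \<le> b l; \<And>l. \<bar>t l\<bar> > Y \<Longrightarrow> cmod (a l) \<le> b l * exp (- s);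
       compact Z; Z \<subseteq> {p..p+h}; measure lebesgue Z \<ge> d * h;
       \<And>x. x \<in> Z \<Longrightarrow> cmod (f x) \<le> A * exp (- s);
       s \<ge> s0; Y > 0; 0 < h; h * Y \<le> \<kappa> * s; y \<in> {p..p+2*h} \<rbrakk>
     \<Longrightarrow> cmod (f y) \<le> A * exp (- (\<eta> * s))"
proof -
  define B where "B = 4 * exp 1 / d"
  have e2: "exp 1 \<ge> (2::real)" using exp_ge_add_one_self[of 1] by simp
  have "B \<ge> exp 1" using d by (simp add: B_def field_simps)
  then have B: "B > 1" "ln B \<ge> 1"
    using e2 by (auto simp: ln_ge_iff)
  \<comment> \<open>For degree about \<open>\<mu> * s\<close> the amplification
    \<open>B powr (\<mu> * s)\<close> is exactly \<open>exp (s / 2)\<close>, so half of the given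
    exponent s survives.\<close>
  define \<mu> where "\<mu> = 1 / (2 * ln B)"
  have \<mu>: "0 < \<mu>" "\<mu> \<le> 1/2" using B by (auto simp: \<mu>_def field_simps)
  \<comment> \<open>Chosen so that \<open>4 * exp 1 * \<kappa> / \<mu> = exp (-1) / B\<close>: the
    Taylor remainder then absorbs the amplification \<open>B ^ M\<close> and still leaves
    \<open>exp (- real M)\<close>.\<close>
  define \<kappa> where "\<kappa> = \<mu> / (4 * exp 2 * B)"
  have \<kappa>: "\<kappa> > 0" using \<mu> B by (simp add: \<kappa>_def)
  \<comment> \<open>The square comes from rounding the degree up, as \<open>M\<close> is at most
    \<open>\<mu> * s + 2\<close>. From \<open>s0\<close> on, the factor \<open>D\<close> costs at
    most half of the exponent \<open>\<mu> * s\<close>, which gives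
    \<open>\<eta> = \<mu> / 2\<close>.\<close>
  define D where "D = 3 * B\<^sup>2 + 3"
  have D: "D > 1" using B by (simp add: D_def add_pos_nonneg)
  define s0 where "s0 = 2 * ln D / \<mu>"
  have s0: "s0 > 0" using D \<mu> by (simp add: s0_def)
  have main: "cmod (f y) \<le> A * exp (- (\<mu> / 2 * s))"
    if f: "\<And>x. ((\<lambda>l. a l * cis (t l * x)) has_sum f x) UNIV" and b: "(b has_sum A) UNIV"
      and ab: "\<And>l. cmod (a l) \<le> b l" and ab': "\<And>l. \<bar>t l\<bar> > Y \<Longrightarrow> cmod (a l) \<le> b l * exp (- s)"
      and Z: "compact Z" "Z \<subseteq> {p..p+h}" "measure lebesgue Z \<ge> d * h"
      and small: "\<And>x. x \<in> Z \<Longrightarrow> cmod (f x) \<le> A * exp (- s)"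
      and s: "s \<ge> s0" and Y: "Y > 0" and h: "0 < h" "h * Y \<le> \<kappa> * s" and y: "y \<in> {p..p+2*h}"
    for a :: "'i \<Rightarrow> complex" and t b f A s Y Z p h y
  proof -
    have A: "A \<ge> 0" using b ab by (meson has_sum_nonneg norm_ge_zero order_trans)
    have spos: "s > 0" using s s0 by simp
    define m where "m = nat \<lceil>\<mu> * s\<rceil>"
    define M where "M = m + 1"
    have m: "\<mu> * s \<le> real m" "real m \<le> \<mu> * s + 1"
      using spos \<mu> by (auto simp: m_def of_nat_nat)
    have BM: "B ^ M \<le> B\<^sup>2 * exp (s / 2)"
    proof -
      have "B ^ M = B powr real M" using B by (simp add: powr_realpow)
      also have "\<dots> \<le> B powr (2 + \<mu> * s)" using B m by (intro powr_mono) (auto simp: M_def)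
      also have "\<dots> = B\<^sup>2 * B powr (\<mu> * s)" using B by (simp add: powr_add powr_numeral)
      also have "B powr (\<mu> * s) = exp (s / 2)" using B by (simp add: powr_def \<mu>_def)
      finally show ?thesis .
    qed
    have "(2 * h * Y) ^ M / fact m \<le> exp (-real M) / B ^ M"
    proof -
      have "(2 * h * Y) ^ M / fact m \<le> (2 * (\<kappa> * s)) ^ M / fact m"
        using h Y by (intro divide_right_mono power_mono) auto
      also have "\<dots> \<le> (2 * (\<kappa> * (real M / \<mu>))) ^ M / fact m"
        using m \<mu> \<kappa> spos by (intro divide_right_mono power_mono mult_left_mono) (auto simp: M_def field_simps)
      also have "\<dots> = real M * ((real M) ^ M / fact M) * (2 * \<kappa> / \<mu>) ^ M"
      proof -
        have 1: "1 / fact m = real M / fact M" by (simp add: M_def)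
        have 2: "2 * (\<kappa> * (real M / \<mu>)) = real M * (2 * \<kappa> / \<mu>)" by simp
        have "(2 * (\<kappa> * (real M / \<mu>))) ^ M / fact m = real M ^ M * (2 * \<kappa> / \<mu>) ^ M * (1 / fact m)"
          unfolding 2 power_mult_distrib by (simp only: times_divide_eq_right mult_1_right)
        then show ?thesis unfolding 1 by (simp only: times_divide_eq_left times_divide_eq_right mult_ac)
      qed
      also have "\<dots> \<le> 2 ^ M * exp (real M) * (2 * \<kappa> / \<mu>) ^ M"
        using \<kappa> \<mu> less_exp[of M]
        by (intro mult_mono power_div_fact_le_exp) (auto simp: less_imp_le)
      also have "\<dots> = (4 * exp 1 * \<kappa> / \<mu>) ^ M"
      proof -
        have "exp (real M) = exp 1 ^ M" using exp_of_nat_mult[of M "1::real"] by simp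
        moreover have "2 * exp 1 * (2 * \<kappa> / \<mu>) = 4 * exp 1 * \<kappa> / \<mu>" by simp
        ultimately show ?thesis
          unfolding power_mult_distrib[symmetric] by (simp only: flip: power_mult_distrib)
      qed
      also have "4 * exp 1 * \<kappa> / \<mu> = exp (-1) / B"
      proof -
        have "exp 1 / exp 2 = exp (-1::real)" by (simp flip: exp_diff)
        then show ?thesis using \<mu> by (simp add: \<kappa>_def field_simps)
      qed
      also have "(exp (-1) / B) ^ M = exp (- real M) / B ^ M"
        using exp_of_nat_mult[of M "-1::real"] by (simp add: power_divide)
      finally show ?thesis .
    qed
    then have "B ^ M * ((2 * h * Y) ^ M / fact m) \<le> exp (- real M)"
      using B by (simp add: field_simps)
    also have "\<dots> \<le> exp (- (\<mu> * s))" using m by (simp add: M_def)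
    finally have 1: "B ^ M * ((2 * h * Y) ^ M / fact m) \<le> exp (- (\<mu> * s))" .
    have "B ^ M * exp (- s) \<le> B\<^sup>2 * exp (s / 2) * exp (- s)"
      using BM by (intro mult_right_mono) auto
    also have "\<dots> = B\<^sup>2 * exp (- (s / 2))" by (simp flip: exp_add add: mult.assoc)
    also have "\<dots> \<le> B\<^sup>2 * exp (- (\<mu> * s))" using \<mu> spos by (intro mult_left_mono) auto
    finally have 2: "B ^ M * exp (- s) \<le> B\<^sup>2 * exp (- (\<mu> * s))" .
    have "cmod (f y) \<le> A * (3 * B ^ M * (exp (- s) + (2 * h * Y) ^ M / fact m))"
      unfolding B_def M_def
      by (rule interpolation_smallness[OF f b ab ab' _ Z small d h(1) _ y]) (use Y in auto)
    also have "\<dots> \<le> A * (D * exp (- (\<mu> * s)))"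
      using 1 2 A by (intro mult_left_mono) (auto simp: D_def algebra_simps)
    also have "\<dots> \<le> A * exp (- (\<mu> / 2 * s))"
    proof (intro mult_left_mono A)
      have "ln D \<le> \<mu> / 2 * s" using s \<mu> by (simp add: s0_def field_simps)
      then have "D \<le> exp (\<mu> / 2 * s)" using D by (metis exp_le_cancel_iff exp_ln less_trans zero_less_one)
      then have "D * exp (- (\<mu> * s)) \<le> exp (\<mu> / 2 * s) * exp (- (\<mu> * s))" by (intro mult_right_mono) auto
      also have "\<dots> = exp (- (\<mu> / 2 * s))" by (simp flip: exp_add)
      finally show "D * exp (- (\<mu> * s)) \<le> exp (- (\<mu> / 2 * s))" .
    qed
    finally show ?thesis .
  qed
  show ?thesis
  proof (rule that[of "\<mu> / 2" \<kappa> s0], goal_cases)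
    case (5 a t b f A s Y Z p h y)
    then show ?case by (rule main[of a t f b A Y s Z p h y])
  qed (use \<mu> \<kappa> s0 in auto)
qed

subsection \<open>Uniqueness for exponential series on the line\<close>

text \<open>An elementary substitute for the density theorem: minimise
  \<open>\<mu> t - d * (t - a)\<close>, where \<open>d\<close> is half the mean density of
  \<open>E\<close>. The function is at most 0 at \<open>a\<close> and positive at \<open>b\<close>,
  so the minimum lies left of \<open>b\<close>, and minimality is the density bound to its right. A
  point outside \<open>E\<close> would have a gap contradicting that bound.\<close>

lemma right_density_point:
  fixes E :: "real set"
  assumes E: "compact E" "measure lebesgue E > 0"
  obtains x0 r d where "x0 \<in> E" "r > 0" "0 < d" "d \<le> 1"
    "\<And>h. 0 < h \<Longrightarrow> h \<le> r \<Longrightarrow> measure lebesgue (E \<inter> {x0..x0+h}) \<ge> d * h"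
proof -
  obtain a b where ab: "a < b" "E \<subseteq> {a..b}"
  proof -
    obtain c where "\<And>x. x \<in> E \<Longrightarrow> \<bar>x\<bar> \<le> c"
      using compact_imp_bounded[OF E(1)] by (auto simp: bounded_iff)
    then show ?thesis by (intro that[of "-(\<bar>c\<bar>+1)" "\<bar>c\<bar>+1"]) (auto simp: abs_le_iff, fastforce+)
  qed
  define \<mu> where "\<mu> t = measure lebesgue (E \<inter> {a..t})" for t
  have lm: "E \<inter> {u..v} \<in> lmeasurable" for u v
    using E by (intro lmeasurable_compact compact_Int_closed) auto
  have mono: "\<mu> s \<le> \<mu> t" if "s \<le> t" for s t
    unfolding \<mu>_def using that lm by (intro measure_mono_fmeasurable) (auto intro: fmeasurableD)
  have add: "\<mu> t \<le> \<mu> s + measure lebesgue (E \<inter> {s..t})" for s t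
  proof -
    have "\<mu> t \<le> measure lebesgue ((E \<inter> {a..s}) \<union> (E \<inter> {s..t}))"
      unfolding \<mu>_def using lm by (intro measure_mono_fmeasurable) (auto intro: fmeasurableD fmeasurable.Un)
    also have "\<dots> \<le> \<mu> s + measure lebesgue (E \<inter> {s..t})"
      unfolding \<mu>_def using lm by (intro measure_Un_le) (auto intro: fmeasurableD)
    finally show ?thesis .
  qed
  have le_len: "measure lebesgue (E \<inter> {s..t}) \<le> t - s" if "s \<le> t" for s t
  proof -
    have "measure lebesgue (E \<inter> {s..t}) \<le> measure lebesgue {s..t}"
      using lm by (intro measure_mono_fmeasurable) (auto intro: fmeasurableD)
    then show ?thesis using that by simp
  qed
  have "\<bar>\<mu> t - \<mu> s\<bar> \<le> \<bar>t - s\<bar>" for s t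
    using mono[of s t] mono[of t s] add[of t s] add[of s t] le_len[of s t] le_len[of t s]
    by (cases "s \<le> t") auto
  then have "continuous_on {a..b} \<mu>"
    by (intro lipschitz_on_continuous_on[of 1] lipschitz_onI) (auto simp: dist_real_def)
  define d where "d = measure lebesgue E / (2 * (b - a))"
  have E_eq: "E \<inter> {a..b} = E" using ab by auto
  have d: "0 < d" "d \<le> 1" using E le_len[of a b] ab by (auto simp: d_def E_eq field_simps)
  have "continuous_on {a..b} (\<lambda>t. \<mu> t - d * (t - a))"
    by (intro continuous_intros \<open>continuous_on {a..b} \<mu>\<close>)
  then obtain x0 where x0: "x0 \<in> {a..b}" "\<And>t. t \<in> {a..b} \<Longrightarrow> \<mu> x0 - d * (x0 - a) \<le> \<mu> t - d * (t - a)"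
    using continuous_attains_inf[of "{a..b}" "\<lambda>t. \<mu> t - d * (t - a)"] ab by auto
  have "\<mu> a \<le> 0" unfolding \<mu>_def using le_len[of a a] by simp
  moreover have "\<mu> b - d * (b - a) > 0"
  proof -
    have "d * (b - a) = measure lebesgue E / 2" unfolding d_def using ab by (simp add: divide_simps del: right_diff_distrib_numeral)
    then show ?thesis using E by (simp add: \<mu>_def E_eq)
  qed
  ultimately have "x0 \<noteq> b" using x0(2)[of a] ab by auto
  then have r: "b - x0 > 0" using x0 by simp
  have dens: "measure lebesgue (E \<inter> {x0..x0+h}) \<ge> d * h" if "0 < h" "h \<le> b - x0" for h
    using x0(2)[of "x0 + h"] add[of "x0 + h" x0] that x0(1) by (simp add: algebra_simps)
  have "x0 \<in> E"
  proof (rule ccontr)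
    assume "x0 \<notin> E"
    then obtain e where e: "e > 0" "ball x0 e \<subseteq> - E"
      using E compact_imp_closed open_contains_ball by (metis ComplI open_Compl)
    define h where "h = min (e / 2) (b - x0)"
    have h: "0 < h" "h \<le> b - x0" "h < e" using e r by (auto simp: h_def)
    then have "E \<inter> {x0..x0+h} = {}" using e(2) by (auto simp: subset_iff dist_real_def)
    then have "d * h \<le> 0" using dens[OF h(1,2)] by simp
    then show False using d h by (simp add: mult_le_0_iff)
  qed
  then show ?thesis using that r d dens by blast
qed

text \<open>Telescoping: \<open>1 / (1 + x\<^sup>2)\<close> is below
  \<open>1 / (x - 1/2) - 1 / (x + 1/2)\<close>, which equals \<open>1 / (x\<^sup>2 - 1/4)\<close>,
  so the tail is at most \<open>1 / (real N - 1/2)\<close>.\<close>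

lemma sum_inverse_squares_tail:
  assumes "N \<ge> 1"
  shows "(\<Sum>k<n. if N \<le> Suc k then 1 / (1 + (real (Suc k))\<^sup>2) else 0) \<le> 2 / real N"
proof -
  have step: "1 / (1 + x\<^sup>2) \<le> 1 / (x - 1/2) - 1 / (x + 1/2)" if "x \<ge> 1" for x :: real
  proof -
    have "1 / (x - 1/2) - 1 / (x + 1/2) = 1 / (x\<^sup>2 - 1/4)"
    proof -
      have "1 / (x - 1/2) - 1 / (x + 1/2) = ((x + 1/2) - (x - 1/2)) / ((x - 1/2) * (x + 1/2))"
        using that by (subst diff_frac_eq) auto
      also have "(x - 1/2) * (x + 1/2) = x\<^sup>2 - 1/4" by (simp add: power2_eq_square algebra_simps)
      finally show ?thesis by simp
    qed
    moreover have "x\<^sup>2 \<ge> 1" using that by simp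
    ultimately show ?thesis by (auto intro!: frac_le)
  qed
  define q T u v where "q m = 1 / (1 + (real m)\<^sup>2)"
    and "T n = (\<Sum>k<n. if N \<le> Suc k then q (Suc k) else 0)"
    and "u n = 1 / (real n + 1/2)" and "v = 1 / (real N - 1/2)" for m n
  have q: "q (Suc n) \<le> u n - u (Suc n)" for n
    using step[of "real (Suc n)"] by (simp add: q_def u_def algebra_simps)
  have v: "v = u n" if "N = Suc n" for n using that by (simp add: u_def v_def)
  have "T n \<le> (if N \<le> n then v - u n else 0)"
  proof (induction n)
    case 0
    then show ?case using assms by (simp add: T_def)
  next
    case (Suc n)
    have T: "T (Suc n) = T n + (if N \<le> Suc n then q (Suc n) else 0)" by (simp add: T_def)
    consider "N \<le> n" | "N = Suc n" | "N > Suc n" by linarith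
    then show ?case
    proof cases
      case 1
      then show ?thesis using Suc q[of n] T by simp
    next
      case 2
      then have "T n \<le> 0" using Suc by simp
      then show ?thesis using 2 q[of n] v[OF 2] T by simp
    next
      case 3
      then show ?thesis using Suc T by simp
    qed
  qed
  also have "\<dots> \<le> v" using assms by (auto simp: u_def v_def)
  also have "\<dots> \<le> 2 / real N" unfolding v_def using assms by (simp add: divide_simps)
  finally show ?thesis unfolding T_def q_def .
qed

text \<open>The levels grow geometrically, so passing from one level to the next may lose a constant
  factor in the exponent, while the sum of the ratios level / frequency still diverges.\<close>

lemma geometric_levels_diverge:
  fixes \<psi> :: "real \<Rightarrow> real" and X :: "nat \<Rightarrow> nat"
  assumes nonneg: "\<And>x. x \<ge> 0 \<Longrightarrow> \<psi> x \<ge> 0" and incr: "mono_on {0..} \<psi>"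
    and div: "\<not> summable (\<lambda>k::nat. \<psi> (real k) / (1 + (real k)\<^sup>2))"
    and C: "C > 1" and X1: "\<And>i. X i \<ge> 1"
    and X: "\<And>i k. k \<ge> 1 \<Longrightarrow> C ^ i \<le> \<psi> (real k) \<Longrightarrow> X i \<le> k"
  shows "\<not> summable (\<lambda>i. C ^ i / max (real (X i)) (C ^ i))"
proof
  assume sm: "summable (\<lambda>i. C ^ i / max (real (X i)) (C ^ i))"
  \<comment> \<open>Summability pushes the ratios below 1, so eventually the maximum is
    \<open>X i\<close> and the cap \<open>C ^ i\<close> disappears.\<close>
  have "eventually (\<lambda>i. C ^ i / max (real (X i)) (C ^ i) < 1) sequentially"
    using summable_LIMSEQ_zero[OF sm] by (rule order_tendstoD) simp
  then have "eventually (\<lambda>i. C ^ i / max (real (X i)) (C ^ i) = C ^ i / real (X i)) sequentially"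
  proof eventually_elim
    case (elim i)
    have "C ^ i > 0" using C by simp
    then have "\<not> real (X i) \<le> C ^ i" using elim by (auto simp: max_absorb2)
    then have "max (real (X i)) (C ^ i) = real (X i)" by (intro max_absorb1) linarith
    then show ?case by simp
  qed
  then have sm': "summable (\<lambda>i. C ^ i / real (X i))"
    using sm by (rule summable_cong[THEN iffD1])
  define S where "S = (\<Sum>i. C ^ i / real (X i))"
  have "summable (\<lambda>k. \<psi> (real (Suc k)) / (1 + (real (Suc k))\<^sup>2))"
  proof (rule summableI_nonneg_bounded)
    fix n
    obtain I where I: "\<psi> (real (Suc n)) < C ^ I" using real_arch_pow[OF C] by blast
    \<comment> \<open>Layer decomposition: the largest level \<open>C ^ i\<close> not above the
      value of \<psi> is one of the summands and is off by less than the factor \<open>C\<close>;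
      values below 1 are covered by the additive \<open>C\<close>. Cutting at \<open>I\<close> keeps
      the sum finite for the interchange below.\<close>
    have bound: "\<psi> (real (Suc k)) \<le> C + C * (\<Sum>i<I. if X i \<le> Suc k then C ^ i else 0)" if k: "k < n" for k
    proof (cases "\<psi> (real (Suc k)) < 1")
      case True
      have "0 \<le> C * (\<Sum>i<I. if X i \<le> Suc k then C ^ i else 0)" using C by (auto intro!: mult_nonneg_nonneg sum_nonneg)
      then show ?thesis using True C by linarith
    next
      case False
      define j where "j = (LEAST j. \<psi> (real (Suc k)) < C ^ j)"
      have mon: "\<psi> (real (Suc k)) \<le> \<psi> (real (Suc n))"
        using k by (intro mono_onD[OF incr]) auto
      then have "\<psi> (real (Suc k)) < C ^ I" using I by linarith
      then have lt: "\<psi> (real (Suc k)) < C ^ j" unfolding j_def by (rule LeastI)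
      then have "j \<noteq> 0" using False by (metis power_0)
      then obtain i where i: "j = Suc i" by (cases j) auto
      then have le: "C ^ i \<le> \<psi> (real (Suc k))"
        using not_less_Least[of i "\<lambda>j. \<psi> (real (Suc k)) < C ^ j"] i unfolding j_def[symmetric] by simp
      have "C ^ i < C ^ I" using le mon I by linarith
      then have iI: "i < I" using power_less_imp_less_exp[OF C] by blast
      have "C ^ i = (if X i \<le> Suc k then C ^ i else 0)" using X[OF _ le] by simp
      also have "\<dots> \<le> (\<Sum>i<I. if X i \<le> Suc k then C ^ i else 0)"
        using iI C by (intro member_le_sum) auto
      finally have "C * C ^ i \<le> C * (\<Sum>i<I. if X i \<le> Suc k then C ^ i else 0)" using C by simp
      moreover have "\<psi> (real (Suc k)) < C * C ^ i" using lt i by simp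
      ultimately show ?thesis using C by linarith
    qed
    have "(\<Sum>k<n. \<psi> (real (Suc k)) / (1 + (real (Suc k))\<^sup>2))
        \<le> (\<Sum>k<n. (C + C * (\<Sum>i<I. if X i \<le> Suc k then C ^ i else 0)) / (1 + (real (Suc k))\<^sup>2))"
      using bound by (intro sum_mono divide_right_mono) (auto simp: add_nonneg_nonneg)
    also have "\<dots> = (\<Sum>k<n. C * (if 1 \<le> Suc k then 1 / (1 + (real (Suc k))\<^sup>2) else 0)
        + (\<Sum>i<I. C * C ^ i * (if X i \<le> Suc k then 1 / (1 + (real (Suc k))\<^sup>2) else 0)))"
    proof (rule sum.cong[OF refl])
      fix k
      let ?D = "1 + (real (Suc k))\<^sup>2"
      have "C * (\<Sum>i<I. if X i \<le> Suc k then C ^ i else 0) / ?D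
          = (\<Sum>i<I. C * C ^ i * (if X i \<le> Suc k then 1 / ?D else 0))"
        unfolding sum_distrib_left sum_divide_distrib by (rule sum.cong) auto
      then show "(C + C * (\<Sum>i<I. if X i \<le> Suc k then C ^ i else 0)) / ?D
          = C * (if 1 \<le> Suc k then 1 / ?D else 0)
            + (\<Sum>i<I. C * C ^ i * (if X i \<le> Suc k then 1 / ?D else 0))"
        unfolding add_divide_distrib by simp
    qed
    also have "\<dots> = C * (\<Sum>k<n. if 1 \<le> Suc k then 1 / (1 + (real (Suc k))\<^sup>2) else 0)
        + (\<Sum>i<I. C * C ^ i * (\<Sum>k<n. if X i \<le> Suc k then 1 / (1 + (real (Suc k))\<^sup>2) else 0))"
    proof -
      let ?q = "\<lambda>i k. C * C ^ i * (if X i \<le> Suc k then 1 / (1 + (real (Suc k))\<^sup>2) else 0)"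
      have "(\<Sum>k<n. \<Sum>i<I. ?q i k) = (\<Sum>i<I. \<Sum>k<n. ?q i k)" by (rule sum.swap)
      then show ?thesis unfolding sum.distrib sum_distrib_left by (rule arg_cong)
    qed
    \<comment> \<open>After the interchange, level i contributes its height times the tail of the
      inverse squares from \<open>X i\<close> on, which is of order \<open>1 / X i\<close>.\<close>
    also have "\<dots> \<le> C * (2 / real 1) + (\<Sum>i<I. C * C ^ i * (2 / real (X i)))"
      using C X1 by (intro add_mono sum_mono mult_left_mono sum_inverse_squares_tail) auto
    also have "\<dots> = 2 * C + 2 * C * (\<Sum>i<I. C ^ i / real (X i))"
      by (simp add: sum_distrib_left mult_ac)
    also have "\<dots> \<le> 2 * C + 2 * C * S"
      unfolding S_def using C by (intro add_left_mono mult_left_mono sum_le_suminf[OF sm']) auto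
    finally show "(\<Sum>k<n. \<psi> (real (Suc k)) / (1 + (real (Suc k))\<^sup>2)) \<le> 2 * C + 2 * C * S" .
  qed (auto intro!: divide_nonneg_nonneg nonneg add_nonneg_nonneg)
  then show False using div summable_Suc_iff by blast
qed

lemma zero_on_right_half_line:
  fixes a :: "'i \<Rightarrow> complex" and t :: "'i \<Rightarrow> real" and f :: "real \<Rightarrow> complex" and \<psi> :: "real \<Rightarrow> real"
  assumes nonneg: "\<And>x. x \<ge> 0 \<Longrightarrow> \<psi> x \<ge> 0" and incr: "mono_on {0..} \<psi>"
    and lim: "filterlim \<psi> at_top at_top"
    and div: "\<not> summable (\<lambda>k::nat. \<psi> (real k) / (1 + (real k)\<^sup>2))"
    and f: "\<And>x. ((\<lambda>l. a l * cis (t l * x)) has_sum f x) UNIV"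
    and sm: "(\<lambda>l. cmod (a l) * exp (\<psi> \<bar>t l\<bar>)) summable_on UNIV"
    and E: "compact E" "measure lebesgue E > 0" and zero: "\<And>x. x \<in> E \<Longrightarrow> f x = 0"
  shows "\<exists>x0\<in>E. \<forall>x\<ge>x0. f x = 0"
proof -
  define b where "b l = cmod (a l) * exp (\<psi> \<bar>t l\<bar>)" for l
  obtain A where b: "(b has_sum A) UNIV"
    using sm unfolding b_def summable_on_def by blast
  have ab: "cmod (a l) \<le> b l" for l
    using nonneg[of "\<bar>t l\<bar>"] by (simp add: b_def mult_le_cancel_left1)
  have A: "A \<ge> 0" using b ab by (meson has_sum_nonneg norm_ge_zero order_trans)
  obtain x0 r d where x0: "x0 \<in> E" and r: "r > 0" and d: "0 < d" "d \<le> 1"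
    and dens: "\<And>h. 0 < h \<Longrightarrow> h \<le> r \<Longrightarrow> measure lebesgue (E \<inter> {x0..x0+h}) \<ge> d * h"
    using right_density_point[OF E] by metis
  obtain \<eta> \<kappa> s0 :: real where \<eta>: "0 < \<eta>" "\<eta> < 1" and \<kappa>: "\<kappa> > 0" and "s0 > 0"
    and smallness: "\<And>(a :: 'i \<Rightarrow> complex) t b f A s Y Z p h y. \<lbrakk>
       \<And>x. ((\<lambda>l. a l * cis (t l * x)) has_sum f x) UNIV; (b has_sum A) UNIV;
       \<And>l. cmod (a l) \<le> b l; \<And>l. \<bar>t l\<bar> > Y \<Longrightarrow> cmod (a l) \<le> b l * exp (- s);
       compact Z; Z \<subseteq> {p..p+h}; measure lebesgue Z \<ge> d * h;
       \<And>x. x \<in> Z \<Longrightarrow> cmod (f x) \<le> A * exp (- s);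
       s \<ge> s0; Y > 0; 0 < h; h * Y \<le> \<kappa> * s; y \<in> {p..p+2*h} \<rbrakk>
     \<Longrightarrow> cmod (f y) \<le> A * exp (- (\<eta> * s))"
    using propagation_of_smallness[OF d] by blast
  define C where "C = 1 / \<eta>"
  have C: "C > 1" using \<eta> by (simp add: C_def)
  define X where "X i = (LEAST n. n \<ge> 1 \<and> C ^ i \<le> \<psi> (real n))" for i
  have X: "X i \<ge> 1 \<and> C ^ i \<le> \<psi> (real (X i))" for i
  proof -
    have "eventually (\<lambda>n. C ^ i \<le> \<psi> (real n)) sequentially"
      using filterlim_compose[OF lim filterlim_real_sequentially] by (auto simp: filterlim_at_top)
    then have "\<exists>n. n \<ge> 1 \<and> C ^ i \<le> \<psi> (real n)"

      unfolding eventually_sequentially by (metis linear max.cobounded1 max.cobounded2)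
    then show ?thesis unfolding X_def by (rule LeastI_ex)
  qed
  \<comment> \<open>The cap keeps every increment \<open>h i\<close> within the radius
    \<open>r\<close> up to which the density bound at \<open>x0\<close> holds. A larger cut-off
    frequency is harmless for the decay of the coefficients beyond it.\<close>
  define Y where "Y i = max (real (X i)) (C ^ i)" for i
  have Y: "Y i > 0" "C ^ i \<le> Y i" for i using C by (auto simp: Y_def less_max_iff_disj)
  define \<rho> where "\<rho> = min \<kappa> r"
  have \<rho>: "\<rho> > 0" "\<rho> \<le> \<kappa>" "\<rho> \<le> r" using \<kappa> r by (auto simp: \<rho>_def)
  define h where "h i = \<rho> * (C ^ i / Y i)" for i
  have h: "h i > 0" "h i \<le> r" "h i * Y i \<le> \<kappa> * C ^ i" for i
  proof -
    show "h i > 0" using \<rho> Y C by (simp add: h_def)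
    have "C ^ i / Y i \<le> 1" using Y by simp
    then have "h i \<le> \<rho>" using mult_left_mono[of "C ^ i / Y i" 1 \<rho>] \<rho> unfolding h_def by simp
    then show "h i \<le> r" using \<rho> by simp
    show "h i * Y i \<le> \<kappa> * C ^ i" using Y(1)[of i] \<rho> C by (simp add: h_def)
  qed
  have "\<not> summable (\<lambda>i. C ^ i / Y i)"
    unfolding Y_def
  proof (rule geometric_levels_diverge[OF nonneg incr div C])
    show "X i \<le> k" if "k \<ge> 1" "C ^ i \<le> \<psi> (real k)" for i k
      unfolding X_def by (rule Least_le) (use that in auto)
  qed (use X in auto)
  then have h_div: "\<not> summable h"
    unfolding h_def summable_cmult_iff[of \<rho>] using \<rho>(1) by auto
  have decay: "cmod (a l) \<le> b l * exp (- (C ^ i))" if "\<bar>t l\<bar> > Y i" for l i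
  proof -
    have "C ^ i \<le> \<psi> \<bar>t l\<bar>"
      using X[of i] mono_onD[OF incr, of "real (X i)" "\<bar>t l\<bar>"] that by (auto simp: Y_def)
    then have "exp (C ^ i) * cmod (a l) \<le> exp (\<psi> \<bar>t l\<bar>) * cmod (a l)" by (intro mult_right_mono) auto
    then show ?thesis by (simp add: b_def exp_minus field_simps)
  qed
  obtain i0 where i0: "s0 \<le> C ^ i0" using real_arch_pow[OF C, of s0] less_imp_le by blast
  \<comment> \<open>Downward induction from \<open>J\<close>: at the top level the interval is the
    single point \<open>x0\<close>, where \<open>f\<close> vanishes exactly, and the descent to
    level \<open>i\<close> appends the length \<open>h (Suc i)\<close>.\<close>
  have chain: "\<forall>y\<in>{x0..x0 + (\<Sum>j\<in>{i<..J}. h j)}. cmod (f y) \<le> A * exp (- (C ^ i))"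
    if "i0 \<le> i" "i \<le> J" for i J
    using that(2,1)
  proof (induction rule: inc_induct)
    case base
    then show ?case using zero[OF x0] A by simp
  next
    case (step i)
    define L where "L = (\<Sum>j\<in>{Suc i<..J}. h j)"
    have IH: "cmod (f y) \<le> A * exp (- (C ^ Suc i))" if "y \<in> {x0..x0 + L}" for y
      using step that by (auto simp: L_def)
    have "{i<..J} = insert (Suc i) {Suc i<..J}" using step by auto
    then have sumeq: "(\<Sum>j\<in>{i<..J}. h j) = h (Suc i) + L" by (simp add: L_def)
    have CS: "\<eta> * C ^ Suc i = C ^ i" using \<eta> by (simp add: C_def)
    have large: "C ^ Suc i \<ge> s0"
      using i0 step(4) C power_increasing[of i0 "Suc i" C] by linarith
    have advance: "cmod (f y) \<le> A * exp (- (C ^ i))"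
      if "compact Z" "Z \<subseteq> {p..p + h (Suc i)}" "d * h (Suc i) \<le> measure lebesgue Z"
        "\<And>x. x \<in> Z \<Longrightarrow> cmod (f x) \<le> A * exp (- (C ^ Suc i))" "y \<in> {p..p + 2 * h (Suc i)}" for Z p y
      using smallness[OF f b ab decay that(1-4) large Y(1) h(1) h(3) that(5)] unfolding CS .
    show ?case
    proof
      fix y assume y: "y \<in> {x0..x0 + (\<Sum>j\<in>{i<..J}. h j)}"
      have "exp (- (C ^ Suc i)) \<le> exp (- (C ^ i))" using C by simp
      then have mon: "A * exp (- (C ^ Suc i)) \<le> A * exp (- (C ^ i))" using A by (rule mult_left_mono)
      \<comment> \<open>If the stretch already controlled is at least as long as the next increment,
        its right end serves as the interpolation set. If it is shorter, the zeros of
        \<open>E\<close> just right of \<open>x0\<close> serve instead, since \<open>f = 0\<close>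
        is small at every level.\<close>
      consider "y \<le> x0 + L" | "y > x0 + L" "h (Suc i) \<le> L" | "y > x0 + L" "L < h (Suc i)" by linarith
      then show "cmod (f y) \<le> A * exp (- (C ^ i))"
      proof cases
        case 1
        then show ?thesis using IH[of y] y mon by auto
      next
        case 2
        show ?thesis
        proof (rule advance[of "{x0 + L - h (Suc i)..x0 + L}" "x0 + L - h (Suc i)"])
          show "d * h (Suc i) \<le> measure lebesgue {x0 + L - h (Suc i)..x0 + L}"
            using h(1)[of "Suc i"] d by (simp add: mult_left_le_one_le)
        qed (use 2 y sumeq h(1)[of "Suc i"] IH in auto)
      next
        case 3
        show ?thesis
        proof (rule advance[of "E \<inter> {x0..x0 + h (Suc i)}" x0])
          show "cmod (f x) \<le> A * exp (- (C ^ Suc i))" if "x \<in> E \<inter> {x0..x0 + h (Suc i)}" for x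
            using that zero A by simp
        qed (use 3 y sumeq h[of "Suc i"] dens[of "h (Suc i)"] E in \<open>auto intro: compact_Int_closed\<close>)
      qed
    qed
  qed
  have "f y = 0" if y: "y \<ge> x0" for y
  proof -
    have small: "cmod (f y) \<le> A * exp (- (C ^ i))" if i: "i0 \<le> i" for i
    proof -
      \<comment> \<open>With \<open>i\<close> fixed, a high enough starting level \<open>J\<close>
        makes the interval reach \<open>y\<close>; the bound does not depend on \<open>J\<close>,
        and \<open>i\<close> tends to infinity only afterwards.\<close>
      have "\<exists>J\<ge>i. y - x0 \<le> (\<Sum>j\<in>{i<..J}. h j)"
      proof (rule ccontr)
        assume "\<not> ?thesis"
        then have *: "(\<Sum>j\<in>{i<..J}. h j) < y - x0" if "J \<ge> i" for J using that by force
        have "summable (\<lambda>n. h (n + Suc i))"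
        proof (rule summableI_nonneg_bounded)
          fix n
          have "(\<Sum>k<n. h (k + Suc i)) = (\<Sum>j\<in>{i<..i + n}. h j)"
            by (rule sum.reindex_bij_witness[of _ "\<lambda>j. j - Suc i" "\<lambda>k. k + Suc i"]) auto
          then show "(\<Sum>k<n. h (k + Suc i)) \<le> y - x0" using *[of "i + n"] by simp
        qed (use h in \<open>auto intro: less_imp_le\<close>)
        then show False using h_div summable_iff_shift by blast
      qed
      then obtain J where "J \<ge> i" "y - x0 \<le> (\<Sum>j\<in>{i<..J}. h j)" by blast
      then show ?thesis using chain[OF i, of J] y by auto
    qed
    have "(\<lambda>i. A * exp (- (C ^ i))) \<longlonglongrightarrow> A * 0"
      using C by (intro tendsto_mult tendsto_const filterlim_compose[OF exp_at_bot]
          filterlim_compose[OF filterlim_uminus_at_bot_at_top]) (auto intro: filterlim_realpow_sequentially_gt1[THEN filterlim_at_infinity_imp_filterlim_at_top])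
    then have "cmod (f y) \<le> A * 0"
      by (rule tendsto_lowerbound) (use small in \<open>auto simp: eventually_sequentially\<close>)
    then show ?thesis by simp
  qed
  then show ?thesis using x0 by blast
qed

theorem quasianalytic_uniqueness_line:
  fixes a :: "'i \<Rightarrow> complex" and t :: "'i \<Rightarrow> real" and f :: "real \<Rightarrow> complex" and \<psi> :: "real \<Rightarrow> real"
  assumes nonneg: "\<And>x. x \<ge> 0 \<Longrightarrow> \<psi> x \<ge> 0" and incr: "mono_on {0..} \<psi>"
    and lim: "filterlim \<psi> at_top at_top"
    and div: "\<not> summable (\<lambda>k::nat. \<psi> (real k) / (1 + (real k)\<^sup>2))"
    and f: "\<And>x. ((\<lambda>l. a l * cis (t l * x)) has_sum f x) UNIV"
    and sm: "(\<lambda>l. cmod (a l) * exp (\<psi> \<bar>t l\<bar>)) summable_on UNIV"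
    and E: "compact E" "measure lebesgue E > 0" and zero: "\<And>x. x \<in> E \<Longrightarrow> f x = 0"
  shows "f x = 0"
proof -
  obtain x0 where x0: "\<And>x. x \<ge> x0 \<Longrightarrow> f x = 0"
    using zero_on_right_half_line[OF nonneg incr lim div f sm E zero] by blast
  \<comment> \<open>The reflected series vanishes on a whole interval, which is a legitimate zero
    set; the half line so obtained starts at or before \<open>- x0\<close>, hence the two half lines
    cover everything.\<close>
  have "\<exists>x1\<in>{- (x0 + 1).. - x0}. \<forall>x\<ge>x1. f (- x) = 0"
  proof (rule zero_on_right_half_line[OF nonneg incr lim div])
    show "((\<lambda>l. a l * cis (- t l * x)) has_sum f (- x)) UNIV" for x
      using f[of "- x"] by simp
    show "f (- x) = 0" if "x \<in> {- (x0 + 1).. - x0}" for x using that by (intro x0) auto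
  qed (use sm in auto)
  then obtain x1 where x1: "x1 \<le> - x0" "\<And>x. x \<ge> x1 \<Longrightarrow> f (- x) = 0" by auto
  show ?thesis using x0[of x] x1(2)[of "- x"] x1(1) by (cases "x \<ge> x0") auto
qed

subsection \<open>Integration over the torus and character series\<close>

lemma lborel_integral_prod_vec:
  fixes F :: "'n::finite \<Rightarrow> real \<Rightarrow> complex"
  assumes F: "\<And>j. integrable lborel (F j)"
  shows "integrable lborel (\<lambda>x::real^'n. \<Prod>j\<in>UNIV. F j (x $ j))"
    and "(LINT x|lborel. (\<Prod>j\<in>UNIV. F j ((x::real^'n) $ j))) = (\<Prod>j\<in>UNIV. (LINT t|lborel. F j t))"
proof -
  interpret product_sigma_finite "\<lambda>_::real^'n. lborel :: real measure" ..
  \<comment> \<open>The product structure of \<open>lborel\<close> is indexed by basis vectors;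
    \<open>ix\<close> recovers the coordinate from its basis vector.\<close>
  define ix where "ix = (\<lambda>b::real^'n. THE j. b = axis j 1)"
  have ix: "ix (axis j 1) = j" for j by (auto simp: ix_def axis_eq_axis)
  have Basis: "(Basis :: (real^'n) set) = range (\<lambda>j. axis j 1)" by (auto simp: Basis_vec_def)
  have inj: "inj (\<lambda>j. axis j 1 :: real^'n)" by (auto simp: inj_on_def axis_eq_axis)
  have prod_Basis: "(\<Prod>b\<in>Basis. G (ix b) b) = (\<Prod>j\<in>UNIV. G j (axis j 1))" for G :: "'n \<Rightarrow> real^'n \<Rightarrow> complex"
    unfolding Basis prod.reindex[OF inj] by (simp add: ix)
  have comp: "(\<Sum>b\<in>Basis. f b *\<^sub>R b) $ j = f (axis j 1)" for f and j :: 'n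
    unfolding Basis sum.reindex[OF inj] by (simp add: axis_def if_distrib cong: if_cong)
  have meas: "F j \<in> borel_measurable borel" for j
    using borel_measurable_integrable[OF F[of j]] by simp
  have m1: "(\<lambda>x::real^'n. \<Prod>j\<in>UNIV. F j (x $ j)) \<in> borel_measurable borel"
  proof (intro borel_measurable_prod)
    fix j
    have "(\<lambda>x::real^'n. x $ j) \<in> borel_measurable borel" by (intro borel_measurable_continuous_onI continuous_intros)
    then show "(\<lambda>x::real^'n. F j (x $ j)) \<in> borel_measurable borel"
      by (rule measurable_compose) (rule meas)
  qed
  have m2: "(\<lambda>f. \<Sum>b\<in>Basis. f b *\<^sub>R b) \<in> measurable (\<Pi>\<^sub>M b\<in>(Basis::(real^'n) set). lborel) borel"
    by measurable
  have eq: "(\<Prod>j\<in>UNIV. F j ((\<Sum>b\<in>(Basis::(real^'n) set). f b *\<^sub>R b) $ j)) = (\<Prod>b\<in>Basis. F (ix b) (f b))" for f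
    unfolding comp prod_Basis[of "\<lambda>j b. F j (f b)"] ..
  show "integrable lborel (\<lambda>x::real^'n. \<Prod>j\<in>UNIV. F j (x $ j))"
    unfolding lborel_eq[where 'a="real^'n"] using product_integrable_prod[OF finite_Basis, of "\<lambda>b. F (ix b)"] F
    by (subst integrable_distr_eq[OF m2]) (use m1 in \<open>simp_all add: eq del: sum_component\<close>)
  show "(LINT x|lborel. (\<Prod>j\<in>UNIV. F j ((x::real^'n) $ j))) = (\<Prod>j\<in>UNIV. (LINT t|lborel. F j t))"
    unfolding lborel_eq[where 'a="real^'n"] using product_integral_prod[OF finite_Basis, of "\<lambda>b. F (ix b)"] F
    by (subst integral_distr[OF m2])
       (use m1 prod_Basis[of "\<lambda>j b. integral\<^sup>L lborel (F j)"] in \<open>simp_all add: eq del: sum_component\<close>)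
qed

section \<open>The torus as a finite measure space\<close>

abbreviation torus_cube :: "(real ^ 'n) set" where
  "torus_cube \<equiv> {x. \<forall>j. x $ j \<in> {-pi..<pi}}"

lemma box_borel:
  assumes "\<And>j::'n::finite. A j \<in> sets borel"
  shows "{x::real^'n. \<forall>j. x $ j \<in> A j} \<in> sets borel"
proof -
  have "{x::real^'n. x $ j \<in> A j} \<in> sets borel" for j
  proof -
    have "(\<lambda>x::real^'n. x $ j) \<in> borel_measurable borel" by (intro borel_measurable_continuous_onI continuous_intros)
    from measurable_sets[OF this assms[of j]] show ?thesis by (simp add: vimage_def)
  qed
  then have "(\<Inter>j. {x::real^'n. x $ j \<in> A j}) \<in> sets borel" by (intro sets.finite_INT) auto
  also have "(\<Inter>j. {x::real^'n. x $ j \<in> A j}) = {x::real^'n. \<forall>j. x $ j \<in> A j}" by auto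
  finally show ?thesis .
qed

lemma emeasure_lborel_box:
  fixes A :: "'n::finite \<Rightarrow> real set"
  assumes "\<And>j. A j \<in> sets borel"
  shows "emeasure lborel {x::real^'n. \<forall>j. x $ j \<in> A j} = (\<Prod>j\<in>UNIV. emeasure lborel (A j))"
proof -
  define ix where "ix = (\<lambda>b::real^'n. THE j. b = axis j 1)"
  have ix: "ix (axis j 1) = j" for j by (auto simp: ix_def axis_eq_axis)
  have Basis: "(Basis :: (real^'n) set) = range (\<lambda>j. axis j 1)" by (auto simp: Basis_vec_def)
  have inj: "inj (\<lambda>j. axis j 1 :: real^'n)" by (auto simp: inj_on_def axis_eq_axis)
  have ind: "indicator {x::real^'n. \<forall>j. x $ j \<in> A j} x = (\<Prod>b\<in>Basis. indicator (A (ix b)) (x \<bullet> b) :: ennreal)" for x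
    unfolding Basis prod.reindex[OF inj]
    by (auto simp: ix inner_axis indicator_def prod_zero_iff intro!: prod.neutral)
  have "emeasure lborel {x::real^'n. \<forall>j. x $ j \<in> A j} = (\<integral>\<^sup>+x. indicator {x::real^'n. \<forall>j. x $ j \<in> A j} x \<partial>lborel)"
    using box_borel[of A] assms by simp
  also have "\<dots> = (\<Prod>b\<in>Basis. (\<integral>\<^sup>+t. indicator (A (ix b)) t \<partial>lborel))"
    unfolding ind using assms by (intro nn_integral_lborel_prod) auto
  also have "\<dots> = (\<Prod>j\<in>UNIV. emeasure lborel (A j))"
    unfolding Basis prod.reindex[OF inj] using assms by (simp add: ix)
  finally show ?thesis .
qed

lemma torus_cube_borel: "(torus_cube :: (real^'n) set) \<in> sets borel"
  by (rule box_borel) simp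

lemma torus_cube_lebesgue: "(torus_cube :: (real^'n) set) \<in> sets lebesgue"
  using torus_cube_borel by (rule sets_completionI_sets[OF _, of _ lborel, simplified])

lemma space_torus: "space (torus :: (real^'n) measure) = torus_cube"
  by (simp add: torus_def)

lemma finite_measure_torus: "finite_measure (torus :: (real^'n) measure)"
proof
  have "emeasure lborel (torus_cube :: (real^'n) set) = (\<Prod>j\<in>(UNIV::'n set). emeasure lborel {-pi..<pi})"
    by (rule emeasure_lborel_box) simp
  also have "\<dots> \<noteq> \<infinity>" by (simp add: power_eq_top_ennreal)
  finally have "emeasure lebesgue (torus_cube :: (real^'n) set) \<noteq> \<infinity>"
    using torus_cube_borel by simp
  then show "emeasure (torus :: (real^'n) measure) (space torus) \<noteq> \<infinity>"
    using torus_cube_lebesgue by (simp add: space_torus) (simp add: torus_def emeasure_restrict_space)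
qed

lemma continuous_measurable_torus:
  fixes h :: "real^'n \<Rightarrow> 'b::{second_countable_topology, real_normed_vector}"
  assumes "continuous_on UNIV h"
  shows "h \<in> borel_measurable (torus :: (real^'n) measure)"
proof -
  have "h \<in> borel_measurable borel" using assms by (rule borel_measurable_continuous_onI)
  then have "h \<in> borel_measurable lebesgue" by (simp add: measurable_completion)
  then show ?thesis unfolding torus_def by (rule measurable_restrict_space1)
qed

lemma integrable_torus_mult:
  fixes g h :: "real^'n \<Rightarrow> complex"
  assumes g: "integrable torus g" and h: "h \<in> borel_measurable torus" and B: "\<And>x. cmod (h x) \<le> B"
  shows "integrable torus (\<lambda>x. g x * h x)"
proof (rule Bochner_Integration.integrable_bound)
  show "integrable torus (\<lambda>x. B * norm (g x))" using g by simp
  show "(\<lambda>x. g x * h x) \<in> borel_measurable torus" using g h by measurable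
  have "cmod (g x) * cmod (h x) \<le> B * cmod (g x)" for x using B[of x] by (subst mult.commute) (rule mult_right_mono, auto)
  moreover have "B \<ge> 0" using B[of 0] norm_ge_zero order_trans by blast
  ultimately show "AE x in torus. norm (g x * h x) \<le> norm (B * norm (g x))"
    by (auto simp: norm_mult abs_mult)
qed

lemma integrable_torus_bounded:
  fixes h :: "real^'n \<Rightarrow> complex"
  assumes "h \<in> borel_measurable torus" "\<And>x. cmod (h x) \<le> B"
  shows "integrable torus h"
proof -
  interpret finite_measure "torus :: (real^'n) measure" by (rule finite_measure_torus)
  show ?thesis using assms by (intro integrable_const_bound[of _ B]) auto
qed

lemma torus_integral_prod:
  fixes F :: "'n::finite \<Rightarrow> real \<Rightarrow> complex"
  assumes F: "\<And>j. continuous_on UNIV (F j)"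
  shows "(LINT x|torus. (\<Prod>j\<in>UNIV. F j ((x::real^'n) $ j))) = (\<Prod>j\<in>UNIV. integral {-pi..pi} (F j))"
proof -
  define G where "G j t = indicator {-pi..<pi} t *\<^sub>R F j t" for j t
  have Fm: "F j \<in> borel_measurable borel" for j using F by (rule borel_measurable_continuous_onI)
  have Gm: "G j \<in> borel_measurable borel" for j unfolding G_def using Fm[of j] by measurable
  have int: "set_integrable lborel {-pi..pi} (F j)" for j
    by (intro borel_integrable_atLeastAtMost' continuous_on_subset[OF F]) auto
  \<comment> \<open>The half-open side of the cube and the closed interval of the integral differ
    only in the null set containing \<open>pi\<close>.\<close>
  have AE: "AE t in lborel. G j t = indicator {-pi..pi} t *\<^sub>R F j t" for j
    using AE_lborel_singleton[of pi] by eventually_elim (auto simp: G_def indicator_def)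
  have Gi: "integrable lborel (G j)" for j
    using int[of j] unfolding set_integrable_def
    by (rule integrable_cong_AE[THEN iffD1, rotated -1])
       (use AE[of j] Gm[of j] Fm[of j] in \<open>auto elim!: eventually_mono\<close>)
  have "(LINT t|lborel. G j t) = (LINT t|lborel. indicator {-pi..pi} t *\<^sub>R F j t)" for j
    by (rule integral_cong_AE) (use AE[of j] Gm[of j] Fm[of j] in auto)
  also have "\<dots> j = integral {-pi..pi} (F j)" for j
    using set_borel_integral_eq_integral(2)[OF int[of j]] by (simp add: set_lebesgue_integral_def)
  finally have Gint: "(LINT t|lborel. G j t) = integral {-pi..pi} (F j)" for j .
  have prod_G: "indicator torus_cube x *\<^sub>R (\<Prod>j\<in>UNIV. F j (x $ j)) = (\<Prod>j\<in>UNIV. G j (x $ j))" for x :: "real^'n"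
  proof (cases "x \<in> torus_cube")
    case True
    then show ?thesis by (auto simp: G_def indicator_def intro!: prod.cong)
  next
    case False
    then obtain j where "x $ j \<notin> {-pi..<pi}" by auto
    then have "G j (x $ j) = 0" by (simp add: G_def)
    then have "(\<Prod>j\<in>UNIV. G j (x $ j)) = 0" by (intro prod_zero) auto
    with False show ?thesis by simp
  qed
  have "(LINT x|torus. (\<Prod>j\<in>UNIV. F j ((x::real^'n) $ j))) = (LINT x|lebesgue. (\<Prod>j\<in>UNIV. G j ((x::real^'n) $ j)))"
  proof -
    have "torus_cube \<inter> space lebesgue \<in> sets (lebesgue :: (real^'n) measure)"
      using torus_cube_lebesgue by simp
    from integral_restrict_space[OF this] show ?thesis unfolding torus_def prod_G[symmetric] .
  qed
  also have "\<dots> = (LINT x|lborel. (\<Prod>j\<in>UNIV. G j ((x::real^'n) $ j)))"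
    using borel_measurable_integrable[OF lborel_integral_prod_vec(1)[of G, OF Gi]]
    by (intro integral_completion) simp
  also have "\<dots> = (\<Prod>j\<in>UNIV. integral {-pi..pi} (F j))"
    unfolding lborel_integral_prod_vec(2)[OF Gi] Gint ..
  finally show ?thesis .
qed

section \<open>Characters and absolutely convergent character series\<close>

definition torus_char :: "int ^ 'n \<Rightarrow> real ^ 'n \<Rightarrow> complex" where
  "torus_char k x = cis (x \<bullet> of_int_vec k)"

lemma norm_torus_char [simp]: "cmod (torus_char k x) = 1"
  by (simp add: torus_char_def)

lemma torus_char_add: "torus_char (k + l) x = torus_char k x * torus_char l x"
proof -
  have "of_int_vec (k + l) = of_int_vec k + of_int_vec l" by (simp add: of_int_vec_def vec_eq_iff)
  then show ?thesis by (simp add: torus_char_def cis_mult inner_add_right)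
qed

lemma torus_char_0 [simp]: "torus_char 0 x = 1"
  by (simp add: torus_char_def of_int_vec_def inner_vec_def)

lemma torus_char_prod: "torus_char k x = (\<Prod>j\<in>UNIV. cis (of_int (k $ j) * x $ j))"
proof -
  have "cis (\<Sum>j\<in>J. f j) = (\<Prod>j\<in>J. cis (f j))" if "finite J" for J and f :: "'a \<Rightarrow> real"
    using that by (induction J rule: finite_induct) (auto simp flip: cis_mult)
  then show ?thesis by (simp add: torus_char_def inner_vec_def of_int_vec_def mult.commute)
qed

lemma continuous_torus_char [continuous_intros]: "continuous_on S (torus_char k)"
  unfolding torus_char_def by (intro continuous_intros)

lemma fourier_coeff_eq:
  "fourier_coeff f k = (1 / (2 * of_real pi) ^ CARD('n)) * (LINT x|torus. f x * torus_char (- k) (x :: real^'n))"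
proof -
  have "of_int_vec (- k) = - of_int_vec k" by (simp add: of_int_vec_def vec_eq_iff)
  then show ?thesis by (simp add: fourier_coeff_def torus_char_def cis_conv_exp)
qed

lemma integral_cis_period:
  "integral {-pi..pi} (\<lambda>t. cis (of_int m * t)) = (if m = 0 then 2 * of_real pi else 0)"
proof (cases "m = 0")
  case False
  have "((\<lambda>t. cis (of_int m * t)) has_integral
      (cis (of_int m * pi) / (\<i> * of_int m) - cis (of_int m * - pi) / (\<i> * of_int m))) {-pi..pi}"
  proof (rule fundamental_theorem_of_calculus)
    show "((\<lambda>t. cis (of_int m * t) / (\<i> * of_int m)) has_vector_derivative cis (of_int m * t)) (at t within {-pi..pi})" for t
      unfolding cis_conv_exp using False
      by (auto intro!: derivative_eq_intros has_vector_derivative_real_field simp: field_simps)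
  qed simp
  moreover have "cis (of_int m * pi) = cis (of_int m * - pi)"
    using cis_mult[of "of_int m * - pi" "2 * pi * of_int m"] cis_multiple_2pi[of "of_int m"]
    by (simp add: algebra_simps)
  ultimately show ?thesis using False by (simp add: integral_unique)
qed (auto simp: scaleR_conv_of_real)

lemma torus_char_integral:
  "(LINT x|torus. torus_char k (x::real^'n)) = (if k = 0 then (2 * of_real pi) ^ CARD('n) else 0)"
proof -
  have "(LINT x|torus. torus_char k (x::real^'n)) = (\<Prod>j\<in>UNIV. integral {-pi..pi} (\<lambda>t. cis (of_int (k $ j) * t)))"
    unfolding torus_char_prod by (rule torus_integral_prod) (intro continuous_intros)
  also have "\<dots> = (if k = 0 then (2 * of_real pi) ^ CARD('n) else 0)"
    by (auto simp: integral_cis_period vec_eq_iff prod_zero_iff)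
  finally show ?thesis .
qed

lemma torus_char_integrable: "integrable torus (torus_char k)"
  by (rule integrable_torus_bounded[of _ 1]) (auto intro: continuous_measurable_torus continuous_torus_char)

text \<open>The tail of the sum of the \<open>cmod (a k)\<close> bounds the error for all
  \<open>x\<close> at once. The set \<open>I\<close> allows a chosen frequency to be forced into the
  partial sum.\<close>

lemma char_series_uniform_approximation:
  fixes a :: "int^'n \<Rightarrow> complex"
  assumes F: "\<And>x. ((\<lambda>k. a k * torus_char k x) has_sum F x) UNIV"
    and a: "(\<lambda>k. cmod (a k)) summable_on UNIV" and e: "e > 0" and I: "finite I"
  shows "\<exists>K. finite K \<and> I \<subseteq> K \<and> (\<forall>x. cmod (F x - (\<Sum>k\<in>K. a k * torus_char k x)) \<le> e)"
proof -
  obtain A where A: "((\<lambda>k. cmod (a k)) has_sum A) UNIV" using a by (auto simp: summable_on_def)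
  then have "eventually (\<lambda>K. dist (\<Sum>k\<in>K. cmod (a k)) A < e) (finite_subsets_at_top UNIV)"
    using e unfolding has_sum_def tendsto_iff by blast
  then obtain K0 where K0: "finite K0" "\<And>K. finite K \<Longrightarrow> K0 \<subseteq> K \<Longrightarrow> dist (\<Sum>k\<in>K. cmod (a k)) A < e"
    by (auto simp: eventually_finite_subsets_at_top)
  define K where "K = K0 \<union> I"
  have fK: "finite K" using K0 I by (simp add: K_def)
  have "cmod (F x - (\<Sum>k\<in>K. a k * torus_char k x)) \<le> A - (\<Sum>k\<in>K. cmod (a k))" for x
  proof (rule norm_infsum_le)
    show "((\<lambda>k. a k * torus_char k x) has_sum (F x - (\<Sum>k\<in>K. a k * torus_char k x))) (UNIV - K)"
      by (rule has_sum_Diff[OF F]) (use fK in auto)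
    show "((\<lambda>k. cmod (a k)) has_sum (A - (\<Sum>k\<in>K. cmod (a k)))) (UNIV - K)"
      by (rule has_sum_Diff[OF A]) (use fK in auto)
  qed (simp add: norm_mult)
  moreover have "A - (\<Sum>k\<in>K. cmod (a k)) \<le> e"
    using K0(2)[OF fK] by (auto simp: K_def dist_real_def)
  ultimately show ?thesis using fK by (intro exI[of _ K]) (auto simp: K_def intro: order_trans)
qed

lemma continuous_on_char_series:
  fixes a :: "int^'n \<Rightarrow> complex"
  assumes F: "\<And>x. ((\<lambda>k. a k * torus_char k x) has_sum F x) UNIV"
    and a: "(\<lambda>k. cmod (a k)) summable_on UNIV"
  shows "continuous_on UNIV F"
proof -
  have "\<exists>K. finite K \<and> (\<forall>x. cmod (F x - (\<Sum>k\<in>K. a k * torus_char k x)) \<le> 1 / real (Suc n))" for n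
    using char_series_uniform_approximation[OF F a, of "1 / real (Suc n)" "{}"] by auto
  then obtain K where K: "\<And>n. finite (K n)" "\<And>n x. cmod (F x - (\<Sum>k\<in>K n. a k * torus_char k x)) \<le> 1 / real (Suc n)"
    by metis
  show ?thesis
  proof (rule uniform_limit_theorem[of _ "\<lambda>n x. \<Sum>k\<in>K n. a k * torus_char k x" sequentially])
    show "uniform_limit UNIV (\<lambda>n x. \<Sum>k\<in>K n. a k * torus_char k x) F sequentially"
      unfolding uniform_limit_iff
    proof (intro allI impI)
      fix e :: real assume "e > 0"
      then have "eventually (\<lambda>n. 1 / real (Suc n) < e) sequentially"
        using LIMSEQ_inverse_real_of_nat by (auto simp: inverse_eq_divide dest: order_tendstoD)
      then show "\<forall>\<^sub>F n in sequentially. \<forall>x\<in>UNIV. dist (\<Sum>k\<in>K n. a k * torus_char k x) (F x) < e"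
        by eventually_elim (use K(2) in \<open>auto simp: dist_norm norm_minus_commute intro: le_less_trans\<close>)
    qed
  qed (auto intro!: always_eventually continuous_intros)
qed

lemma char_series_coeff:
  fixes a :: "int^'n \<Rightarrow> complex"
  assumes F: "\<And>x. ((\<lambda>k. a k * torus_char k x) has_sum F x) UNIV"
    and a: "(\<lambda>k. cmod (a k)) summable_on UNIV"
  shows "integrable torus F" and "fourier_coeff F l = a l"
proof -
  interpret finite_measure "torus :: (real^'n) measure" by (rule finite_measure_torus)
  obtain A where A: "((\<lambda>k. cmod (a k)) has_sum A) UNIV" using a by (auto simp: summable_on_def)
  have FA: "cmod (F x) \<le> A" for x by (rule norm_infsum_le[OF F A]) (simp add: norm_mult)
  show Fi: "integrable torus F"
    by (rule integrable_torus_bounded[OF continuous_measurable_torus[OF continuous_on_char_series[OF F a]] FA])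
  have ci: "integrable torus (\<lambda>x. F x * torus_char (- l) x)"
    by (rule integrable_torus_mult[OF Fi, of _ 1]) (auto intro: continuous_measurable_torus continuous_torus_char)
  let ?c = "(2 * of_real pi) ^ CARD('n) :: complex"
  let ?V = "measure torus (space torus :: (real^'n) set)"
  \<comment> \<open>A finite partial sum containing \<open>l\<close> integrates to exactly
    \<open>?c * a l\<close> by orthogonality; the uniform error \<open>e\<close> costs at most
    \<open>e\<close> times the volume.\<close>
  have "cmod ((LINT x|torus. F x * torus_char (- l) x) - ?c * a l) \<le> e * ?V" if e: "e > 0" for e
  proof -
    obtain K where K: "finite K" "l \<in> K" "\<And>x. cmod (F x - (\<Sum>k\<in>K. a k * torus_char k x)) \<le> e"
      using char_series_uniform_approximation[OF F a e, of "{l}"] by auto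
    have eq: "(\<Sum>k\<in>K. a k * torus_char k x) * torus_char (- l) x = (\<Sum>k\<in>K. a k * torus_char (k - l) x)" for x
      by (simp add: sum_distrib_right mult.assoc flip: torus_char_add)
    have "(LINT x|torus. (\<Sum>k\<in>K. a k * torus_char k x) * torus_char (- l) x) = (\<Sum>k\<in>K. a k * (if k = l then ?c else 0))"
      unfolding eq by (simp add: torus_char_integrable torus_char_integral)
    also have "\<dots> = ?c * a l" using K by (simp add: if_distrib cong: if_cong)
    finally have 1: "(LINT x|torus. (\<Sum>k\<in>K. a k * torus_char k x) * torus_char (- l) x) = ?c * a l" .
    have i2: "integrable torus (\<lambda>x. (\<Sum>k\<in>K. a k * torus_char k x) * torus_char (- l) x)"
      unfolding eq by (simp add: torus_char_integrable)
    have "cmod ((LINT x|torus. F x * torus_char (- l) x) - ?c * a l)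
        = cmod (LINT x|torus. (F x - (\<Sum>k\<in>K. a k * torus_char k x)) * torus_char (- l) x)"
      unfolding left_diff_distrib using ci i2 by (simp add: 1)
    also have "\<dots> \<le> (LINT x|torus. cmod ((F x - (\<Sum>k\<in>K. a k * torus_char k x)) * torus_char (- l) x))"
      by (rule integral_norm_bound)
    also have "\<dots> \<le> (LINT x|(torus :: (real^'n) measure). e)"
    proof (rule integral_mono)
      have "integrable torus (\<lambda>x. (F x - (\<Sum>k\<in>K. a k * torus_char k x)) * torus_char (- l) x)"
        unfolding left_diff_distrib using ci i2 by simp
      then show "integrable torus (\<lambda>x. cmod ((F x - (\<Sum>k\<in>K. a k * torus_char k x)) * torus_char (- l) x))"
        by (rule integrable_norm)
    qed (use K in \<open>auto simp: norm_mult\<close>)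
    finally show ?thesis by (simp add: mult.commute)
  qed
  note bound = this
  have "cmod ((LINT x|torus. F x * torus_char (- l) x) - ?c * a l) \<le> 0 + e" if "e > 0" for e
  proof -
    have V: "?V \<ge> 0" by simp
    have "cmod ((LINT x|torus. F x * torus_char (- l) x) - ?c * a l) \<le> e / (?V + 1) * ?V"
      by (rule bound) (use V that in \<open>simp add: add_nonneg_pos\<close>)
    also have "\<dots> \<le> e" using V that by (simp add: divide_simps add_nonneg_pos)
    finally show ?thesis by simp
  qed
  then have "cmod ((LINT x|torus. F x * torus_char (- l) x) - ?c * a l) \<le> 0"
    by (rule field_le_epsilon)
  then show "fourier_coeff F l = a l" unfolding fourier_coeff_eq by simp
qed

subsection \<open>Uniqueness of Fourier coefficients\<close>

text \<open>The embedding glues opposite faces of the cube, so that periodic continuous functions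
  live on a compact set of \<open>complex ^ 'n\<close>, where Stone-Weierstrass applies.\<close>

definition torus_embed :: "real ^ 'n \<Rightarrow> complex ^ 'n" where
  "torus_embed x = (\<chi> j. cis (x $ j))"

inductive trig_poly :: "(real ^ 'n \<Rightarrow> complex) \<Rightarrow> bool" where
  monomial: "trig_poly (\<lambda>x. c * torus_char k x)"
| add: "trig_poly p \<Longrightarrow> trig_poly q \<Longrightarrow> trig_poly (\<lambda>x. p x + q x)"

lemma trig_poly_const: "trig_poly (\<lambda>x. c)"
  using trig_poly.monomial[of c 0] by simp

lemma trig_poly_sum: "finite I \<Longrightarrow> (\<And>i. i \<in> I \<Longrightarrow> trig_poly (p i)) \<Longrightarrow> trig_poly (\<lambda>x. \<Sum>i\<in>I. p i x)"
  by (induction I rule: finite_induct) (auto intro: trig_poly_const trig_poly.add)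

lemma trig_poly_mult:
  assumes p: "trig_poly p" and q: "trig_poly q"
  shows "trig_poly (\<lambda>x. p x * q x)"
  using p
proof induction
  case (monomial c k)
  show ?case using q
  proof induction
    case (monomial d l)
    have "(\<lambda>x. c * torus_char k x * (d * torus_char l x)) = (\<lambda>x. (c * d) * torus_char (k + l) x)"
      by (simp add: torus_char_add mult_ac)
    then show ?case using trig_poly.monomial[of "c * d" "k + l"] by metis
  next
    case (add p q)
    then show ?case using trig_poly.add by (fastforce simp: distrib_left)
  qed
next
  case (add p q)
  then show ?case using trig_poly.add by (fastforce simp: distrib_right)
qed

lemma torus_char_axis: "torus_char (axis j m) x = cis (of_int m * x $ j)"
  by (simp add: torus_char_def of_int_vec_def inner_vec_def axis_def if_distrib[of "\<lambda>m. _ * real_of_int m"] mult.commute cong: if_cong)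

text \<open>A real-linear functional acts on each coordinate as \<open>u * cos + v * sin\<close>,
  which is a combination of the characters of frequency 1 and -1 with coefficients
  \<open>(u - \<i> * v) / 2\<close> and \<open>(u + \<i> * v) / 2\<close>.\<close>

lemma trig_poly_bounded_linear:
  assumes "bounded_linear (f :: complex ^ 'n \<Rightarrow> real)"
  shows "trig_poly (\<lambda>x. of_real (f (torus_embed x)))"
proof -
  interpret f: bounded_linear f by fact
  define u v where "u j = f (axis j 1)" and "v j = f (axis j \<i>)" for j
  have split: "axis j z = Re z *\<^sub>R axis j 1 + Im z *\<^sub>R axis j \<i>" for j :: 'n and z
    by (simp add: vec_eq_iff axis_def complex_eq_iff)
  have fa: "f (axis j z) = Re z * u j + Im z * v j" for j z
    by (subst split) (simp add: f.add f.scaleR u_def v_def)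
  have emb: "torus_embed x = (\<Sum>j\<in>UNIV. axis j (cis (x $ j)))" for x :: "real^'n"
    by (simp add: torus_embed_def vec_eq_iff axis_def)
  have "complex_of_real (f (torus_embed x)) = (\<Sum>j\<in>UNIV.
      ((u j - \<i> * v j) / 2) * torus_char (axis j 1) x + ((u j + \<i> * v j) / 2) * torus_char (axis j (-1)) x)" for x
    unfolding emb f.sum fa of_real_sum torus_char_axis
    by (intro sum.cong refl) (simp add: complex_eq_iff field_simps)
  then have "(\<lambda>x. complex_of_real (f (torus_embed x))) = (\<lambda>x. \<Sum>j\<in>UNIV.
      ((u j - \<i> * v j) / 2) * torus_char (axis j 1) x + ((u j + \<i> * v j) / 2) * torus_char (axis j (-1)) x)"
    by (rule ext)
  then show ?thesis
    by (simp only:) (intro trig_poly_sum trig_poly.intros finite)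
qed

lemma trig_poly_real_polynomial_function:
  "real_polynomial_function p \<Longrightarrow> trig_poly (\<lambda>x. of_real (p (torus_embed x)))"
proof (induction rule: real_polynomial_function.induct)
  case (linear f)
  then show ?case by (rule trig_poly_bounded_linear)
qed (simp_all add: trig_poly_const trig_poly.add trig_poly_mult)

lemma trig_poly_orthogonal:
  fixes g :: "real ^ 'n \<Rightarrow> complex"
  assumes g: "integrable torus g" and g0: "\<And>k. (LINT x|torus. g x * torus_char k x) = 0"
    and p: "trig_poly p"
  shows "integrable torus (\<lambda>x. g x * p x) \<and> (LINT x|torus. g x * p x) = 0"
  using p
proof induction
  case (monomial c k)
  have "integrable torus (\<lambda>x. g x * torus_char k x)"
    by (rule integrable_torus_mult[OF g, of _ 1]) (auto intro: continuous_measurable_torus continuous_torus_char)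
  then have "integrable torus (\<lambda>x. c * (g x * torus_char k x))" by simp
  then show ?case using g0[of k] by (simp add: mult.left_commute)
next
  case (add p q)
  then show ?case by (simp add: distrib_left)
qed

lemma compact_unit_torus: "compact {z :: complex ^ 'n. \<forall>j. cmod (z $ j) = 1}"
proof (rule compact_eq_bounded_closed[THEN iffD2], rule conjI)
  show "bounded {z :: complex ^ 'n. \<forall>j. cmod (z $ j) = 1}"
    unfolding bounded_iff
  proof (intro exI ballI)
    fix z :: "complex ^ 'n" assume "z \<in> {z. \<forall>j. cmod (z $ j) = 1}"
    then have "L2_set (\<lambda>i. norm (z $ i)) UNIV \<le> (\<Sum>i\<in>(UNIV::'n set). 1)"
      by (intro order.trans[OF L2_set_le_sum] sum_mono) auto
    then show "norm z \<le> (\<Sum>i\<in>(UNIV::'n set). 1)" by (simp add: norm_vec_def)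
  qed
  have "{z :: complex ^ 'n. \<forall>j. cmod (z $ j) = 1} = (\<Inter>j. {z. cmod (z $ j) = 1})" by auto
  also have "closed \<dots>" by (intro closed_INT ballI closed_Collect_eq continuous_intros)
  finally show "closed {z :: complex ^ 'n. \<forall>j. cmod (z $ j) = 1}" .
qed

lemma continuous_torus_embed [continuous_intros]: "continuous_on S torus_embed"
  unfolding torus_embed_def by (intro continuous_intros)

text \<open>On the compact unit torus \<phi> is uniformly close to a polynomial, whose composition
  with \<open>torus_embed\<close> is a trigonometric polynomial and hence orthogonal to
  \<open>g\<close>; the error is at most \<open>e\<close> times the integral of
  \<open>cmod (g x)\<close>.\<close>

lemma continuous_function_orthogonal:
  fixes g :: "real ^ 'n \<Rightarrow> complex" and \<phi> :: "complex ^ 'n \<Rightarrow> real"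
  assumes g: "integrable torus g" and g0: "\<And>k. (LINT x|torus. g x * torus_char k x) = 0"
    and \<phi>: "continuous_on UNIV \<phi>"
  shows "integrable torus (\<lambda>x. g x * of_real (\<phi> (torus_embed x)))"
    and "(LINT x|torus. g x * of_real (\<phi> (torus_embed x))) = 0"
proof -
  let ?S = "{z :: complex ^ 'n. \<forall>j. cmod (z $ j) = 1}"
  have S: "torus_embed x \<in> ?S" for x by (simp add: torus_embed_def)
  have "compact (\<phi> ` ?S)"
    using compact_continuous_image[OF continuous_on_subset[OF \<phi>] compact_unit_torus] by simp
  then obtain B where B: "\<And>z. z \<in> ?S \<Longrightarrow> \<bar>\<phi> z\<bar> \<le> B"
    by (force dest!: compact_imp_bounded simp: bounded_iff)
  have cont: "continuous_on UNIV (\<lambda>x. complex_of_real (\<phi> (torus_embed x)))"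
    by (intro continuous_intros continuous_on_compose2[OF \<phi>]) auto
  show int: "integrable torus (\<lambda>x. g x * of_real (\<phi> (torus_embed x)))"
    by (rule integrable_torus_mult[OF g continuous_measurable_torus[OF cont], of B]) (use B S in auto)
  let ?I = "LINT x|torus. g x * of_real (\<phi> (torus_embed x))"
  let ?V = "LINT x|torus. cmod (g x)"
  have bound: "cmod ?I \<le> e * ?V" if e: "e > 0" for e
  proof -
    obtain p where p: "real_polynomial_function p" "\<And>z. z \<in> ?S \<Longrightarrow> \<bar>\<phi> z - p z\<bar> < e"
      using Stone_Weierstrass_real_polynomial_function[OF compact_unit_torus continuous_on_subset[OF \<phi>] e] by auto
    note P = trig_poly_orthogonal[OF g g0 trig_poly_real_polynomial_function[OF p(1)]]
    have "?I = (LINT x|torus. g x * of_real (\<phi> (torus_embed x)) - g x * of_real (p (torus_embed x)))"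
      using int P by simp
    also have "cmod \<dots> \<le> (LINT x|torus. e * cmod (g x))"
    proof (rule Bochner_Integration.integral_norm_bound_integral)
      show "integrable torus (\<lambda>x. e * cmod (g x))" using g by simp
      show "integrable torus (\<lambda>x. g x * of_real (\<phi> (torus_embed x)) - g x * of_real (p (torus_embed x)))"
        using int P by simp
      fix x :: "real^'n"
      have "cmod (g x * of_real (\<phi> (torus_embed x)) - g x * of_real (p (torus_embed x)))
          = cmod (g x) * \<bar>\<phi> (torus_embed x) - p (torus_embed x)\<bar>"
        by (simp flip: right_diff_distrib of_real_diff add: norm_mult)
      also have "\<dots> \<le> cmod (g x) * e"
        using p(2)[OF S[of x]] by (intro mult_left_mono) auto
      finally show "cmod (g x * of_real (\<phi> (torus_embed x)) - g x * of_real (p (torus_embed x))) \<le> e * cmod (g x)"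
        by (simp add: mult.commute)
    qed
    finally show ?thesis by simp
  qed
  have "cmod ?I \<le> 0 + e" if "e > 0" for e
  proof -
    have V: "?V \<ge> 0" by simp
    have "cmod ?I \<le> e / (?V + 1) * ?V"
      by (rule bound) (use V that in \<open>simp add: add_nonneg_pos\<close>)
    also have "\<dots> \<le> e" using V that by (simp add: divide_simps add_nonneg_pos)
    finally show ?thesis by simp
  qed
  then have "cmod ?I \<le> 0" by (rule field_le_epsilon)
  then show "?I = 0" by simp
qed

lemma inj_on_torus_embed: "inj_on torus_embed torus_cube"
proof (rule inj_onI)
  fix x y :: "real^'n" assume x: "x \<in> torus_cube" and y: "y \<in> torus_cube" and eq: "torus_embed x = torus_embed y"
  have "x $ j = y $ j" for j
  proof -
    have "cis (x $ j) = cis (y $ j)" using eq by (simp add: torus_embed_def vec_eq_iff)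
    then have "sin (x $ j) = sin (y $ j) \<and> cos (x $ j) = cos (y $ j)" by (simp add: complex_eq_iff)
    then obtain n :: int where n: "x $ j = y $ j + 2 * pi * of_int n"
      using sin_cos_eq_iff by blast
    have "\<bar>x $ j - y $ j\<bar> < 2 * pi" using x y by (auto simp: abs_less_iff) (smt (verit) pi_gt_zero)+
    then have "2 * pi * \<bar>of_int n :: real\<bar> < 2 * pi * 1" using n by (simp add: abs_mult)
    then have "\<bar>of_int n :: real\<bar> < 1" by (subst (asm) mult_less_cancel_left_pos) auto
    then have "n = 0" by linarith
    then show ?thesis using n by simp
  qed
  then show "x = y" by (simp add: vec_eq_iff)
qed

text \<open>The indicator of \<open>K\<close> is the pointwise limit of truncated distance functions
  to the image of \<open>K\<close>. These see only \<open>torus_embed x\<close>, so the argument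
  rests on the injectivity of the embedding on the half-open cube.\<close>

lemma integral_compact_eq_0:
  fixes g :: "real ^ 'n \<Rightarrow> complex"
  assumes g: "integrable torus g" and g0: "\<And>k. (LINT x|torus. g x * torus_char k x) = 0"
    and K: "compact K" "K \<subseteq> torus_cube"
  shows "(LINT x|torus. g x * indicator K x) = 0"
proof (cases "K = {}")
  case False
  define \<phi> where "\<phi> m z = max 0 (1 - real m * infdist z (torus_embed ` K))" for m :: nat and z :: "complex^'n"
  have cont: "continuous_on UNIV (\<phi> m)" for m unfolding \<phi>_def by (intro continuous_intros)
  have clos: "closed (torus_embed ` K)"
    by (intro compact_imp_closed compact_continuous_image continuous_torus_embed K)
  have zero: "(LINT x|torus. g x * of_real (\<phi> m (torus_embed x))) = 0" for m
    using continuous_function_orthogonal(2)[OF g g0 cont] .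
  have lim: "(\<lambda>m. \<phi> m (torus_embed x)) \<longlonglongrightarrow> indicator K x" if x: "x \<in> torus_cube" for x
  proof (cases "x \<in> K")
    case True
    then show ?thesis by (simp add: \<phi>_def)
  next
    case False
    then have "torus_embed x \<notin> torus_embed ` K"
      using inj_on_torus_embed x K(2) by (auto dest: inj_onD)
    then have pos: "infdist (torus_embed x) (torus_embed ` K) > 0"
      using clos \<open>K \<noteq> {}\<close> infdist_pos_not_in_closed by blast
    then obtain N :: nat where N: "1 < real N * infdist (torus_embed x) (torus_embed ` K)"
      using reals_Archimedean3 by blast
    have "\<phi> m (torus_embed x) = 0" if "m \<ge> N" for m
    proof -
      have "real N * infdist (torus_embed x) (torus_embed ` K) \<le> real m * infdist (torus_embed x) (torus_embed ` K)"
        using that pos by (intro mult_right_mono) auto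
      then show ?thesis using N by (simp add: \<phi>_def)
    qed
    then have "eventually (\<lambda>m. \<phi> m (torus_embed x) = indicator K x) sequentially"
      using False by (auto simp: eventually_sequentially)
    then show ?thesis by (rule tendsto_eventually)
  qed
  have "K \<in> sets lebesgue" using K by (intro fmeasurableD lmeasurable_compact)
  then have K_meas: "(\<lambda>x. complex_of_real (indicator K x)) \<in> borel_measurable torus"
    unfolding torus_def by (intro measurable_restrict_space1) simp
  have "(\<lambda>m. LINT x|torus. g x * of_real (\<phi> m (torus_embed x))) \<longlonglongrightarrow> (LINT x|torus. g x * of_real (indicator K x))"
  proof (rule integral_dominated_convergence[where w = "\<lambda>x. cmod (g x)"])
    show "AE x in torus. (\<lambda>m. g x * of_real (\<phi> m (torus_embed x))) \<longlonglongrightarrow> g x * of_real (indicator K x)"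
      by (rule AE_I2) (auto simp: space_torus intro!: tendsto_mult tendsto_of_real lim)
    show "AE x in torus. norm (g x * of_real (\<phi> m (torus_embed x))) \<le> cmod (g x)" for m
      by (rule AE_I2) (auto simp: norm_mult \<phi>_def infdist_nonneg intro!: mult_left_le)
    show "(\<lambda>x. g x * of_real (\<phi> m (torus_embed x))) \<in> borel_measurable torus" for m
      using continuous_function_orthogonal(1)[OF g g0 cont] by (rule borel_measurable_integrable)
    show "(\<lambda>x. g x * of_real (indicator K x)) \<in> borel_measurable torus"
      using g K_meas by (intro borel_measurable_times) auto
  qed (use g in auto)
  then have "(LINT x|torus. g x * of_real (indicator K x)) = 0"
    unfolding zero by (simp add: LIMSEQ_const_iff)
  moreover have "(\<lambda>x. g x * of_real (indicator K x)) = (\<lambda>x. g x * indicator K x)"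
    by (auto simp: indicator_def)
  ultimately show ?thesis by simp
qed simp

lemma compact_subset_of_positive_measure:
  fixes S :: "'a::euclidean_space set"
  assumes S: "S \<in> sets lebesgue" and ne: "emeasure lebesgue S \<noteq> 0" and bdd: "bounded S"
  obtains T where "compact T" "T \<subseteq> S" "emeasure lebesgue T \<noteq> 0"
proof -
  obtain e :: real where e: "e > 0" "ennreal e \<le> emeasure lebesgue S"
  proof (cases "emeasure lebesgue S")
    case (real r)
    then show ?thesis using ne that[of r] by (auto simp: less_le)
  next
    case top
    then show ?thesis using that[of 1] by simp
  qed
  obtain T where T: "closed T" "T \<subseteq> S" "S - T \<in> lmeasurable" "emeasure lebesgue (S - T) < ennreal e"
    using sets_lebesgue_inner_closed[OF S e(1)] by metis
  have cT: "compact T" using T(1) bounded_subset[OF bdd T(2)] by (simp add: compact_eq_bounded_closed)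
  have Tm: "T \<in> sets lebesgue" using cT by (intro fmeasurableD lmeasurable_compact)
  have "emeasure lebesgue T \<noteq> 0"
  proof
    assume "emeasure lebesgue T = 0"
    then have "emeasure lebesgue S \<le> emeasure lebesgue (S - T) + 0"
      using emeasure_subadditive[of "S - T" lebesgue T] Tm T(2,3) by (simp add: Un_absorb2 fmeasurableD)
    then show False using T(4) e(2) by simp
  qed
  then show ?thesis using that cT T(2) by blast
qed

lemma bounded_torus_cube: "bounded (torus_cube :: (real^'n) set)"
proof (rule bounded_subset[of "cbox (\<chi> j. - pi) (\<chi> j. pi)"])
  show "torus_cube \<subseteq> cbox (\<chi> j. - pi) (\<chi> j::'n. pi)" by (auto simp: mem_box_cart less_imp_le)
qed simp

text \<open>If \<open>u\<close> were positive on a set of positive measure, inner regularity would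
  give a compact part of it with positive measure, and the integral of \<open>u\<close> over that
  part would be positive.\<close>

lemma AE_nonpos_if_compact_integrals_nonpos:
  fixes u :: "real ^ 'n \<Rightarrow> real"
  assumes u: "integrable torus u"
    and u0: "\<And>K. compact K \<Longrightarrow> K \<subseteq> torus_cube \<Longrightarrow> (LINT x|torus. u x * indicator K x) \<le> 0"
  shows "AE x in torus. u x \<le> 0"
proof -
  define P where "P = {x \<in> torus_cube. u x > 0}"
  have um: "u \<in> borel_measurable torus" using u by simp
  have "P \<in> sets torus" using um unfolding P_def space_torus[symmetric] by measurable
  then have P: "P \<in> sets lebesgue"
    using torus_cube_lebesgue unfolding torus_def by (auto simp: sets_restrict_space_iff)
  have "emeasure lebesgue P = 0"
  proof (rule ccontr)
    assume ne: "emeasure lebesgue P \<noteq> 0"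
    have "bounded P"
      by (rule bounded_subset[OF bounded_torus_cube]) (auto simp: P_def)
    then obtain T where cT: "compact T" and T: "T \<subseteq> P" and Tne: "emeasure lebesgue T \<noteq> 0"
      using compact_subset_of_positive_measure[OF P ne] by metis
    have TP: "T \<subseteq> torus_cube" using T unfolding P_def by blast
    have Tm: "T \<in> sets lebesgue" using cT by (intro fmeasurableD lmeasurable_compact)
    have Tt: "T \<in> sets torus"
      using Tm TP torus_cube_lebesgue unfolding torus_def by (auto simp: sets_restrict_space_iff)
    have int: "integrable torus (\<lambda>x. u x * indicator T x)"
      using integrable_mult_indicator[OF Tt u] by (simp add: mult.commute)
    have nn: "AE x in torus. 0 \<le> u x * indicator T x"
      using T by (intro AE_I2) (auto simp: indicator_def P_def)
    have "(LINT x|torus. u x * indicator T x) = 0"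
      using u0[OF cT TP] integral_nonneg_AE[OF nn] by simp
    then have "AE x in torus. u x * indicator T x = 0"
      using integral_nonneg_eq_0_iff_AE[OF int nn] by simp
    then have "AE x in torus. x \<notin> T"
      by eventually_elim (use T in \<open>auto simp: P_def indicator_def split: if_splits\<close>)
    then have "emeasure torus T = 0"
      using Tt by (subst (asm) AE_iff_measurable[of T]) (use TP in \<open>auto simp: space_torus\<close>)
    then show False
      using Tne TP torus_cube_lebesgue unfolding torus_def by (simp add: emeasure_restrict_space)
  qed
  then have "AE x in lebesgue. x \<notin> P"
    using P by (intro AE_I[of _ _ P]) auto
  then show ?thesis
    unfolding torus_def using torus_cube_lebesgue
    by (subst AE_restrict_space_iff) (auto simp: P_def elim!: eventually_mono)
qed

lemma AE_zero_if_fourier_coeffs_zero: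
  fixes g :: "real ^ 'n \<Rightarrow> complex"
  assumes g: "integrable torus g" and g0: "\<And>k. fourier_coeff g k = 0"
  shows "AE x in torus. g x = 0"
proof -
  have c0: "(LINT x|torus. g x * torus_char k x) = 0" for k
    using g0[of "- k"] by (simp add: fourier_coeff_eq)
  \<comment> \<open>Used with the constants 1, -1, \<i> and -\<i>, the one-sided criterion controls
    the real and the imaginary part from both sides.\<close>
  have *: "AE x in torus. Re (c * g x) \<le> 0" for c
  proof (rule AE_nonpos_if_compact_integrals_nonpos)
    have i: "integrable torus (\<lambda>x. c * g x)" using g by simp
    then show "integrable torus (\<lambda>x. Re (c * g x))" by (rule integrable_Re)
    fix K :: "(real^'n) set" assume K: "compact K" "K \<subseteq> torus_cube"
    have Kt: "K \<in> sets torus"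
      using K torus_cube_lebesgue unfolding torus_def
      by (auto simp: sets_restrict_space_iff intro: fmeasurableD lmeasurable_compact)
    have "integrable torus (\<lambda>x. c * (g x * indicator K x))"
      using integrable_mult_indicator[OF Kt g] by (simp add: mult.commute scaleR_conv_of_real of_real_indicator)
    then have "(LINT x|torus. Re (c * (g x * indicator K x))) = Re (LINT x|torus. c * (g x * indicator K x))"
      by (rule integral_Re)
    also have "\<dots> = 0" using integral_compact_eq_0[OF g c0 K] by simp
    also have "(\<lambda>x. Re (c * (g x * indicator K x))) = (\<lambda>x. Re (c * g x) * indicator K x)"
      by (auto simp: indicator_def)
    finally show "(LINT x|torus. Re (c * g x) * indicator K x) \<le> 0" by simp
  qed
  from *[of 1] *[of "-1"] *[of \<i>] *[of "-\<i>"] show ?thesis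
    by eventually_elim (auto simp: complex_eq_iff)
qed

subsection \<open>Vanishing on product sets\<close>

text \<open>\<open>E\<close> is the support of Lebesgue measure restricted to \<open>K\<close>: all
  balls meeting \<open>K\<close> in a null set are removed, and by Lindelof countably many of them
  have the same union, so only a null set is lost.\<close>

lemma compact_support_points:
  fixes K :: "'a::euclidean_space set"
  assumes K: "compact K" "emeasure lebesgue K \<noteq> 0"
  obtains E where "compact E" "E \<subseteq> K" "measure lebesgue E > 0"
    "\<And>x e. x \<in> E \<Longrightarrow> e > 0 \<Longrightarrow> emeasure lborel (K \<inter> cball x e) \<noteq> 0"
proof -
  define \<F> where "\<F> = {ball x e | x e. emeasure lborel (K \<inter> ball x e) = 0}"
  obtain \<F>' where F': "\<F>' \<subseteq> \<F>" "countable \<F>'" "\<Union>\<F>' = \<Union>\<F>"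
    using Lindelof[of \<F>] by (auto simp: \<F>_def)
  have Kb: "K \<in> sets borel" using K by (simp add: compact_imp_closed borel_closed)
  define E where "E = K - \<Union>\<F>"
  have "open (\<Union>\<F>)" by (auto simp: \<F>_def)
  then have E: "compact E" unfolding E_def using K by (intro compact_diff)
  have "(\<Union>B\<in>\<F>'. K \<inter> B) \<in> null_sets lborel"
    using F'(1,2) Kb by (intro null_sets_UN') (auto simp: \<F>_def null_sets_def)
  then have null: "(\<Union>B\<in>\<F>'. K \<inter> B) \<in> null_sets lebesgue" by (rule null_sets_completionI)
  have "K = E \<union> (\<Union>B\<in>\<F>'. K \<inter> B)" using F'(3) by (auto simp: E_def)
  moreover have "E \<in> sets lebesgue" using E by (intro fmeasurableD lmeasurable_compact)
  ultimately have "emeasure lebesgue E = emeasure lebesgue K"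
    using null by (metis emeasure_Un_null_set)
  then have "measure lebesgue E \<noteq> 0"
    using K(2) emeasure_eq_measure2[OF lmeasurable_compact[OF E]] by (metis ennreal_0)
  then have "measure lebesgue E > 0" by (simp add: zero_less_measure_iff)
  moreover have "emeasure lborel (K \<inter> cball x e) \<noteq> 0" if "x \<in> E" "e > 0" for x e
  proof
    assume "emeasure lborel (K \<inter> cball x e) = 0"
    moreover have "emeasure lborel (K \<inter> ball x e) \<le> emeasure lborel (K \<inter> cball x e)"
      using Kb by (intro emeasure_mono) auto
    ultimately have "emeasure lborel (K \<inter> ball x e) = 0" by simp
    then have "ball x e \<in> \<F>" by (auto simp: \<F>_def)
    then show False using that by (auto simp: E_def)
  qed
  ultimately show ?thesis using that[OF E] by (auto simp: E_def)
qed

text \<open>Upgrades vanishing almost everywhere to vanishing at every point of a product. Around a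
  point whose coordinates are support points, each box meets the product of the \<open>K j\<close>
  in positive measure, so a continuous function cannot be nonzero near it.\<close>

lemma continuous_zero_on_compact_product:
  fixes F :: "real ^ 'n \<Rightarrow> complex" and \<Lambda> :: "'n \<Rightarrow> real set"
  assumes F: "continuous_on UNIV F" and pos: "\<And>j. positive_measure_subset (\<Lambda> j)"
    and AE: "AE x in torus. x \<in> product_set \<Lambda> \<longrightarrow> F x = 0"
  shows "\<exists>E. (\<forall>j. compact (E j) \<and> measure lebesgue (E j) > 0) \<and> (\<forall>x. (\<forall>j. x $ j \<in> E j) \<longrightarrow> F x = 0)"
proof -
  have "\<exists>K. compact K \<and> K \<subseteq> \<Lambda> j \<and> K \<subseteq> {-pi..<pi} \<and> emeasure lebesgue K \<noteq> 0" for j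
  proof -
    have L: "\<Lambda> j \<in> sets lebesgue" "\<Lambda> j \<subseteq> {-pi..<pi}" "emeasure lebesgue (\<Lambda> j) \<noteq> 0"
      using pos[of j] unfolding positive_measure_subset_def
      by (auto simp: sets_restrict_space_iff emeasure_restrict_space)
    have "bounded (\<Lambda> j)" by (rule bounded_subset[OF _ L(2)]) (rule bounded_subset[of "{-pi..pi}"], auto)
    from compact_subset_of_positive_measure[OF L(1,3) this] L(2) show ?thesis by (metis subset_trans)
  qed
  then obtain K where K: "\<And>j. compact (K j)" "\<And>j. K j \<subseteq> \<Lambda> j" "\<And>j. K j \<subseteq> {-pi..<pi}" "\<And>j. emeasure lebesgue (K j) \<noteq> 0"
    by metis
  have "\<exists>E. compact E \<and> measure lebesgue E > 0 \<and> (\<forall>x\<in>E. \<forall>e>0. emeasure lborel (K j \<inter> cball x e) \<noteq> 0)" for j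
    using compact_support_points[OF K(1) K(4)] by metis
  then obtain E where E: "\<And>j. compact (E j)" "\<And>j. measure lebesgue (E j) > 0"
    "\<And>j x e. x \<in> E j \<Longrightarrow> e > 0 \<Longrightarrow> emeasure lborel (K j \<inter> cball x e) \<noteq> 0" by metis
  have "F x = 0" if x: "\<And>j. x $ j \<in> E j" for x
  proof (rule ccontr)
    assume "F x \<noteq> 0"
    then obtain d where d: "d > 0" "\<And>y. dist x y < d \<Longrightarrow> F y \<noteq> 0"
      using continuous_on_avoid[OF F, of x 0] by auto
    \<comment> \<open>If every coordinate moves by at most \<open>e\<close>, the sum of the
      coordinate changes, and with it the norm, is at most \<open>d / 2\<close>.\<close>
    define e where "e = d / (2 * CARD('n))"
    have e: "e > 0" using d by (simp add: e_def)
    define W where "W = {y. \<forall>j. y $ j \<in> K j \<inter> cball (x $ j) e}"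
    have Kb: "K j \<inter> cball (x $ j) e \<in> sets borel" for j
      using K(1)[of j] by (intro sets.Int borel_closed closed_cball) (simp add: compact_imp_closed)
    have "emeasure lborel W = (\<Prod>j\<in>UNIV. emeasure lborel (K j \<inter> cball (x $ j) e))"
      unfolding W_def by (rule emeasure_lborel_box) (rule Kb)
    also have "\<dots> \<noteq> 0" using E(3)[OF x e] by (simp add: prod_zero_iff)
    finally have Wne: "emeasure lborel W \<noteq> 0" .
    have Wb: "W \<in> sets borel" unfolding W_def by (rule box_borel) (rule Kb)
    have "AE y in lebesgue. y \<in> torus_cube \<longrightarrow> y \<in> product_set \<Lambda> \<longrightarrow> F y = 0"
      using AE torus_cube_lebesgue unfolding torus_def by (subst (asm) AE_restrict_space_iff) auto
    then have "AE y in lebesgue. y \<notin> W"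
    proof eventually_elim
      case (elim y)
      show ?case
      proof
        assume y: "y \<in> W"
        then have "y $ j \<in> K j" for j by (simp add: W_def)
        then have "y $ j \<in> {-pi..<pi}" "y $ j \<in> \<Lambda> j" for j using K(2,3) by blast+
        then have "y \<in> torus_cube" "y \<in> product_set \<Lambda>" by (auto simp: product_set_def)
        then have "F y = 0" using elim by blast
        have "norm (x - y) \<le> (\<Sum>j\<in>UNIV. \<bar>(x - y) $ j\<bar>)" by (rule norm_le_l1_cart)
        also have "\<dots> \<le> (\<Sum>j\<in>(UNIV::'n set). e)" using y by (intro sum_mono) (auto simp: W_def dist_real_def)
        also have "\<dots> < d" using d by (simp add: e_def)
        finally have "F y \<noteq> 0" using d(2)[of y] by (simp add: dist_norm)
        with \<open>F y = 0\<close> show False by simp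
      qed
    qed
    then have "emeasure lebesgue W = 0"
      using Wb by (subst (asm) AE_iff_measurable[of W]) auto
    then show False using Wne Wb by simp
  qed
  with E(1,2) show ?thesis by blast
qed

text \<open>Freeing one coordinate at a time: in the \<open>i\<close>-th coordinate the series is an exponential
  series with frequencies \<open>k\<^sub>i\<close>, and \<open>\<bar>k\<^sub>i\<bar> \<le> \<bar>k\<bar>\<close>.\<close>

lemma char_series_zero:
  fixes a :: "int ^ 'n \<Rightarrow> complex" and \<psi> :: "real \<Rightarrow> real"
  assumes nonneg: "\<And>x. x \<ge> 0 \<Longrightarrow> \<psi> x \<ge> 0" and incr: "mono_on {0..} \<psi>"
    and lim: "filterlim \<psi> at_top at_top"
    and div: "\<not> summable (\<lambda>k::nat. \<psi> (real k) / (1 + (real k)\<^sup>2))"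
    and F: "\<And>x. ((\<lambda>k. a k * torus_char k x) has_sum F x) UNIV"
    and sm: "(\<lambda>k. cmod (a k) * exp (\<psi> (norm (of_int_vec k)))) summable_on UNIV"
    and E: "\<And>j. compact (E j)" "\<And>j. measure lebesgue (E j) > 0"
    and zero: "\<And>x. (\<And>j. x $ j \<in> E j) \<Longrightarrow> F x = 0"
  shows "F x = 0"
proof -
  \<comment> \<open>\<open>D\<close> collects the coordinates already freed; those outside it are
    still confined to their sets \<open>E j\<close>.\<close>
  have "(\<forall>j. j \<notin> D \<longrightarrow> x $ j \<in> E j) \<Longrightarrow> F x = 0" if "finite D" for D x
    using that
  proof (induction D arbitrary: x rule: finite_induct)
    case empty
    then show ?case using zero by simp
  next
    case (insert i D)
    define upd where "upd t = (\<chi> j. if j = i then t else x $ j)" for t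
    have char_upd: "torus_char k (upd t) = torus_char k (upd 0) * cis (of_int (k $ i) * t)" for k t
    proof -
      have "torus_char k (upd t) = cis (of_int (k $ i) * t) * (\<Prod>j\<in>UNIV-{i}. cis (of_int (k $ j) * x $ j))" for t
        unfolding torus_char_prod by (subst prod.remove[of _ i]) (auto simp: upd_def intro!: prod.cong)
      from this[of t] this[of 0] show ?thesis by (simp add: mult.commute)
    qed
    have "F (upd t) = 0" for t
    proof (rule quasianalytic_uniqueness_line[OF nonneg incr lim div, where f = "\<lambda>t. F (upd t)"
          and a = "\<lambda>k. a k * torus_char k (upd 0)" and t = "\<lambda>k. real_of_int (k $ i)" and E = "E i"])
      show "((\<lambda>k. (a k * torus_char k (upd 0)) * cis (real_of_int (k $ i) * t)) has_sum F (upd t)) UNIV" for t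
        using F[of "upd t"] by (simp add: char_upd[of _ t] mult.assoc)
      show "(\<lambda>k. cmod (a k * torus_char k (upd 0)) * exp (\<psi> \<bar>real_of_int (k $ i)\<bar>)) summable_on UNIV"
      proof (rule summable_on_comparison_test[OF sm])
        fix k :: "int ^ 'n"
        have "\<bar>real_of_int (k $ i)\<bar> \<le> norm (of_int_vec k)"
          using component_le_norm_cart[of "of_int_vec k" i] by (simp add: of_int_vec_def)
        then have "\<psi> \<bar>real_of_int (k $ i)\<bar> \<le> \<psi> (norm (of_int_vec k))"
          by (intro mono_onD[OF incr]) auto
        then show "cmod (a k * torus_char k (upd 0)) * exp (\<psi> \<bar>real_of_int (k $ i)\<bar>)
            \<le> cmod (a k) * exp (\<psi> (norm (of_int_vec k)))"
          by (simp add: norm_mult mult_left_mono)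
      qed simp
      show "F (upd t) = 0" if "t \<in> E i" for t
        by (rule insert.IH) (use that insert.prems in \<open>auto simp: upd_def\<close>)
    qed (use E in auto)
    moreover have "upd (x $ i) = x" by (simp add: upd_def vec_eq_iff)
    ultimately show ?case by metis
  qed
  from this[of UNIV x] show ?thesis by simp
qed

text \<open>The sum \<open>F\<close> of the Fourier series is a continuous representative of
  \<open>f\<close>: the coefficients agree, so the functions agree almost everywhere. Pointwise
  zeros are meaningful for \<open>F\<close>.\<close>

lemma vanishing_if_weight_diverges:
  fixes f :: "real ^ 'n \<Rightarrow> complex" and \<Lambda> :: "'n \<Rightarrow> real set" and \<psi> :: "real \<Rightarrow> real"
  assumes nonneg: "\<And>x. x \<ge> 0 \<Longrightarrow> \<psi> x \<ge> 0" and incr: "mono_on {0..} \<psi>"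
    and lim: "filterlim \<psi> at_top at_top"
    and div: "\<not> summable (\<lambda>k::nat. \<psi> (real k) / (1 + (real k)\<^sup>2))"
    and f: "integrable torus f"
    and sm: "(\<lambda>k. cmod (fourier_coeff f k) * exp (\<psi> (norm (of_int_vec k)))) summable_on UNIV"
    and pos: "\<And>j. positive_measure_subset (\<Lambda> j)"
    and zero: "AE x in torus. x \<in> product_set \<Lambda> \<longrightarrow> f x = 0"
  shows "AE x in torus. f x = 0"
proof -
  define F where "F x = infsum (\<lambda>k. fourier_coeff f k * torus_char k x) UNIV" for x :: "real^'n"
  have a: "(\<lambda>k. cmod (fourier_coeff f k)) summable_on UNIV"
  proof (rule summable_on_comparison_test[OF sm])
    show "cmod (fourier_coeff f k) \<le> cmod (fourier_coeff f k) * exp (\<psi> (norm (of_int_vec k)))" for k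
      using nonneg[of "norm (of_int_vec k)"] by (simp add: mult_le_cancel_left1)
  qed simp
  have F: "((\<lambda>k. fourier_coeff f k * torus_char k x) has_sum F x) UNIV" for x
    unfolding F_def by (rule has_sum_infsum, rule abs_summable_summable) (use a in \<open>simp add: norm_mult\<close>)
  have Fi: "integrable torus F" by (rule char_series_coeff(1)[OF F a])
  have ci: "integrable torus (\<lambda>x. h x * torus_char k x)" if "integrable torus h" for h and k :: "int^'n"
    by (rule integrable_torus_mult[OF that, of _ 1]) (auto intro: continuous_measurable_torus continuous_torus_char)
  have "fourier_coeff (\<lambda>x. f x - F x) k = fourier_coeff f k - fourier_coeff F k" for k
    unfolding fourier_coeff_eq left_diff_distrib using ci[OF f] ci[OF Fi] by (simp add: right_diff_distrib)
  then have "AE x in torus. f x - F x = 0"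
    using char_series_coeff(2)[OF F a] f Fi by (intro AE_zero_if_fourier_coeffs_zero) auto
  then have eq: "AE x in torus. f x = F x" by simp
  have Fz: "AE x in torus. x \<in> product_set \<Lambda> \<longrightarrow> F x = 0"
    using eq zero by eventually_elim auto
  obtain E where E: "\<forall>j. compact (E j) \<and> measure lebesgue (E j) > 0" "\<forall>x. (\<forall>j. x $ j \<in> E j) \<longrightarrow> F x = 0"
    using continuous_zero_on_compact_product[OF continuous_on_char_series[OF F a] pos Fz] by (elim exE conjE)
  have "F x = 0" for x
    by (rule char_series_zero[OF nonneg incr lim div F sm, of E]) (use E in auto)
  then show ?thesis using eq by simp
qed

subsection \<open>Iterated averages\<close>

lemma continuous_antiderivative:
  fixes h :: "real \<Rightarrow> 'a::euclidean_space"
  assumes "continuous_on UNIV h"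
  obtains H where "\<And>x. (H has_vector_derivative h x) (at x)"
  using einterval_antiderivative[of "-\<infinity>" "\<infinity>" h] assms
  by (auto simp: continuous_on_eq_continuous_at)

lemma integral_eq_antiderivative_diff:
  fixes h :: "real \<Rightarrow> 'a::euclidean_space"
  assumes "\<And>x. (H has_vector_derivative h x) (at x)" "u \<le> v"
  shows "integral {u..v} h = H v - H u"
  by (intro integral_unique fundamental_theorem_of_calculus assms has_vector_derivative_at_within)

text \<open>Convolution with the uniform probability density on \<open>{-a..a}\<close>; on the m-th
  Fourier coefficient it acts as multiplication by \<open>sin (m * a) / (m * a)\<close>.\<close>

definition average :: "real \<Rightarrow> (real \<Rightarrow> real) \<Rightarrow> real \<Rightarrow> real" where
  "average a h x = integral {x-a..x+a} h / (2 * a)"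

lemma average_has_real_derivative:
  assumes h: "continuous_on UNIV h" and a: "a > 0"
  shows "(average a h has_real_derivative (h (x + a) - h (x - a)) / (2 * a)) (at x)"
proof -
  obtain H where H: "\<And>x. (H has_vector_derivative h x) (at x)"
    using continuous_antiderivative[OF h] by blast
  have D: "(H has_real_derivative h y) (at y)" for y
    using H by (simp add: has_real_derivative_iff_has_vector_derivative)
  have eq: "average a h = (\<lambda>x. (H (x + a) - H (x - a)) / (2 * a))"
    using a by (auto simp: average_def integral_eq_antiderivative_diff[OF H])
  have "((\<lambda>x. H (x + a)) has_real_derivative h (x + a)) (at x)"
       "((\<lambda>x. H (x - a)) has_real_derivative h (x - a)) (at x)"
    using DERIV_shift[of H "h (x + a)" x a] D[of "x + a"] DERIV_shift[of H "h (x - a)" x "- a"] D[of "x - a"]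
    by simp_all
  then show ?thesis unfolding eq by (intro DERIV_cdivide DERIV_diff)
qed

lemma continuous_average:
  assumes "continuous_on UNIV h" "a > 0"
  shows "continuous_on UNIV (average a h)"
  using average_has_real_derivative[OF assms] by (intro DERIV_continuous_on) (auto intro: has_field_derivative_at_within)

lemma average_diff_bound:
  assumes h: "continuous_on UNIV h" and g: "continuous_on UNIV g" and a: "a > 0"
    and e: "\<And>t. t \<in> {x-a..x+a} \<Longrightarrow> \<bar>h t - g t\<bar> \<le> e"
  shows "\<bar>average a h x - average a g x\<bar> \<le> e"
proof -
  have c: "continuous_on {x-a..x+a} h" "continuous_on {x-a..x+a} g"
    using h g continuous_on_subset by blast+
  have "norm (integral {x-a..x+a} (\<lambda>t. h t - g t)) \<le> e * ((x + a) - (x - a))"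
    by (rule integral_bound) (use a e c in \<open>auto intro: continuous_on_diff\<close>)
  moreover have "integral {x-a..x+a} (\<lambda>t. h t - g t) = integral {x-a..x+a} h - integral {x-a..x+a} g"
    by (intro Henstock_Kurzweil_Integration.integral_diff integrable_continuous_real c)
  ultimately show ?thesis
    using a by (simp add: average_def field_simps flip: diff_divide_distrib)
qed

lemma average_const: "a > 0 \<Longrightarrow> average a (\<lambda>_. c) x = c"
  by (simp add: average_def)

lemma average_periodic:
  assumes "\<And>x. h (x + p) = h x"
  shows "average a h (x + p) = average a h x"
proof -
  have "h \<circ> (+) p = h" using assms by (auto simp: add.commute)
  then have "integral {x-a..x+a} h = integral {x-a+p..x+a+p} h"
    using integral_shift_Icc_real[of "x-a" "x+a" h p] by simp
  then show ?thesis by (simp add: average_def algebra_simps)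
qed

section \<open>The infinitely averaged cosine bump\<close>

definition cos_bump :: "real \<Rightarrow> real" where "cos_bump x = max 0 (cos x)"

lemma continuous_cos_bump: "continuous_on UNIV cos_bump"
  unfolding cos_bump_def by (intro continuous_intros)

lemma cos_bump_lipschitz: "\<bar>cos_bump x - cos_bump y\<bar> \<le> \<bar>x - y\<bar>"
proof -
  have "\<bar>cos x - cos y\<bar> = 2 * \<bar>sin ((x + y) / 2)\<bar> * \<bar>sin ((y - x) / 2)\<bar>"
    by (simp add: cos_diff_cos abs_mult)
  also have "\<dots> \<le> 2 * 1 * \<bar>(y - x) / 2\<bar>"
    by (intro mult_mono abs_sin_x_le_abs_x) auto
  finally show ?thesis by (auto simp: cos_bump_def)
qed

text \<open>The width \<open>a 0\<close> belongs to the outermost average. Increasing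
  \<open>M\<close> thus inserts a new innermost average next to \<open>cos_bump\<close>, while a
  derivative removes \<open>a 0\<close> and leaves the shifted sequence.\<close>

primrec iterated_average :: "nat \<Rightarrow> (nat \<Rightarrow> real) \<Rightarrow> real \<Rightarrow> real" where
  "iterated_average 0 a = cos_bump"
| "iterated_average (Suc M) a = average (a 0) (iterated_average M (\<lambda>i. a (Suc i)))"

lemma continuous_iterated_average: "(\<And>i. a i > 0) \<Longrightarrow> continuous_on UNIV (iterated_average M a)"
  by (induction M arbitrary: a) (auto intro: continuous_cos_bump continuous_average)

text \<open>The two functions differ by one average of width \<open>a M\<close> applied directly to
  \<open>cos_bump\<close>, which moves a 1-Lipschitz function by at most \<open>a M\<close>; the
  outer averages do not increase the uniform distance.\<close>

lemma iterated_average_step: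
  assumes "\<And>i. a i > 0"
  shows "\<bar>iterated_average (Suc M) a x - iterated_average M a x\<bar> \<le> a M"
  using assms
proof (induction M arbitrary: a x)
  case 0
  have "\<bar>average (a 0) cos_bump x - average (a 0) (\<lambda>_. cos_bump x) x\<bar> \<le> a 0"
  proof (rule average_diff_bound)
    show "\<bar>cos_bump t - cos_bump x\<bar> \<le> a 0" if "t \<in> {x - a 0..x + a 0}" for t
      using cos_bump_lipschitz[of t x] that by auto
  qed (use 0 in \<open>auto intro: continuous_cos_bump\<close>)
  then show ?case using 0 by (simp add: average_const)
next
  case (Suc M)
  let ?b = "\<lambda>i. a (Suc i)"
  have "\<bar>average (a 0) (iterated_average (Suc M) ?b) x - average (a 0) (iterated_average M ?b) x\<bar> \<le> a (Suc M)"
  proof (rule average_diff_bound)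
    show "\<bar>iterated_average (Suc M) ?b t - iterated_average M ?b t\<bar> \<le> a (Suc M)" for t
      by (rule Suc.IH) (rule Suc.prems)
  qed (use Suc.prems in \<open>auto intro!: continuous_iterated_average simp del: iterated_average.simps\<close>)
  then show ?case by simp
qed

lemma iterated_average_periodic: "iterated_average M a (x + 2 * pi) = iterated_average M a x"
  by (induction M arbitrary: a x) (auto simp: cos_bump_def intro: average_periodic)

text \<open>\<open>cos_bump\<close> vanishes between \<open>pi / 2\<close> and
  \<open>3 * pi / 2\<close>, and each average shortens the zero interval at both ends by its
  half-length.\<close>

lemma iterated_average_zero:
  assumes "\<And>i. a i > 0" "x \<in> {pi/2 + (\<Sum>i<M. a i)..3*pi/2 - (\<Sum>i<M. a i)}"
  shows "iterated_average M a x = 0"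
  using assms
proof (induction M arbitrary: a x)
  case 0
  have "cos x = - sin (x - pi / 2)" by (simp add: sin_diff)
  moreover have "sin (x - pi / 2) \<ge> 0" using 0 by (intro sin_ge_zero) auto
  ultimately show ?case by (simp add: cos_bump_def)
next
  case (Suc M)
  let ?b = "\<lambda>i. a (Suc i)"
  have "(\<Sum>i<Suc M. a i) = a 0 + (\<Sum>i<M. ?b i)" by (rule sum.lessThan_Suc_shift)
  then have "iterated_average M ?b t = 0" if "t \<in> {x - a 0..x + a 0}" for t
    using Suc.prems that by (intro Suc.IH) auto
  then have "\<bar>average (a 0) (iterated_average M ?b) x - average (a 0) (\<lambda>_. 0) x\<bar> \<le> 0"
    by (intro average_diff_bound continuous_iterated_average) (use Suc.prems in auto)
  then show ?case using Suc.prems by (simp add: average_const)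
qed

text \<open>The limit of the iterated averages, written as a telescoping series whose i-th term is
  bounded by \<open>a i\<close>, as the Weierstrass test requires.\<close>

definition smooth_bump :: "(nat \<Rightarrow> real) \<Rightarrow> real \<Rightarrow> real" where
  "smooth_bump a x = cos_bump x + (\<Sum>i. iterated_average (Suc i) a x - iterated_average i a x)"

locale widths =
  fixes a :: "nat \<Rightarrow> real"
  assumes pos: "a i > 0" and summable_widths: "summable a"
begin

lemma uniform_limit_iterated_average:
  "uniform_limit UNIV (\<lambda>M. iterated_average M a) (smooth_bump a) sequentially"
proof -
  have "uniform_limit UNIV (\<lambda>M x. \<Sum>i<M. iterated_average (Suc i) a x - iterated_average i a x)
      (\<lambda>x. \<Sum>i. iterated_average (Suc i) a x - iterated_average i a x) sequentially"
    by (rule Weierstrass_m_test[OF _ summable_widths])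
       (use iterated_average_step[OF pos] in \<open>simp only: real_norm_def\<close>)
  then have "uniform_limit UNIV (\<lambda>M x. cos_bump x + (\<Sum>i<M. iterated_average (Suc i) a x - iterated_average i a x))
      (\<lambda>x. cos_bump x + (\<Sum>i. iterated_average (Suc i) a x - iterated_average i a x)) sequentially"
    by (intro uniform_limit_add uniform_limit_const)
  moreover have "cos_bump x + (\<Sum>i<M. iterated_average (Suc i) a x - iterated_average i a x) = iterated_average M a x" for M x
    by (subst sum_lessThan_telescope) simp
  ultimately show ?thesis unfolding smooth_bump_def by simp
qed

lemma iterated_average_tendsto: "(\<lambda>M. iterated_average M a x) \<longlonglongrightarrow> smooth_bump a x"
  using uniform_limit_iterated_average by (rule tendsto_uniform_limitI) simp

lemma continuous_smooth_bump: "continuous_on UNIV (smooth_bump a)"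
  by (rule uniform_limit_theorem[OF _ uniform_limit_iterated_average])
     (auto intro: continuous_iterated_average pos always_eventually)

lemma smooth_bump_periodic: "smooth_bump a (x + 2 * pi) = smooth_bump a x"
  using LIMSEQ_unique[OF iterated_average_tendsto[of "x + 2 * pi"]] iterated_average_tendsto[of x]
  by (simp add: iterated_average_periodic)

lemma smooth_bump_near_cos_bump: "\<bar>smooth_bump a x - cos_bump x\<bar> \<le> suminf a"
proof -
  have "norm (\<Sum>i. iterated_average (Suc i) a x - iterated_average i a x) \<le> suminf a"
    by (rule norm_suminf_le[OF _ summable_widths])
       (use iterated_average_step[OF pos] in \<open>simp only: real_norm_def\<close>)
  then show ?thesis by (simp add: smooth_bump_def)
qed

lemma smooth_bump_zero:
  assumes "x \<in> {pi/2 + suminf a..3*pi/2 - suminf a}"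
  shows "smooth_bump a x = 0"
proof -
  have "iterated_average M a x = 0" for M
  proof (rule iterated_average_zero[OF pos])
    have "(\<Sum>i<M. a i) \<le> suminf a"
      using pos by (intro sum_le_suminf summable_widths) (auto intro: less_imp_le)
    then show "x \<in> {pi/2 + (\<Sum>i<M. a i)..3*pi/2 - (\<Sum>i<M. a i)}" using assms by auto
  qed
  then show ?thesis using iterated_average_tendsto[of x] by (simp add: LIMSEQ_const_iff)
qed

lemma widths_tail: "widths (\<lambda>i. a (i + n))"
  using pos summable_widths by unfold_locales (auto simp: summable_iff_shift)

text \<open>The self-similarity on which both smoothness and decay rest. Convergence of the iterated
  averages is uniform, so the limit passes through the outer average.\<close>

lemma smooth_bump_average: "smooth_bump a = average (a 0) (smooth_bump (\<lambda>i. a (Suc i)))"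
proof
  fix x
  let ?b = "\<lambda>i. a (Suc i)"
  interpret b: widths ?b using widths_tail[of 1] by simp
  have "(\<lambda>M. average (a 0) (iterated_average M ?b) x) \<longlonglongrightarrow> average (a 0) (smooth_bump ?b) x"
  proof (rule tendstoI)
    fix e :: real assume e: "e > 0"
    have "eventually (\<lambda>M. \<forall>t\<in>UNIV. dist (iterated_average M ?b t) (smooth_bump ?b t) < e / 2) sequentially"
      using uniform_limitD[OF b.uniform_limit_iterated_average, of "e / 2"] e by simp
    then show "eventually (\<lambda>M. dist (average (a 0) (iterated_average M ?b) x) (average (a 0) (smooth_bump ?b) x) < e) sequentially"
    proof eventually_elim
      case (elim M)
      have "\<bar>average (a 0) (iterated_average M ?b) x - average (a 0) (smooth_bump ?b) x\<bar> \<le> e / 2"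
        by (rule average_diff_bound)
           (use elim pos in \<open>auto intro!: continuous_iterated_average b.continuous_smooth_bump less_imp_le simp: dist_real_def\<close>)
      then show ?case using e by (simp add: dist_real_def)
    qed
  qed
  then have "(\<lambda>M. iterated_average (Suc M) a x) \<longlonglongrightarrow> average (a 0) (smooth_bump ?b) x" by simp
  then show "smooth_bump a x = average (a 0) (smooth_bump ?b) x"
    using LIMSEQ_Suc[OF iterated_average_tendsto[of x]] LIMSEQ_unique by blast
qed

end

text \<open>A class closed under differentiation: the derivative of a bump is a multiple of the
  difference of two translates of the bump with the tail widths, so one induction yields all
  orders.\<close>

inductive bump_combination :: "(real \<Rightarrow> real) \<Rightarrow> bool" where
  shift: "widths a \<Longrightarrow> bump_combination (\<lambda>x. c * smooth_bump a (x + t))"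
| add: "bump_combination g \<Longrightarrow> bump_combination h \<Longrightarrow> bump_combination (\<lambda>x. g x + h x)"

lemma bump_combination_scale: "bump_combination h \<Longrightarrow> bump_combination (\<lambda>x. c * h x)"
proof (induction rule: bump_combination.induct)
  case (shift a d t)
  then show ?case using bump_combination.shift[of a "c * d" t] by (simp add: mult.assoc)
next
  case (add g h)
  then show ?case using bump_combination.add[OF add.IH] by (simp add: distrib_left)
qed

lemma bump_combination_derivative:
  "bump_combination h \<Longrightarrow> \<exists>h'. bump_combination h' \<and> (\<forall>x. (h has_real_derivative h' x) (at x))"
proof (induction rule: bump_combination.induct)
  case (shift a c t)
  interpret widths a by fact
  let ?b = "\<lambda>i. a (Suc i)"
  interpret b: widths ?b using widths_tail[of 1] by simp
  define d where "d = c / (2 * a 0)"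
  define h' where "h' x = d * smooth_bump ?b (x + (t + a 0)) + (- d) * smooth_bump ?b (x + (t - a 0))" for x
  have "bump_combination h'" unfolding h'_def
    by (intro bump_combination.intros b.widths_axioms)
  moreover have "((\<lambda>x. c * smooth_bump a (x + t)) has_real_derivative h' x) (at x)" for x
  proof -
    have "(smooth_bump a has_real_derivative
        (smooth_bump ?b (x + t + a 0) - smooth_bump ?b (x + t - a 0)) / (2 * a 0)) (at (x + t))"
      unfolding smooth_bump_average by (rule average_has_real_derivative[OF b.continuous_smooth_bump pos])
    then have "((\<lambda>x. smooth_bump a (x + t)) has_real_derivative
        (smooth_bump ?b (x + t + a 0) - smooth_bump ?b (x + t - a 0)) / (2 * a 0)) (at x)"
      by (simp add: DERIV_shift)
    from DERIV_cmult[OF this, of c] show ?thesis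
      by (simp add: h'_def d_def algebra_simps diff_divide_distrib)
  qed
  ultimately show ?case by blast
next
  case (add g h)
  then obtain g' h' where "bump_combination g'" "\<And>x. (g has_real_derivative g' x) (at x)"
    "bump_combination h'" "\<And>x. (h has_real_derivative h' x) (at x)" by blast
  then show ?case by (intro exI[of _ "\<lambda>x. g' x + h' x"]) (auto intro: bump_combination.add DERIV_add)
qed

lemma C_k_bump_combination:
  "bump_combination h \<Longrightarrow> C_k m (\<lambda>x::real^'n. complex_of_real (h (x $ j)))"
proof (induction m arbitrary: h)
  case 0
  from bump_combination_derivative[OF 0] have "continuous_on UNIV h"
    by (metis DERIV_continuous_on has_field_derivative_at_within)
  then show ?case by (auto intro!: continuous_intros continuous_on_compose2[of UNIV h])
next
  case (Suc m)
  obtain h' where h': "bump_combination h'" "\<And>x. (h has_real_derivative h' x) (at x)"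
    using bump_combination_derivative[OF Suc.prems] by blast
  have D: "((\<lambda>x::real^'n. complex_of_real (h (x $ j))) has_derivative
      (\<lambda>v. complex_of_real (v $ j * h' (x $ j)))) (at x)" for x
  proof -
    have "((\<lambda>x::real^'n. x $ j) has_derivative (\<lambda>v. v $ j)) (at x)"
      by (rule bounded_linear.has_derivative[OF bounded_linear_vec_nth has_derivative_ident])
    moreover have "(h has_derivative (\<lambda>v. v * h' (x $ j))) (at (x $ j))"
      using h'(2)[of "x $ j"] by (simp add: has_field_derivative_def mult_commute_abs)
    ultimately have "((\<lambda>x::real^'n. h (x $ j)) has_derivative (\<lambda>v. v $ j * h' (x $ j))) (at x)"
      by (rule has_derivative_compose)
    then show ?thesis by (rule has_derivative_of_real)
  qed
  have "frechet_derivative (\<lambda>x::real^'n. complex_of_real (h (x $ j))) (at x) v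
      = complex_of_real (v $ j * h' (x $ j))" for x v
    using frechet_derivative_at[OF D[of x]] by metis
  then show ?case
    using D Suc.IH[OF bump_combination_scale[OF h'(1)]] by (auto simp: differentiable_def)
qed

subsection \<open>Fourier coefficients of iterated averages\<close>

text \<open>With an antiderivative \<open>P\<close>, the integral is
  \<open>P (c + pi) - P (c - pi)\<close>, whose derivative in \<open>c\<close> is zero by
  periodicity.\<close>

lemma integral_period_shift:
  fixes p :: "real \<Rightarrow> complex"
  assumes p: "continuous_on UNIV p" and per: "\<And>t. p (t + 2 * pi) = p t"
  shows "integral {-pi + c..pi + c} p = integral {-pi..pi} p"
proof -
  obtain P where P: "\<And>x. (P has_vector_derivative p x) (at x)"
    using continuous_antiderivative[OF p] by blast
  have shift: "((\<lambda>c. P (c + d)) has_vector_derivative p (x + d)) (at x)" for d x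
  proof -
    have "((\<lambda>c. c + d) has_vector_derivative 1) (at x)" by (auto intro!: derivative_eq_intros)
    from vector_diff_chain_at[OF this P[of "x + d"]] show ?thesis by (simp add: o_def)
  qed
  have "((\<lambda>c. P (c + pi) - P (c + (- pi))) has_vector_derivative p (x + pi) - p (x + (- pi))) (at x)" for x
    by (rule has_vector_derivative_diff[OF shift shift])
  moreover have "p (x + pi) = p (x + (- pi))" for x using per[of "x - pi"] by (simp add: add.commute)
  ultimately have "((\<lambda>c. P (c + pi) - P (c + (- pi))) has_vector_derivative 0) (at x within UNIV)" for x
    by simp
  then obtain d where "\<And>x. P (x + pi) - P (x + (- pi)) = d"
    using has_vector_derivative_zero_constant[of UNIV "\<lambda>c. P (c + pi) - P (c + (- pi))"] by auto
  from this[of c] this[of 0] show ?thesis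
    by (simp add: integral_eq_antiderivative_diff[OF P] add.commute)
qed

text \<open>Unnormalised and with the sign of the frequency reversed: \<open>2 * pi\<close> times
  the usual Fourier coefficient at \<open>- m\<close>.\<close>

definition period_coeff :: "(real \<Rightarrow> real) \<Rightarrow> int \<Rightarrow> complex" where
  "period_coeff h m = integral {-pi..pi} (\<lambda>t. of_real (h t) * cis (of_int m * t))"

lemma cis_period: "cis (of_int m * (t + 2 * pi)) = cis (of_int m * t)"
  using cis_mult[of "of_int m * t" "2 * pi * of_int m"] cis_multiple_2pi[of "of_int m"]
  by (simp add: algebra_simps)

lemma period_coeff_translate:
  assumes h: "continuous_on UNIV h" and per: "\<And>t. h (t + 2 * pi) = h t"
  shows "integral {-pi..pi} (\<lambda>t. of_real (h (t + c)) * cis (of_int m * t)) = cis (- (of_int m * c)) * period_coeff h m"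
proof -
  let ?p = "\<lambda>t. complex_of_real (h t) * cis (of_int m * t)"
  have cont: "continuous_on UNIV ?p"
    by (intro continuous_intros continuous_on_compose2[OF h]) auto
  have eq: "cis (of_int m * t) = cis (- (of_int m * c)) * cis (of_int m * (c + t))" for t
    by (simp add: cis_mult distrib_left)
  have "complex_of_real (h (t + c)) * cis (of_int m * t) = cis (- (of_int m * c)) * (?p \<circ> (+) c) t" for t
    unfolding o_def eq[of t] by (simp only: mult.left_commute add.commute)
  then have "integral {-pi..pi} (\<lambda>t. of_real (h (t + c)) * cis (of_int m * t))
      = integral {-pi..pi} (\<lambda>t. cis (- (of_int m * c)) * (?p \<circ> (+) c) t)"
    by (simp only:)
  also have "\<dots> = cis (- (of_int m * c)) * integral {-pi..pi} (?p \<circ> (+) c)"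
    by (rule integral_mult_right)
  also have "integral {-pi..pi} (?p \<circ> (+) c) = integral {-pi + c..pi + c} ?p"
    by (rule integral_shift_Icc_real)
  also have "\<dots> = integral {-pi..pi} ?p"
    by (rule integral_period_shift[OF cont]) (simp add: per cis_period)
  finally show ?thesis by (simp add: period_coeff_def)
qed

text \<open>Integration by parts over a period has no boundary term, and the derivative of the
  average is a difference of two translates of \<open>h\<close>, whose coefficients differ from that
  of \<open>h\<close> by the phases \<open>cis (- (m * a))\<close> and
  \<open>cis (m * a)\<close>.\<close>

lemma period_coeff_average:
  assumes h: "continuous_on UNIV h" and per: "\<And>t. h (t + 2 * pi) = h t" and a: "a > 0" and m: "m \<noteq> 0"
  shows "period_coeff (average a h) m = of_real (sin (of_int m * a) / (of_int m * a)) * period_coeff h m"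
proof -
  let ?E = "\<lambda>t::real. cis (of_int m * t)"
  let ?u = "average a h"
  define u' where "u' t = (h (t + a) - h (t - a)) / (2 * a)" for t
  have u: "continuous_on UNIV ?u" by (rule continuous_average[OF h a])
  have cont: "continuous_on UNIV (\<lambda>t. complex_of_real (f t) * ?E t)" if "continuous_on UNIV f" for f
    by (intro continuous_intros continuous_on_compose2[OF that]) auto
  have int: "(\<lambda>t. complex_of_real (f t) * ?E t) integrable_on {-pi..pi}" if "continuous_on UNIV f" for f
    by (intro integrable_continuous_real continuous_on_subset[OF cont[OF that]]) auto
  have shift: "continuous_on UNIV (\<lambda>t. h (t + c))" for c
    by (intro continuous_on_compose2[OF h] continuous_intros) auto
  have u'c: "continuous_on UNIV u'" unfolding u'_def
    using shift[of a] shift[of "- a"] a by (intro continuous_intros) auto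
  have "((\<lambda>t. complex_of_real (?u t) * ?E t) has_vector_derivative
      complex_of_real (?u t) * (\<i> * of_int m * ?E t) + complex_of_real (u' t) * ?E t) (at t within {-pi..pi})" for t
  proof (rule has_vector_derivative_mult)
    show "((\<lambda>t. complex_of_real (?u t)) has_vector_derivative complex_of_real (u' t)) (at t within {-pi..pi})"
      using average_has_real_derivative[OF h a, of t] unfolding u'_def
      by (rule has_vector_derivative_of_real[OF has_field_derivative_at_within])
    show "(?E has_vector_derivative \<i> * of_int m * ?E t) (at t within {-pi..pi})"
    proof -
      have "((\<lambda>z. exp (\<i> * (of_int m * z))) has_field_derivative
          \<i> * of_int m * exp (\<i> * (of_int m * of_real t))) (at (of_real t))"
        by (auto intro!: derivative_eq_intros)
      from has_vector_derivative_real_field[OF this] show ?thesis by (simp add: cis_conv_exp)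
    qed
  qed
  then have "((\<lambda>t. complex_of_real (?u t) * (\<i> * of_int m * ?E t) + complex_of_real (u' t) * ?E t) has_integral
      complex_of_real (?u pi) * ?E pi - complex_of_real (?u (- pi)) * ?E (- pi)) {-pi..pi}"
    by (intro fundamental_theorem_of_calculus) auto
  moreover have "?u pi = ?u (- pi)" using average_periodic[of h "2 * pi" a "- pi", OF per] by simp
  moreover have "?E pi = ?E (- pi)" using cis_period[of m "- pi"] by simp
  ultimately have "integral {-pi..pi} (\<lambda>t. (\<i> * of_int m) * (complex_of_real (?u t) * ?E t) + complex_of_real (u' t) * ?E t) = 0"
    by (simp add: integral_unique mult_ac)
  moreover have "integral {-pi..pi} (\<lambda>t. (\<i> * of_int m) * (complex_of_real (?u t) * ?E t) + complex_of_real (u' t) * ?E t)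
      = (\<i> * of_int m) * period_coeff ?u m + period_coeff u' m"
    unfolding period_coeff_def
      Henstock_Kurzweil_Integration.integral_add[OF integrable_on_mult_right[OF int[OF u]] int[OF u'c]]
    by simp
  ultimately have 1: "(\<i> * of_int m) * period_coeff ?u m + period_coeff u' m = 0" by simp
  have "period_coeff u' m = integral {-pi..pi} (\<lambda>t. (complex_of_real (h (t + a)) * ?E t - complex_of_real (h (t + (- a))) * ?E t) / (2 * of_real a))"
    unfolding period_coeff_def
    by (rule Henstock_Kurzweil_Integration.integral_cong) (simp add: u'_def left_diff_distrib diff_divide_distrib)
  also have "\<dots> = (integral {-pi..pi} (\<lambda>t. complex_of_real (h (t + a)) * ?E t)
      - integral {-pi..pi} (\<lambda>t. complex_of_real (h (t + (- a))) * ?E t)) / (2 * of_real a)"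
    unfolding Henstock_Kurzweil_Integration.integral_diff[OF int[OF shift] int[OF shift], symmetric]
    by simp
  also have "\<dots> = (cis (- (of_int m * a)) - cis (of_int m * a)) * period_coeff h m / (2 * of_real a)"
    unfolding period_coeff_translate[OF h per] by (simp add: left_diff_distrib)
  also have "cis (- (of_int m * a)) - cis (of_int m * a) = - (2 * \<i> * of_real (sin (of_int m * a)))"
    by (simp add: complex_eq_iff)
  finally have 2: "period_coeff u' m = - (2 * \<i> * of_real (sin (of_int m * a))) * period_coeff h m / (2 * of_real a)" .
  have "\<i> * (of_int m * period_coeff ?u m) = \<i> * (of_real (sin (of_int m * a)) * period_coeff h m / of_real a)"
    using 1 unfolding 2 using a by (simp add: field_simps)
  then have "of_int m * period_coeff ?u m = of_real (sin (of_int m * a)) * period_coeff h m / of_real a"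
    by (rule mult_left_cancel[THEN iffD1, OF complex_i_not_zero])
  then show ?thesis using m a by (simp add: field_simps)
qed

lemma norm_period_coeff_average:
  assumes "continuous_on UNIV h" "\<And>t. h (t + 2 * pi) = h t" "a > 0" "m \<noteq> 0"
  shows "cmod (period_coeff (average a h) m) \<le> min 1 (1 / (a * \<bar>of_int m\<bar>)) * cmod (period_coeff h m)"
proof -
  have pos: "\<bar>of_int m\<bar> * a > 0" using assms by simp
  have "\<bar>sin (of_int m * a)\<bar> \<le> \<bar>of_int m\<bar> * a" using abs_sin_x_le_abs_x[of "of_int m * a"] assms(3) by (simp add: abs_mult)
  then have "\<bar>sin (of_int m * a) / (of_int m * a)\<bar> \<le> 1" "\<bar>sin (of_int m * a) / (of_int m * a)\<bar> \<le> 1 / (a * \<bar>of_int m\<bar>)"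
    using pos assms(3) by (auto simp: abs_mult abs_divide field_simps)
  then have "\<bar>sin (of_int m * a) / (of_int m * a)\<bar> \<le> min 1 (1 / (a * \<bar>of_int m\<bar>))" by simp
  then show ?thesis
    unfolding period_coeff_average[OF assms] norm_mult norm_of_real by (rule mult_right_mono) simp
qed

text \<open>The first \<open>M\<close> averages are split off one at a time; the bump that remains
  is bounded by \<open>1 + suminf a\<close>. \<open>M\<close> is free, so it can later be adapted to
  the frequency.\<close>

lemma (in widths) norm_period_coeff_smooth_bump:
  assumes m: "m \<noteq> 0"
  shows "cmod (period_coeff (smooth_bump a) m)
    \<le> (\<Prod>i<M. min 1 (1 / (a i * \<bar>of_int m\<bar>))) * (2 * pi * (1 + suminf a))"
proof -
  have step: "cmod (period_coeff (smooth_bump a) m)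
      \<le> (\<Prod>i<M. min 1 (1 / (a i * \<bar>of_int m\<bar>))) * cmod (period_coeff (smooth_bump (\<lambda>i. a (i + M))) m)"
  proof (induction M)
    case (Suc M)
    interpret b: widths "\<lambda>i. a (i + M)" by (rule widths_tail)
    interpret c: widths "\<lambda>i. a (i + Suc M)" by (rule widths_tail)
    have "cmod (period_coeff (smooth_bump (\<lambda>i. a (i + M))) m)
        \<le> min 1 (1 / (a M * \<bar>of_int m\<bar>)) * cmod (period_coeff (smooth_bump (\<lambda>i. a (i + Suc M))) m)"
      using norm_period_coeff_average[OF c.continuous_smooth_bump c.smooth_bump_periodic pos[of M] m]
      unfolding b.smooth_bump_average by simp
    then have "(\<Prod>i<M. min 1 (1 / (a i * \<bar>of_int m\<bar>))) * cmod (period_coeff (smooth_bump (\<lambda>i. a (i + M))) m)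
        \<le> (\<Prod>i<M. min 1 (1 / (a i * \<bar>of_int m\<bar>))) * (min 1 (1 / (a M * \<bar>of_int m\<bar>)) * cmod (period_coeff (smooth_bump (\<lambda>i. a (i + Suc M))) m))"
      using pos by (intro mult_left_mono prod_nonneg) (auto intro!: mult_nonneg_nonneg intro: less_imp_le)
    then show ?case using Suc by (simp add: mult.assoc)
  qed simp
  interpret b: widths "\<lambda>i. a (i + M)" by (rule widths_tail)
  have tail: "(\<Sum>i. a (i + M)) \<le> suminf a"
    using suminf_split_initial_segment[OF summable_widths, of M] sum_nonneg[of "{..<M}" a] pos
    by (auto intro: less_imp_le)
  have "cmod (integral {-pi..pi} (\<lambda>t. complex_of_real (smooth_bump (\<lambda>i. a (i + M)) t) * cis (of_int m * t)))
      \<le> (1 + suminf a) * (pi - - pi)"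
  proof (rule integral_bound)
    show "continuous_on {-pi..pi} (\<lambda>t. complex_of_real (smooth_bump (\<lambda>i. a (i + M)) t) * cis (of_int m * t))"
      by (intro continuous_intros continuous_on_compose2[OF b.continuous_smooth_bump]) auto
    fix t
    have "\<bar>cos_bump t\<bar> \<le> 1" by (simp add: cos_bump_def)
    then show "cmod (complex_of_real (smooth_bump (\<lambda>i. a (i + M)) t) * cis (of_int m * t)) \<le> 1 + suminf a"
      using b.smooth_bump_near_cos_bump[of t] tail by (simp add: norm_mult)
  qed simp
  then have "cmod (period_coeff (smooth_bump (\<lambda>i. a (i + M))) m) \<le> 2 * pi * (1 + suminf a)"
    by (simp add: period_coeff_def mult.commute)
  then have "(\<Prod>i<M. min 1 (1 / (a i * \<bar>of_int m\<bar>))) * cmod (period_coeff (smooth_bump (\<lambda>i. a (i + M))) m)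
      \<le> (\<Prod>i<M. min 1 (1 / (a i * \<bar>of_int m\<bar>))) * (2 * pi * (1 + suminf a))"
    using pos by (intro mult_left_mono prod_nonneg) (auto intro!: mult_nonneg_nonneg intro: less_imp_le)
  with step show ?thesis by linarith
qed

section \<open>Widths adapted to the weight\<close>

lemma repeat_terms:
  fixes b :: "nat \<Rightarrow> real" and N :: "nat \<Rightarrow> nat"
  assumes b: "\<And>j. b j > 0" and N: "\<And>j. N j \<ge> 1" and sm: "summable (\<lambda>j. real (N j) * b j)"
  obtains a where "\<And>i. a i > 0" "summable a" "suminf a \<le> (\<Sum>j. real (N j) * b j)"
    "\<And>g j. (\<And>x. x > 0 \<Longrightarrow> 0 \<le> g x \<and> g x \<le> 1) \<Longrightarrow> \<exists>M. (\<Prod>i<M. g (a i) :: real) \<le> g (b j) ^ N j"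
proof -
  \<comment> \<open>The sequence \<open>a\<close> lists \<open>b j\<close> exactly
    \<open>N j\<close> times: \<open>S j\<close> is where block j begins and \<open>J m\<close> is
    the block of position m. In the product up to the end of block j, the earlier factors are at
    most 1 and block j gives \<open>g (b j) ^ N j\<close>.\<close>
  define S where "S j = (\<Sum>i<j. N i)" for j
  have S_Suc: "S (Suc j) = S j + N j" for j by (simp add: S_def)
  have S_ge: "j \<le> S j" for j
  proof (induction j)
    case (Suc j)
    then show ?case using N[of j] by (simp add: S_Suc)
  qed simp
  have S_mono: "i \<le> j \<Longrightarrow> S i \<le> S j" for i j
    unfolding S_def by (intro sum_mono2) auto
  define J where "J m = (LEAST j. m < S (Suc j))" for m
  define a where "a m = b (J m)" for m
  have J: "J m = j" if "m \<in> {S j..<S (Suc j)}" for m j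
    unfolding J_def
  proof (rule Least_equality)
    show "m < S (Suc j)" using that by simp
    show "j \<le> i" if "m < S (Suc i)" for i
    proof (rule ccontr)
      assume "\<not> j \<le> i"
      then have "S (Suc i) \<le> S j" by (intro S_mono) simp
      then show False using that \<open>m \<in> _\<close> by simp
    qed
  qed
  have apos: "a i > 0" for i by (simp add: a_def b)
  have split: "{..<S (Suc j)} = {..<S j} \<union> {S j..<S (Suc j)}" for j
    using S_mono[of j "Suc j"] by auto
  have block: "(\<Sum>m\<in>{..<S j}. a m) = (\<Sum>i<j. real (N i) * b i)" for j
  proof (induction j)
    case (Suc j)
    have "(\<Sum>m\<in>{S j..<S (Suc j)}. a m) = (\<Sum>m\<in>{S j..<S (Suc j)}. b j)"
      by (intro sum.cong) (auto simp: a_def J)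
    also have "\<dots> = real (N j) * b j" by (simp add: S_Suc)
    finally show ?case using Suc unfolding split by (subst sum.union_disjoint) auto
  qed (simp add: S_def)
  have bound: "(\<Sum>m<n. a m) \<le> (\<Sum>j. real (N j) * b j)" for n
  proof -
    have "(\<Sum>m<n. a m) \<le> (\<Sum>m<S n. a m)"
      using S_ge[of n] apos by (intro sum_mono2) (auto intro: less_imp_le)
    also have "\<dots> \<le> (\<Sum>j. real (N j) * b j)"
      unfolding block using b by (intro sum_le_suminf sm) (auto intro!: mult_nonneg_nonneg intro: less_imp_le)
    finally show ?thesis .
  qed
  have sa: "summable a" by (rule summableI_nonneg_bounded[OF _ bound]) (use apos in \<open>auto intro: less_imp_le\<close>)
  have "\<exists>M. (\<Prod>i<M. g (a i)) \<le> g (b j) ^ N j" if g: "\<And>x. x > 0 \<Longrightarrow> 0 \<le> g x \<and> g x \<le> 1" for g :: "real \<Rightarrow> real" and j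
  proof -
    have "(\<Prod>m\<in>{S j..<S (Suc j)}. g (a m)) = (\<Prod>m\<in>{S j..<S (Suc j)}. g (b j))"
      by (intro prod.cong) (auto simp: a_def J)
    also have "\<dots> = g (b j) ^ N j" by (simp add: S_Suc)
    finally have 1: "(\<Prod>m\<in>{S j..<S (Suc j)}. g (a m)) = g (b j) ^ N j" .
    have "(\<Prod>m<S (Suc j). g (a m)) = (\<Prod>m<S j. g (a m)) * (\<Prod>m\<in>{S j..<S (Suc j)}. g (a m))"
      unfolding split by (subst prod.union_disjoint) auto
    also have "\<dots> \<le> 1 * g (b j) ^ N j"
      unfolding 1 using g apos b by (intro mult_right_mono prod_le_1) auto
    finally show ?thesis by auto
  qed
  with that[OF apos sa suminf_le_const[OF sa bound]] show ?thesis by blast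
qed

text \<open>In the j-th dyadic block there are \<open>2 ^ j\<close> terms, each at least
  \<open>\<psi> (2 ^ j) / 4 ^ Suc j\<close>, because \<open>1 + k\<^sup>2\<close> is at most
  \<open>(k + 1)\<^sup>2\<close>; this costs a factor 4.\<close>

lemma dyadic_condensation:
  fixes \<psi> :: "real \<Rightarrow> real"
  assumes nonneg: "\<And>x. x \<ge> 0 \<Longrightarrow> \<psi> x \<ge> 0" and incr: "mono_on {0..} \<psi>"
    and sm: "summable (\<lambda>k::nat. \<psi> (real k) / (1 + (real k)\<^sup>2))"
  shows "summable (\<lambda>j. \<psi> (2 ^ j) / 2 ^ j)"
proof (rule summableI_nonneg_bounded)
  define q where "q k = \<psi> (real k) / (1 + (real k)\<^sup>2)" for k :: nat
  have q: "q k \<ge> 0" for k unfolding q_def by (intro divide_nonneg_nonneg nonneg) auto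
  have block: "\<psi> (2 ^ j) / 2 ^ j \<le> 4 * (\<Sum>k\<in>{2^j..<2^Suc j}. q k)" for j
  proof -
    have "(\<Sum>k\<in>{(2::nat)^j..<2^Suc j}. \<psi> (2 ^ j) / 4 ^ Suc j) \<le> (\<Sum>k\<in>{2^j..<2^Suc j}. q k)"
    proof (rule sum_mono)
      fix k :: nat assume k: "k \<in> {2^j..<2^Suc j}"
      then have "real k + 1 \<le> 2 ^ Suc j" by (metis Suc_leI add.commute atLeastLessThan_iff of_nat_Suc of_nat_le_iff of_nat_numeral of_nat_power)
      then have "(real k + 1)\<^sup>2 \<le> (2 ^ Suc j)\<^sup>2" by (intro power_mono) auto
      also have "(2 ^ Suc j :: real)\<^sup>2 = 4 ^ Suc j" by (simp add: power2_eq_square power_mult_distrib[symmetric])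
      finally have "1 + (real k)\<^sup>2 \<le> 4 ^ Suc j" by (simp add: power2_eq_square algebra_simps)
      moreover have "\<psi> (2 ^ j) \<le> \<psi> (real k)"
        using k by (intro mono_onD[OF incr]) (auto simp flip: of_nat_power)
      ultimately show "\<psi> (2 ^ j) / 4 ^ Suc j \<le> q k"
        unfolding q_def using nonneg[of "2 ^ j"] by (intro frac_le) (auto intro: add_pos_nonneg)
    qed
    moreover have "(\<Sum>k\<in>{(2::nat)^j..<2^Suc j}. \<psi> (2 ^ j) / 4 ^ Suc j) = \<psi> (2 ^ j) / 2 ^ j / 4"
    proof -
      have "(4::real) ^ j = 2 ^ j * 2 ^ j" by (simp flip: power_mult_distrib)
      then show ?thesis by simp
    qed
    ultimately show ?thesis by simp
  qed
  show "(\<Sum>j<n. \<psi> (2 ^ j) / 2 ^ j) \<le> 4 * suminf q" for n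
  proof -
    have "(\<Sum>j<n. \<Sum>k\<in>{(2::nat)^j..<2^Suc j}. q k) \<le> (\<Sum>k<2^n. q k)"
    proof (induction n)
      case (Suc n)
      have "{..<(2::nat)^Suc n} = {..<2^n} \<union> {2^n..<2^Suc n}" by auto
      then have "(\<Sum>k<2^Suc n. q k) = sum q ({..<2^n} \<union> {2^n..<2^Suc n})" by (rule arg_cong)
      also have "\<dots> = (\<Sum>k<2^n. q k) + (\<Sum>k\<in>{2^n..<2^Suc n}. q k)"
        by (rule sum.union_disjoint) auto
      finally have "(\<Sum>k<2^Suc n. q k) = (\<Sum>k<2^n. q k) + (\<Sum>k\<in>{2^n..<2^Suc n}. q k)" .
      then show ?case using Suc by simp
    qed (use q in simp)
    also have "\<dots> \<le> suminf q" using sm q by (intro sum_le_suminf) (auto simp: q_def)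
    finally have "4 * (\<Sum>j<n. \<Sum>k\<in>{(2::nat)^j..<2^Suc j}. q k) \<le> 4 * suminf q" by simp
    moreover have "(\<Sum>j<n. \<psi> (2 ^ j) / 2 ^ j) \<le> 4 * (\<Sum>j<n. \<Sum>k\<in>{(2::nat)^j..<2^Suc j}. q k)"
      unfolding sum_distrib_left[of 4 _ "{..<n}"] by (intro sum_mono block)
    ultimately show ?thesis by linarith
  qed
qed (auto intro!: divide_nonneg_nonneg nonneg)

lemma widths_for_weight:
  fixes \<psi> :: "real \<Rightarrow> real"
  assumes nonneg: "\<And>x. x \<ge> 0 \<Longrightarrow> \<psi> x \<ge> 0" and incr: "mono_on {0..} \<psi>"
    and sm: "summable (\<lambda>k::nat. \<psi> (real k) / (1 + (real k)\<^sup>2))"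
  obtains a C where "widths a" "suminf a \<le> 1/2" "C \<ge> 0"
    "\<And>k::nat. k \<ge> 1 \<Longrightarrow> \<exists>M. (\<Prod>i<M. min 1 (1 / (a i * real k))) \<le> C * exp (- \<psi> (real k)) / (real k)\<^sup>2"
proof -
  define \<phi> where "\<phi> j = \<psi> (2 ^ Suc j) + 2 * ln (2 ^ Suc j)" for j
  define N where "N j = nat \<lceil>\<phi> j\<rceil> + 1" for j
  have \<phi>: "\<phi> j \<ge> 0" for j using nonneg[of "2 ^ Suc j"] by (simp add: \<phi>_def ln_ge_zero del: power_Suc)
  have N: "\<phi> j \<le> real (N j)" "real (N j) \<le> \<phi> j + 2" for j
  proof -
    have "0 \<le> \<lceil>\<phi> j\<rceil>" using \<phi>[of j] by linarith
    then have "real (N j) = of_int \<lceil>\<phi> j\<rceil> + 1" by (simp add: N_def of_nat_nat)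
    then show "\<phi> j \<le> real (N j)" "real (N j) \<le> \<phi> j + 2"
      using le_of_int_ceiling[of "\<phi> j"] of_int_ceiling_le_add_one[of "\<phi> j"] by linarith+
  qed
  \<comment> \<open>For \<open>k\<close> at least \<open>2 ^ j\<close> the factor
    \<open>1 / (b j * k)\<close> is at most \<open>exp (-1)\<close>, so \<open>N j\<close> copies
    produce \<open>exp (- \<phi> j)\<close>.\<close>
  define b :: "nat \<Rightarrow> real" where "b j = exp 1 / 2 ^ j" for j
  have smNb: "summable (\<lambda>j. real (N j) * b j)"
  proof (rule summable_comparison_test')
    have "summable (\<lambda>j. \<psi> (2 ^ Suc j) / 2 ^ Suc j)"
      by (rule summable_Suc_iff[THEN iffD2]) (rule dyadic_condensation[OF nonneg incr sm])
    moreover have "summable (\<lambda>j. real (Suc j) * (1/2) ^ j)"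
      using sums_summable[OF geometric_deriv_sums[of "1/2::real"]] by simp
    ultimately show "summable (\<lambda>j. exp 1 * (2 * (\<psi> (2 ^ Suc j) / 2 ^ Suc j) + 4 * (real (Suc j) * (1/2) ^ j)))"
      by (intro summable_mult summable_add)
    fix j :: nat
    have "ln (2::real) \<le> 1" using ln_le_minus_one[of 2] by simp
    then have "real (Suc j) * ln 2 \<le> real (Suc j)" by (intro mult_left_le) auto
    then have "ln (2 ^ Suc j :: real) \<le> real (Suc j)" by (simp only: ln_realpow zero_less_numeral)
    then have "real (N j) \<le> \<psi> (2 ^ Suc j) + 4 * real (Suc j)"
      using N(2)[of j] unfolding \<phi>_def by (simp del: power_Suc)
    then have "real (N j) * b j \<le> (\<psi> (2 ^ Suc j) + 4 * real (Suc j)) * b j"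
      by (intro mult_right_mono) (auto simp: b_def)
    also have "\<dots> = exp 1 * (2 * (\<psi> (2 ^ Suc j) / 2 ^ Suc j) + 4 * (real (Suc j) * (1/2) ^ j))"
      by (simp add: b_def field_simps power_one_over)
    finally show "norm (real (N j) * b j) \<le> exp 1 * (2 * (\<psi> (2 ^ Suc j) / 2 ^ Suc j) + 4 * (real (Suc j) * (1/2) ^ j))"
      by (simp add: b_def)
  qed
  \<comment> \<open>Dropping the first \<open>J\<close> blocks makes the total width at most 1/2,
    which keeps the bump nonzero at 0 and leaves it a zero interval.\<close>
  obtain J where J: "norm (\<Sum>j. real (N (j + J)) * b (j + J)) < 1/2"
    using suminf_exist_split[of "1/2", OF _ smNb] by auto
  obtain a where a: "\<And>i. a i > 0" "summable a" "suminf a \<le> (\<Sum>j. real (N (j + J)) * b (j + J))"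
    "\<And>g j. (\<And>x. x > 0 \<Longrightarrow> 0 \<le> g x \<and> g x \<le> 1) \<Longrightarrow> \<exists>M. (\<Prod>i<M. g (a i) :: real) \<le> g (b (j + J)) ^ N (j + J)"
  proof (rule repeat_terms[of "\<lambda>j. b (j + J)" "\<lambda>j. N (j + J)"])
    show "summable (\<lambda>j. real (N (j + J)) * b (j + J))"
      using smNb summable_iff_shift[of "\<lambda>j. real (N j) * b j" J] by simp
  qed (auto simp: b_def N_def)
  \<comment> \<open>Pays for the dropped blocks: below \<open>2 ^ J\<close> the empty product 1 must
    be covered, and \<open>(real k)\<^sup>2 * exp (\<psi> (real k))\<close> is at most
    \<open>C\<close> there.\<close>
  define C where "C = 4 ^ J * exp (\<psi> (2 ^ J))"
  have C1: "C \<ge> 1" unfolding C_def using mult_mono[of 1 "4 ^ J :: real" 1 "exp (\<psi> (2 ^ J))"] nonneg[of "2 ^ J"] by simp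
  have "\<exists>M. (\<Prod>i<M. min 1 (1 / (a i * real k))) \<le> C * exp (- \<psi> (real k)) / (real k)\<^sup>2" if k: "k \<ge> 1" for k :: nat
  proof (cases "k < 2 ^ J")
    case True
    then have le: "real k \<le> 2 ^ J" by (metis less_imp_le of_nat_le_iff of_nat_numeral of_nat_power)
    then have "\<psi> (real k) \<le> \<psi> (2 ^ J)" by (intro mono_onD[OF incr]) auto
    moreover have "(real k)\<^sup>2 \<le> (2 ^ J)\<^sup>2" using le by (intro power_mono) auto
    moreover have "(2 ^ J :: real)\<^sup>2 = 4 ^ J" by (simp add: power2_eq_square power_mult_distrib[symmetric])
    ultimately have "(real k)\<^sup>2 * exp (\<psi> (real k)) \<le> C" unfolding C_def by (intro mult_mono) auto
    then have "1 \<le> C * exp (- \<psi> (real k)) / (real k)\<^sup>2"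
      using k by (simp add: exp_minus field_simps)
    then show ?thesis by (intro exI[of _ 0]) simp
  next
    case False
    obtain i where "2 ^ i \<le> k" "k < 2 ^ (i + 1)" using ex_power_ivl1[of 2 k] k by auto
    then have "real (2 ^ i) \<le> real k" "real k < real (2 ^ (i + 1))" by (simp_all only: of_nat_le_iff of_nat_less_iff)
    then have i: "2 ^ i \<le> real k" "real k < 2 ^ Suc i" by simp_all
    have "(2::real) ^ J < 2 ^ Suc i"
      using False i(2) by (metis le_less_trans not_less of_nat_le_iff of_nat_numeral of_nat_power)
    then have "J < Suc i" by (rule power_less_imp_less_exp[rotated]) simp
    then have Ji: "J \<le> i" by simp
    define g where "g x = min 1 (1 / (x * real k))" for x
    obtain M where M: "(\<Prod>m<M. g (a m)) \<le> g (b i) ^ N i"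
      using a(4)[of g "i - J"] Ji by (auto simp: g_def)
    have "g (b i) \<le> exp (- 1)"
    proof -
      have "g (b i) \<le> 2 ^ i / real k * exp (- 1)"
        by (simp add: g_def b_def exp_minus field_simps)
      also have "\<dots> \<le> 1 * exp (- 1)" using i k by (intro mult_right_mono) auto
      finally show ?thesis by simp
    qed
    then have "g (b i) ^ N i \<le> exp (- 1) ^ N i" by (intro power_mono) (auto simp: g_def b_def)
    also have "\<dots> = exp (- real (N i))" by (simp flip: exp_of_nat_mult)
    also have "\<dots> \<le> exp (- \<phi> i)" using N by simp
    also have "\<dots> = exp (- \<psi> (2 ^ Suc i)) / (2 ^ Suc i)\<^sup>2"
    proof -
      have "exp (2 * ln (2 ^ Suc i)) = (2 ^ Suc i :: real)\<^sup>2"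
        by (simp add: exp_double del: power_Suc)
      then show ?thesis unfolding \<phi>_def minus_add_distrib exp_add exp_minus[of "2 * _"] by (simp only: divide_inverse)
    qed
    also have "\<dots> \<le> exp (- \<psi> (real k)) / (real k)\<^sup>2"
    proof (rule frac_le)
      show "exp (- \<psi> (2 ^ Suc i)) \<le> exp (- \<psi> (real k))"
        using i by (auto intro!: mono_onD[OF incr])
      show "(real k)\<^sup>2 \<le> (2 ^ Suc i)\<^sup>2" using i by (intro power_mono) auto
    qed (use k in auto)
    also have "\<dots> \<le> C * exp (- \<psi> (real k)) / (real k)\<^sup>2"
      using C1 by (intro divide_right_mono) (auto simp: mult_le_cancel_right1)
    finally show ?thesis using M unfolding g_def by (meson order_trans)
  qed
  moreover have "widths a" using a by unfold_locales auto
  moreover have "suminf a \<le> 1/2" using a(3) J by simp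
  ultimately show ?thesis using that C1 by (meson order_trans zero_le_one)
qed

subsection \<open>A smooth function vanishing on a product set\<close>

lemma fourier_coeff_one_variable:
  fixes j0 :: "'n::finite" and h :: "real \<Rightarrow> real"
  assumes h: "continuous_on UNIV h"
  shows "fourier_coeff (\<lambda>x::real^'n. complex_of_real (h (x $ j0))) k
    = (if \<forall>j. j \<noteq> j0 \<longrightarrow> k $ j = 0 then period_coeff h (- (k $ j0)) / (2 * of_real pi) else 0)"
proof -
  define F where "F j t = (if j = j0 then complex_of_real (h t) else 1) * cis (of_int (- (k $ j)) * t)" for j t
  have "complex_of_real (h (x $ j0)) * torus_char (- k) x = (\<Prod>j\<in>UNIV. F j (x $ j))" for x :: "real^'n"
    unfolding torus_char_prod F_def prod.distrib by simp
  then have "(LINT x|torus. complex_of_real (h ((x::real^'n) $ j0)) * torus_char (- k) x)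
      = (LINT x|torus. (\<Prod>j\<in>UNIV. F j ((x::real^'n) $ j)))"
    by (simp only:)
  also have "\<dots> = (\<Prod>j\<in>UNIV. integral {-pi..pi} (F j))"
  proof (rule torus_integral_prod)
    show "continuous_on UNIV (F j)" for j
      unfolding F_def by (cases "j = j0") (auto intro!: continuous_intros continuous_on_compose2[OF h])
  qed
  also have "\<dots> = integral {-pi..pi} (F j0) * (\<Prod>j\<in>UNIV-{j0}. integral {-pi..pi} (F j))"
    by (rule prod.remove) auto
  also have "integral {-pi..pi} (F j0) = period_coeff h (- (k $ j0))"
  proof -
    have "F j0 = (\<lambda>t. complex_of_real (h t) * cis (of_int (- (k $ j0)) * t))" by (auto simp: F_def)
    then show ?thesis by (simp only: period_coeff_def)
  qed
  also have "(\<Prod>j\<in>UNIV-{j0}. integral {-pi..pi} (F j)) = (\<Prod>j\<in>UNIV-{j0}. if k $ j = 0 then 2 * of_real pi else 0)"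
  proof (rule prod.cong[OF refl])
    fix j assume "j \<in> UNIV - {j0}"
    then have "F j = (\<lambda>t. cis (of_int (- (k $ j)) * t))" by (auto simp: F_def)
    then show "integral {-pi..pi} (F j) = (if k $ j = 0 then 2 * of_real pi else 0)"
      using integral_cis_period[of "- (k $ j)"] by simp
  qed
  also have "\<dots> = (if \<forall>j. j \<noteq> j0 \<longrightarrow> k $ j = 0 then (2 * of_real pi) ^ (CARD('n) - 1) else 0)"
  proof (cases "\<forall>j. j \<noteq> j0 \<longrightarrow> k $ j = 0")
    case True
    then have "(\<Prod>j\<in>UNIV-{j0}. if k $ j = 0 then 2 * complex_of_real pi else 0) = (\<Prod>j\<in>UNIV-{j0}. 2 * of_real pi)"
      by (intro prod.cong) auto
    then show ?thesis using True by (simp add: card_Diff_singleton)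
  next
    case False
    then have "(\<Prod>j\<in>UNIV-{j0}. if k $ j = 0 then 2 * complex_of_real pi else 0) = 0"
      by (intro prod_zero) auto
    then show ?thesis using False by simp
  qed
  finally have "(LINT x|torus. complex_of_real (h ((x::real^'n) $ j0)) * torus_char (- k) x)
      = period_coeff h (- (k $ j0)) * (if \<forall>j. j \<noteq> j0 \<longrightarrow> k $ j = 0 then (2 * of_real pi) ^ (CARD('n) - 1) else 0)" .
  moreover have "(2 * complex_of_real pi) ^ CARD('n) = 2 * of_real pi * (2 * of_real pi) ^ (CARD('n) - 1)"
    by (metis One_nat_def Suc_pred power_Suc zero_less_card_finite)
  ultimately show ?thesis unfolding fourier_coeff_eq by simp blast
qed

lemma summable_on_int_inverse_squares: "(\<lambda>m::int. 1 / (1 + (real_of_int m)\<^sup>2)) summable_on UNIV"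
proof -
  let ?q = "\<lambda>m::int. 1 / (1 + (real_of_int m)\<^sup>2)"
  have "summable (\<lambda>n::nat. 1 / (1 + (real n)\<^sup>2))"
  proof (rule summable_comparison_test')
    show "summable (\<lambda>n::nat. inverse ((real n)\<^sup>2))"
      using inverse_power_summable[of 2, where 'a = real] by simp
    show "norm (1 / (1 + (real n)\<^sup>2)) \<le> inverse ((real n)\<^sup>2)" if "n \<ge> 1" for n :: nat
      using that by (simp add: inverse_eq_divide frac_le)
  qed
  then have nat: "(\<lambda>n::nat. 1 / (1 + (real n)\<^sup>2)) summable_on UNIV"
    by (intro summable_nonneg_imp_summable_on) auto
  have "?q summable_on range int"
    by (rule summable_on_reindex[THEN iffD2]) (use nat in \<open>auto simp: o_def\<close>)
  moreover have "?q summable_on range (\<lambda>n. - int n)"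
    by (rule summable_on_reindex[THEN iffD2]) (use nat in \<open>auto simp: o_def inj_on_def\<close>)
  ultimately have "?q summable_on (range int \<union> range (\<lambda>n. - int n))"
    by (rule summable_on_union)
  moreover have "range int \<union> range (\<lambda>n. - int n) = UNIV"
    by (auto simp: image_iff) (metis int_cases2)
  ultimately show ?thesis by simp
qed

text \<open>The function depends on one coordinate only, so its coefficients live on one axis, where
  the Euclidean norm of \<open>k\<close> is the absolute value of its single entry.\<close>

lemma smooth_function_vanishing_on_product:
  fixes \<psi> :: "real \<Rightarrow> real"
  assumes nonneg: "\<And>x. x \<ge> 0 \<Longrightarrow> \<psi> x \<ge> 0" and incr: "mono_on {0..} \<psi>"
    and sm: "summable (\<lambda>k::nat. \<psi> (real k) / (1 + (real k)\<^sup>2))"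
  shows "\<exists>(f :: real ^ 'n \<Rightarrow> complex) (\<Lambda> :: 'n \<Rightarrow> real set).
          smooth_on_torus f \<and> (\<exists>x. f x \<noteq> 0) \<and> (\<forall>j. positive_measure_subset (\<Lambda> j)) \<and>
          (\<forall>x \<in> product_set \<Lambda>. f x = 0) \<and>
          (\<lambda>k. cmod (fourier_coeff f k) * exp (\<psi> (norm (of_int_vec k)))) summable_on UNIV"
proof -
  obtain a C where a: "widths a" "suminf a \<le> 1/2" and C: "C \<ge> 0"
    and decay: "\<And>k::nat. k \<ge> 1 \<Longrightarrow> \<exists>M. (\<Prod>i<M. min 1 (1 / (a i * real k))) \<le> C * exp (- \<psi> (real k)) / (real k)\<^sup>2"
    using widths_for_weight[OF nonneg incr sm] by blast
  interpret widths a by fact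
  have suma: "suminf a \<ge> 0" using pos by (intro suminf_nonneg summable_widths) (auto intro: less_imp_le)
  fix j0 :: 'n
  define G where "G = smooth_bump a"
  define f where "f x = complex_of_real (G (x $ j0))" for x :: "real^'n"
  \<comment> \<open>As the total width is at most 1/2, the bump vanishes from
    \<open>pi/2 + 1/2\<close> to \<open>3*pi/2 - 1/2\<close>, which is beyond \<open>pi\<close>; the
    part inside the cube has positive length since \<open>pi > 1\<close>.\<close>
  define \<Lambda> where "\<Lambda> j = (if j = j0 then {pi/2 + 1/2..<pi} else {-pi..<pi})" for j :: 'n
  have "smooth_on_torus f"
    unfolding smooth_on_torus_def
  proof (intro conjI allI)
    have "bump_combination G"
      using bump_combination.shift[OF a(1), of 1 0] by (simp add: G_def)
    then show "C_k m f" for m unfolding f_def by (rule C_k_bump_combination)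
    show "f (x + axis j (2 * pi)) = f x" for x j
      by (cases "j = j0") (auto simp: f_def G_def axis_def smooth_bump_periodic)
  qed
  moreover have "f 0 \<noteq> 0"
  proof -
    have "\<bar>G 0 - 1\<bar> \<le> 1/2" using smooth_bump_near_cos_bump[of 0] a(2) by (simp add: G_def cos_bump_def)
    then show ?thesis by (auto simp: f_def)
  qed
  moreover have "positive_measure_subset (\<Lambda> j)" for j
  proof -
    have "pi > 1" using pi_gt3 by simp
    then have "\<Lambda> j \<subseteq> {-pi..<pi}" "emeasure lebesgue (\<Lambda> j) > 0" "\<Lambda> j \<in> sets lebesgue"
      by (auto simp: \<Lambda>_def)
    then show ?thesis
      by (simp add: positive_measure_subset_def sets_restrict_space_iff emeasure_restrict_space)
  qed
  moreover have "f x = 0" if "x \<in> product_set \<Lambda>" for x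
  proof -
    have "x $ j0 \<in> \<Lambda> j0" using that unfolding product_set_def by blast
    then have "x $ j0 \<in> {pi/2 + 1/2..<pi}" by (simp add: \<Lambda>_def)
    then have "x $ j0 \<in> {pi/2 + suminf a..3*pi/2 - suminf a}" using a(2) pi_gt3 by auto
    from smooth_bump_zero[OF this] show ?thesis by (simp add: f_def G_def)
  qed
  moreover have "(\<lambda>k. cmod (fourier_coeff f k) * exp (\<psi> (norm (of_int_vec k)))) summable_on UNIV"
  proof -
    define w where "w k = cmod (fourier_coeff f k) * exp (\<psi> (norm (of_int_vec k)))" for k :: "int^'n"
    \<comment> \<open>Here \<open>3 * pi\<close> bounds \<open>2 * pi * (1 + suminf a)\<close>, the
      factor 2 passes from \<open>1 / k\<^sup>2\<close> to \<open>1 / (1 + k\<^sup>2)\<close>, and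
      the last summand covers frequency 0.\<close>
    define D where "D = 3 * pi * C * 2 + cmod (period_coeff G 0) * exp (\<psi> 0)"
    have D: "D \<ge> 0" using C by (simp add: D_def)
    have coeff: "fourier_coeff f k = (if \<forall>j. j \<noteq> j0 \<longrightarrow> k $ j = 0 then period_coeff G (- (k $ j0)) / (2 * of_real pi) else 0)" for k
      unfolding f_def by (rule fourier_coeff_one_variable) (simp add: G_def continuous_smooth_bump)
    have bound: "cmod (period_coeff G (- m)) * exp (\<psi> \<bar>real_of_int m\<bar>) \<le> D * (1 / (1 + (real_of_int m)\<^sup>2))" for m
    proof (cases "m = 0")
      case True
      then show ?thesis using C by (simp add: D_def)
    next
      case False
      define k where "k = nat \<bar>m\<bar>"
      have k: "k \<ge> 1" "real k = \<bar>real_of_int m\<bar>" using False by (auto simp: k_def)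
      obtain M where M: "(\<Prod>i<M. min 1 (1 / (a i * real k))) \<le> C * exp (- \<psi> (real k)) / (real k)\<^sup>2"
        using decay[OF k(1)] by blast
      have "cmod (period_coeff G (- m)) \<le> (\<Prod>i<M. min 1 (1 / (a i * real k))) * (2 * pi * (1 + suminf a))"
        using norm_period_coeff_smooth_bump[of "- m" M] False unfolding k(2) G_def by simp
      also have "\<dots> \<le> (C * exp (- \<psi> (real k)) / (real k)\<^sup>2) * (3 * pi)"
      proof (rule mult_mono[OF M])
        show "2 * pi * (1 + suminf a) \<le> 3 * pi"
          using mult_left_mono[of "2 * (1 + suminf a)" 3 pi] a(2) by (simp add: algebra_simps)
      qed (use suma C in auto)
      finally have "cmod (period_coeff G (- m)) * exp (\<psi> (real k)) \<le> (C * exp (- \<psi> (real k)) / (real k)\<^sup>2) * (3 * pi) * exp (\<psi> (real k))"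
        by (intro mult_right_mono) auto
      also have "\<dots> = 3 * pi * C * (1 / (real k)\<^sup>2)" by (simp add: exp_minus field_simps)
      also have "\<dots> \<le> 3 * pi * C * (2 * (1 / (1 + (real k)\<^sup>2)))"
      proof (rule mult_left_mono)
        have "(real k)\<^sup>2 \<ge> 1" using k(1) by simp
        then have "2 / ((real k)\<^sup>2 + (real k)\<^sup>2) \<le> 2 / (1 + (real k)\<^sup>2)"
          by (intro frac_le) (auto intro: add_pos_nonneg)
        then show "1 / (real k)\<^sup>2 \<le> 2 * (1 / (1 + (real k)\<^sup>2))" by simp
      qed (use C in simp)
      also have "\<dots> = (3 * pi * C * 2) * (1 / (1 + (real k)\<^sup>2))" by simp
      also have "\<dots> \<le> D * (1 / (1 + (real k)\<^sup>2))"
        by (intro mult_right_mono) (auto simp: D_def add_nonneg_pos intro: add_nonneg_nonneg)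
      finally show ?thesis by (simp add: k(2))
    qed
    have "w summable_on range (\<lambda>m. axis j0 m)"
    proof (rule summable_on_reindex[THEN iffD2])
      show "inj (\<lambda>m::int. axis j0 m :: int^'n)" by (auto simp: inj_on_def axis_eq_axis)
      have "(\<lambda>m::int. D * (1 / (1 + (real_of_int m)\<^sup>2))) summable_on UNIV"
        by (rule summable_on_cmult_right[OF summable_on_int_inverse_squares])
      then show "(w \<circ> (\<lambda>m. axis j0 m)) summable_on UNIV"
      proof (rule summable_on_comparison_test)
        fix m :: int
        have nrm: "norm (of_int_vec (axis j0 m :: int^'n)) = \<bar>real_of_int m\<bar>"
        proof -
          have "of_int_vec (axis j0 m :: int^'n) = axis j0 (real_of_int m)"
            by (simp add: of_int_vec_def axis_def vec_eq_iff)
          then show ?thesis by (simp add: norm_eq_sqrt_inner inner_axis_axis)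
        qed
        have "cmod (fourier_coeff f (axis j0 m)) \<le> cmod (period_coeff G (- m))"
        proof -
          have "fourier_coeff f (axis j0 m) = period_coeff G (- m) / (2 * of_real pi)"
            unfolding coeff by (simp add: axis_def)
          moreover have "1 \<le> 2 * pi" using pi_gt3 by simp
          ultimately show ?thesis by (simp add: norm_divide divide_le_eq mult_left_le[of 1, simplified] mult_le_cancel_left1)
        qed
        then have "w (axis j0 m) \<le> cmod (period_coeff G (- m)) * exp (\<psi> \<bar>real_of_int m\<bar>)"
          unfolding w_def nrm by (intro mult_right_mono) auto
        then show "(w \<circ> (\<lambda>m. axis j0 m)) m \<le> D * (1 / (1 + (real_of_int m)\<^sup>2))"
          using bound[of m] by simp
      qed (simp add: w_def)
    qed
    moreover have "w k = 0" if "k \<notin> range (\<lambda>m. axis j0 m)" for k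
    proof -
      have "\<not> (\<forall>j. j \<noteq> j0 \<longrightarrow> k $ j = 0)"
      proof
        assume "\<forall>j. j \<noteq> j0 \<longrightarrow> k $ j = 0"
        then have "k = axis j0 (k $ j0)" by (auto simp: vec_eq_iff axis_def)
        then show False using that by blast
      qed
      then have "fourier_coeff f k = 0" unfolding coeff by (rule if_not_P)
      then show ?thesis by (simp add: w_def)
    qed
    then have "w summable_on UNIV \<longleftrightarrow> w summable_on range (\<lambda>m. axis j0 m)"
      by (intro summable_on_cong_neutral) auto
    ultimately have "w summable_on UNIV" by simp
    then show ?thesis unfolding w_def .
  qed
  ultimately show ?thesis by blast
qed

theorem theorem3p3:
  fixes \<psi> :: "real \<Rightarrow> real"
  assumes nonneg: "\<And>x. x \<ge> 0 \<Longrightarrow> \<psi> x \<ge> 0"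
    and incr: "mono_on {0..} \<psi>"
    and lim: "filterlim \<psi> at_top at_top"
  shows
    "(\<not> summable (\<lambda>k::nat. \<psi> (real k) / (1 + (real k)\<^sup>2)) \<longrightarrow>
       (\<forall>(f :: real ^ 'n \<Rightarrow> complex) (\<Lambda> :: 'n \<Rightarrow> real set).
          integrable torus f \<longrightarrow>
          (\<lambda>k. cmod (fourier_coeff f k) * exp (\<psi> (norm (of_int_vec k)))) summable_on UNIV \<longrightarrow>
          (\<forall>j. positive_measure_subset (\<Lambda> j)) \<longrightarrow>
          (AE x in torus. x \<in> product_set \<Lambda> \<longrightarrow> f x = 0) \<longrightarrow>
          (AE x in torus. f x = 0)))
     \<and>
     (summable (\<lambda>k::nat. \<psi> (real k) / (1 + (real k)\<^sup>2)) \<longrightarrow>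
       (\<exists>(f :: real ^ 'n \<Rightarrow> complex) (\<Lambda> :: 'n \<Rightarrow> real set).
          smooth_on_torus f \<and>
          (\<exists>x. f x \<noteq> 0) \<and>
          (\<forall>j. positive_measure_subset (\<Lambda> j)) \<and>
          (\<forall>x \<in> product_set \<Lambda>. f x = 0) \<and>
          (\<lambda>k. cmod (fourier_coeff f k) * exp (\<psi> (norm (of_int_vec k)))) summable_on UNIV))"
proof (intro conjI impI allI)
  fix f :: "real ^ 'n \<Rightarrow> complex" and \<Lambda> :: "'n \<Rightarrow> real set"
  assume "\<not> summable (\<lambda>k::nat. \<psi> (real k) / (1 + (real k)\<^sup>2))" "integrable torus f"
    "(\<lambda>k. cmod (fourier_coeff f k) * exp (\<psi> (norm (of_int_vec k)))) summable_on UNIV"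
    "\<forall>j. positive_measure_subset (\<Lambda> j)" "AE x in torus. x \<in> product_set \<Lambda> \<longrightarrow> f x = 0"
  then show "AE x in torus. f x = 0"
    by (intro vanishing_if_weight_diverges[OF nonneg incr lim, of f \<Lambda>]) auto
next
  assume sm: "summable (\<lambda>k::nat. \<psi> (real k) / (1 + (real k)\<^sup>2))"
  show "\<exists>(f :: real ^ 'n \<Rightarrow> complex) (\<Lambda> :: 'n \<Rightarrow> real set).
          smooth_on_torus f \<and>
          (\<exists>x. f x \<noteq> 0) \<and>
          (\<forall>j. positive_measure_subset (\<Lambda> j)) \<and>
          (\<forall>x \<in> product_set \<Lambda>. f x = 0) \<and>
          (\<lambda>k. cmod (fourier_coeff f k) * exp (\<psi> (norm (of_int_vec k)))) summable_on UNIV"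
    by (rule smooth_function_vanishing_on_product[OF nonneg incr sm])
qed

end
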